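(* Let $X\in M(\infty)$ be strongly regular. Then $A(\infty)\cdot X\subset GL(\infty)\cdot X$ is an irreducible, Lagrangian ind-subvariety of $GL(\infty)\cdot X$ with respect to the weak symplectic form $\omega_\infty$ on $GL(\infty)\cdot X$.
   Context: Let $\mathfrak g_n=\mathfrak{gl}(n,\mathbb C)$ and $G_n=GL(n,\mathbb C)$, with $\mathfrak g_n\hookrightarrow\mathfrak g_{n+1}$ as the upper left $n\times n$ block (zeros elsewhere) and $G_n\hookrightarrow G_{n+1}$, $g\mapsto\mathrm{diag}(g,1)$. $GL(\infty)=\varinjlim G_n=\bigcup G_n$, $\mathfrak{gl}(\infty)=\varinjlim\mathfrak g_n$. $M(\infty)=\varprojlim\mathfrak g_n$ is the set of sequences $X=(X(1),X(2),\dots)$, $X(n)\in\mathfrak g_n$, such that the upper left $n\times n$ corner of $X(n+1)$ is $X(n)$, i.e. the space of all infinite complex matrices; write $X_n:=X(n)$. It is identified with $\mathfrak{gl}(\infty)^*$ by $X\mapsto(A\in\mathfrak g_n\mapsto\mathrm{tr}(X_nA))$, and the coadjoint action becomes conjugation $\mathrm{Ad}(g)X=gXg^{-1}$. Let $f_{nj}(X)=\mathrm{tr}(X_n^j)$ and $J_\infty=\{f_{nj}:n\in\mathbb N,1\le j\le n\}$. $X$ is strongly regular if the differentials at $X$ of the functions in $J_\infty$ are linearly independent in the cotangent space $T^*_X(M(\infty))=\varinjlim T^*_{X_n}(\mathfrak g_n)$. Let $A(n)=\mathbb C^{\binom n2}=\mathbb C^1\times\dots\times\mathbb C^{n-1}$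 with coordinates $(\underline t_1,\dots,\underline t_{n-1})$, $\underline t_i=(t_{i1},\dots,t_{ii})$, embedded in $A(n+1)$ by appending $\underline t_n=0$; $A(\infty)=\varinjlim A(n)$. $a=(\underline t_1,\dots,\underline t_{n-1})\in A(n)$ acts on $M(\infty)$ by $a\cdot X=\mathrm{Ad}(z_1z_2\cdots z_{n-1})X$, where $z_i=\exp(t_{i1}\mathrm{Id}_i)\cdots\exp(j\,t_{ij}X_i^{j-1})\cdots\exp(i\,t_{ii}X_i^{i-1})\in G_i$. These define an action of $A(\infty)$ on $M(\infty)$ preserving $GL(\infty)$-orbits. The orbit $GL(\infty)\cdot X=\varinjlim G_n\cdot X$ is an ind-variety (direct limit of varieties along locally closed embeddings, final topology; tangent spaces are the direct limits), where $G_n\cdot X\cong G_n/G_n^X$ and $G_n^X$ is the stabilizer of $X$ in $G_n$; for $Y$ in the orbit, $T_Y(GL(\infty)\cdot X)=\mathfrak{gl}(\infty)/\mathfrak{gl}(\infty)^Y$, where $\mathfrak{gl}(\infty)^Y$ is the Lie algebra of the stabilizer of $Y$. The form $\omega_\infty$ is the inverse limit of the pullbacks to $G_n\cdot X$ of the Kostant–Kirillov forms on the orbits $G_n\cdot X_n\subset\mathfrak g_n$; explicitly $(\omega_\infty)_Y(A+\mathfrak{gl}(\infty)^Y,B+\mathfrak{gl}(\infty)^Y)=\mathrm{tr}(Y_n[A,B])$ for $A,B\in\mathfrak g_n$. An ind-subvariety $\mathcal L\subseteq GL(\infty)\cdot X$ is a subset such that each $\mathcal L_n=\mathcal L\cap(G_n\cdot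 X)$ is a locally closed subvariety of $G_n\cdot X$; then $\mathcal L=\varinjlim\mathcal L_n$ and $T_Y(\mathcal L)=\varinjlim T_Y(\mathcal L_n)$. It is Lagrangian if for every $Y\in\mathcal L$, $T_Y(\mathcal L)$ equals its annihilator $T_Y(\mathcal L)^\perp$ in $T_Y(GL(\infty)\cdot X)$ with respect to $(\omega_\infty)_Y$. It is irreducible if its underlying topological space is. *)

theory Defs
  imports
    "HOL-Analysis.Analysis"
    "HOL-Library.Groups_Big_Fun"
    "Jordan_Normal_Form.Matrix"
begin

section \<open>Infinite matrices\<close>

text \<open>
  Rows and columns are numbered from 0. A point of \<open>M(\<infinity>)\<close>, the inverse limit of the spaces
  \<open>gl(n)\<close>, is given by its entries; \<open>bij_betw_corner\<close> below is the identification with the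
  compatible sequences \<open>(X(1), X(2), \<dots>)\<close>. The direct limits \<open>gl(\<infinity>)\<close> and \<open>GL(\<infinity>)\<close> consist
  of infinite matrices as well, with \<open>A \<in> gl(n)\<close> padded by zeros and \<open>g \<in> GL(n)\<close> padded by an
  infinite identity block, so that the direct limits are unions. Every family indexed by \<open>n\<close>
  below also has a term \<open>n = 0\<close>, which is a single point throughout.
\<close>

type_synonym infmat = "nat \<Rightarrow> nat \<Rightarrow> complex"

definition corner :: "nat \<Rightarrow> infmat \<Rightarrow> complex mat" where
  "corner n X = mat n n (\<lambda>(i, j). X i j)"

lemma corner_carrier [simp]: "corner n X \<in> carrier_mat n n"
  by (simp add: corner_def)

lemma corner_index [simp]: "i < n \<Longrightarrow> j < n \<Longrightarrow> corner n X $$ (i, j) = X i j"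
  by (simp add: corner_def)

lemma bij_betw_corner:
  "bij_betw (\<lambda>X n. corner n X) UNIV
     {S. \<forall>n. S n \<in> carrier_mat n n \<and> mat n n (\<lambda>ij. S (Suc n) $$ ij) = S n}"
proof (rule bij_betwI')
  fix X Y :: infmat
  show "((\<lambda>n. corner n X) = (\<lambda>n. corner n Y)) = (X = Y)"
  proof
    assume eq: "(\<lambda>n. corner n X) = (\<lambda>n. corner n Y)"
    show "X = Y"
    proof (intro ext)
      fix i j
      have "corner (Suc (max i j)) X $$ (i, j) = corner (Suc (max i j)) Y $$ (i, j)"
        using fun_cong[OF eq, of "Suc (max i j)"] by simp
      then show "X i j = Y i j" by simp
    qed
  qed simp
next
  fix X :: infmat
  show "(\<lambda>n. corner n X) \<in> {S. \<forall>n. S n \<in> carrier_mat n n \<and> mat n n (\<lambda>ij. S (Suc n) $$ ij) = S n}"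
    by (auto intro!: eq_matI simp: corner_def)
next
  fix S :: "nat \<Rightarrow> complex mat"
  assume "S \<in> {S. \<forall>n. S n \<in> carrier_mat n n \<and> mat n n (\<lambda>ij. S (Suc n) $$ ij) = S n}"
  then have c: "S n \<in> carrier_mat n n" and r: "mat n n (\<lambda>ij. S (Suc n) $$ ij) = S n" for n
    by auto
  have step: "S (Suc n) $$ (i, j) = S n $$ (i, j)" if "i < n" "j < n" for n i j
    using that by (subst r[symmetric]) simp
  have up: "S (k + n) $$ (i, j) = S n $$ (i, j)" if "i < n" "j < n" for n i j k
    using that by (induction k) (auto simp: step)
  define X :: infmat where "X i j = S (Suc (max i j)) $$ (i, j)" for i j
  have "corner n X = S n" for n
  proof (rule eq_matI)
    fix i j assume "i < dim_row (S n)" "j < dim_col (S n)"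
    then have ij: "i < n" "j < n" using c[of n] by auto
    then have "S (n - Suc (max i j) + Suc (max i j)) $$ (i, j) = S (Suc (max i j)) $$ (i, j)"
      by (intro up) auto
    then show "corner n X $$ (i, j) = S n $$ (i, j)" using ij by (simp add: X_def)
  qed (use c[of n] in \<open>auto simp: corner_def\<close>)
  then show "\<exists>X\<in>UNIV. S = (\<lambda>n. corner n X)" by (intro bexI[of _ X]) (auto intro!: ext)
qed

text \<open>\<open>Sum_any\<close> ranges over the indices with nonzero summand; all products used below have
  finitely many of these, since one factor is in \<open>GL(\<infinity>)\<close>.\<close>

definition inf_mult :: "infmat \<Rightarrow> infmat \<Rightarrow> infmat" where
  "inf_mult A B = (\<lambda>i j. Sum_any (\<lambda>k. A i k * B k j))"

definition inf_one :: infmat where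
  "inf_one = (\<lambda>i j. if i = j then 1 else 0)"

definition GL_embed :: "nat \<Rightarrow> complex mat \<Rightarrow> infmat" where
  "GL_embed n g = (\<lambda>i j. if i < n \<and> j < n then g $$ (i, j) else inf_one i j)"

definition gl :: "nat \<Rightarrow> infmat set" where
  "gl n = {A. \<forall>i j. n \<le> i \<or> n \<le> j \<longrightarrow> A i j = 0}"

definition gl_inf :: "infmat set" where
  "gl_inf = (\<Union>n. gl n)"

definition GL :: "nat \<Rightarrow> infmat set" where
  "GL n = GL_embed n ` {g \<in> carrier_mat n n. invertible_mat g}"

definition GL_inf :: "infmat monoid" where
  "GL_inf = \<lparr>carrier = (\<Union>n. GL n), monoid.mult = inf_mult, one = inf_one\<rparr>"

definition Ad :: "infmat \<Rightarrow> infmat \<Rightarrow> infmat" where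
  "Ad g X = inf_mult (inf_mult g X) (inv\<^bsub>GL_inf\<^esub> g)"

lemma GL_embed_mono:
  assumes "g \<in> carrier_mat n n" "n \<le> m"
  shows "GL_embed n g = GL_embed m (corner m (GL_embed n g))"
  using assms by (auto simp: GL_embed_def inf_one_def intro!: ext)

lemma inf_mult_eq_sum:
  assumes "\<And>k. n \<le> k \<Longrightarrow> A i k * B k j = 0"
  shows "inf_mult A B i j = (\<Sum>k<n. A i k * B k j)"
  unfolding inf_mult_def
  by (rule Sum_any.expand_superset) (use assms in \<open>force simp: not_less[symmetric]\<close>)+

lemma inf_mult_GL_embed:
  assumes g: "g \<in> carrier_mat n n" and h: "h \<in> carrier_mat n n"
  shows "inf_mult (GL_embed n g) (GL_embed n h) = GL_embed n (g * h)"
proof (intro ext)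
  fix i j
  show "inf_mult (GL_embed n g) (GL_embed n h) i j = GL_embed n (g * h) i j"
  proof (cases "i < n")
    case True
    then have "inf_mult (GL_embed n g) (GL_embed n h) i j
        = (\<Sum>k<n. GL_embed n g i k * GL_embed n h k j)"
      by (intro inf_mult_eq_sum) (auto simp: GL_embed_def inf_one_def)
    also have "\<dots> = GL_embed n (g * h) i j"
      using True g h
      by (auto simp: GL_embed_def inf_one_def scalar_prod_def lessThan_atLeast0 intro!: sum.cong)
    finally show ?thesis .
  next
    case False
    then have "inf_mult (GL_embed n g) (GL_embed n h) i j
        = (\<Sum>k<Suc i. GL_embed n g i k * GL_embed n h k j)"
      by (intro inf_mult_eq_sum) (auto simp: GL_embed_def inf_one_def)
    also have "\<dots> = GL_embed n (g * h) i j"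
      using False by (auto simp: GL_embed_def inf_one_def)
    finally show ?thesis .
  qed
qed

lemma GL_embed_one: "GL_embed n (1\<^sub>m n) = inf_one"
  by (auto simp: GL_embed_def inf_one_def intro!: ext)

lemma GL_I:
  assumes "g \<in> carrier_mat n n" "h \<in> carrier_mat n n" "g * h = 1\<^sub>m n" "h * g = 1\<^sub>m n"
  shows "GL_embed n g \<in> GL n"
  using assms unfolding GL_def invertible_mat_def inverts_mat_def
  by (intro imageI CollectI conjI exI[of _ h]) auto

lemma GL_E:
  assumes "g \<in> GL n"
  obtains a b where "g = GL_embed n a" "a \<in> carrier_mat n n" "b \<in> carrier_mat n n"
    "a * b = 1\<^sub>m n" "b * a = 1\<^sub>m n"
proof -
  from assms obtain a b where ab: "g = GL_embed n a" "a \<in> carrier_mat n n"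
    "a * b = 1\<^sub>m n" "b * a = 1\<^sub>m (dim_row b)"
    unfolding GL_def invertible_mat_def inverts_mat_def by auto
  have "dim_col b = n" using arg_cong[OF ab(3), of dim_col] by simp
  moreover have "dim_row b = n" using arg_cong[OF ab(4), of dim_col] ab(2) by simp
  ultimately show thesis using ab that by auto
qed

lemma GL_mono:
  assumes "n \<le> m"
  shows "GL n \<subseteq> GL m"
proof
  fix g assume "g \<in> GL n"
  then obtain a b where ab: "g = GL_embed n a" "a \<in> carrier_mat n n" "b \<in> carrier_mat n n"
    "a * b = 1\<^sub>m n" "b * a = 1\<^sub>m n" by (rule GL_E)
  define a' b' where "a' = corner m (GL_embed n a)" and "b' = corner m (GL_embed n b)"
  have eq: "GL_embed n a = GL_embed m a'" "GL_embed n b = GL_embed m b'"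
    unfolding a'_def b'_def using ab assms by (auto intro: GL_embed_mono)
  have car: "a' \<in> carrier_mat m m" "b' \<in> carrier_mat m m" by (auto simp: a'_def b'_def)
  have inj: "c = d" if "GL_embed m c = GL_embed m d" "c \<in> carrier_mat m m" "d \<in> carrier_mat m m"
    for c d
  proof (rule eq_matI)
    fix i j assume "i < dim_row d" "j < dim_col d"
    then show "c $$ (i, j) = d $$ (i, j)"
      using fun_cong[OF fun_cong[OF that(1)], of i j] that by (auto simp: GL_embed_def)
  qed (use that in auto)
  have "GL_embed m (a' * b') = GL_embed m (1\<^sub>m m)"
    using car ab(2-) by (metis eq inf_mult_GL_embed GL_embed_one)
  moreover have "GL_embed m (b' * a') = GL_embed m (1\<^sub>m m)"
    using car ab(2-) by (metis eq inf_mult_GL_embed GL_embed_one)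
  ultimately show "g \<in> GL m"
    unfolding ab(1) eq using car by (intro GL_I[of _ _ b']) (auto intro!: inj)
qed

lemma group_GL_inf: "group GL_inf"
proof (rule groupI)
  have common: "\<exists>n. g \<in> GL n \<and> h \<in> GL n \<and> k \<in> GL n"
    if "g \<in> carrier GL_inf" "h \<in> carrier GL_inf" "k \<in> carrier GL_inf" for g h k
  proof -
    from that obtain p q r where "g \<in> GL p" "h \<in> GL q" "k \<in> GL r" by (auto simp: GL_inf_def)
    then show ?thesis
      by (intro exI[of _ "max p (max q r)"])
        (auto simp: le_max_iff_disj intro: subsetD[OF GL_mono, rotated])
  qed
  show "g \<otimes>\<^bsub>GL_inf\<^esub> h \<in> carrier GL_inf" if gh: "g \<in> carrier GL_inf" "h \<in> carrier GL_inf" for g h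
  proof -
    obtain n where n: "g \<in> GL n" "h \<in> GL n" using common[OF gh gh(2)] by auto
    obtain a b where ab: "g = GL_embed n a" "a \<in> carrier_mat n n" "b \<in> carrier_mat n n"
      "a * b = 1\<^sub>m n" "b * a = 1\<^sub>m n" using n(1) by (rule GL_E)
    obtain c d where cd: "h = GL_embed n c" "c \<in> carrier_mat n n" "d \<in> carrier_mat n n"
      "c * d = 1\<^sub>m n" "d * c = 1\<^sub>m n" using n(2) by (rule GL_E)
    have "c * (d * b) = b" "b * (a * c) = c"
      using ab cd assoc_mult_mat[of c n n d n b n] assoc_mult_mat[of b n n a n c n] by simp_all
    then have "(a * c) * (d * b) = 1\<^sub>m n" "(d * b) * (a * c) = 1\<^sub>m n"
      using ab cd by (simp_all add: assoc_mult_mat[of _ n n _ n _ n])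
    then have "GL_embed n (a * c) \<in> GL n" using ab cd by (intro GL_I[of _ _ "d * b"]) auto
    then show ?thesis using ab cd by (auto simp: GL_inf_def inf_mult_GL_embed)
  qed
  show "\<one>\<^bsub>GL_inf\<^esub> \<in> carrier GL_inf"
    using GL_I[of "1\<^sub>m 0" 0 "1\<^sub>m 0"] by (auto simp: GL_inf_def GL_embed_one)
  show "g \<otimes>\<^bsub>GL_inf\<^esub> h \<otimes>\<^bsub>GL_inf\<^esub> k = g \<otimes>\<^bsub>GL_inf\<^esub> (h \<otimes>\<^bsub>GL_inf\<^esub> k)"
    if ghk: "g \<in> carrier GL_inf" "h \<in> carrier GL_inf" "k \<in> carrier GL_inf" for g h k
  proof -
    obtain n where n: "g \<in> GL n" "h \<in> GL n" "k \<in> GL n" using common[OF ghk] by auto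
    obtain a where "g = GL_embed n a" "a \<in> carrier_mat n n" using n(1) by (rule GL_E)
    moreover obtain b where "h = GL_embed n b" "b \<in> carrier_mat n n" using n(2) by (rule GL_E)
    moreover obtain c where "k = GL_embed n c" "c \<in> carrier_mat n n" using n(3) by (rule GL_E)
    ultimately show ?thesis
      by (simp add: GL_inf_def inf_mult_GL_embed assoc_mult_mat[of _ n n _ n _ n])
  qed
  show "\<one>\<^bsub>GL_inf\<^esub> \<otimes>\<^bsub>GL_inf\<^esub> g = g" if g: "g \<in> carrier GL_inf" for g
  proof -
    obtain n where "g \<in> GL n" using common[OF g g g] by auto
    then obtain a where "g = GL_embed n a" "a \<in> carrier_mat n n" by (rule GL_E)
    then show ?thesis
      by (simp add: GL_inf_def GL_embed_one[of n, symmetric] inf_mult_GL_embed)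
  qed
  show "\<exists>h\<in>carrier GL_inf. h \<otimes>\<^bsub>GL_inf\<^esub> g = \<one>\<^bsub>GL_inf\<^esub>" if g: "g \<in> carrier GL_inf" for g
  proof -
    obtain n where "g \<in> GL n" using common[OF g g g] by auto
    then obtain a b where ab: "g = GL_embed n a" "a \<in> carrier_mat n n" "b \<in> carrier_mat n n"
      "a * b = 1\<^sub>m n" "b * a = 1\<^sub>m n" by (rule GL_E)
    then have "GL_embed n b \<in> GL n" by (intro GL_I[of b n a])
    then show ?thesis
      using ab by (intro bexI[of _ "GL_embed n b"])
        (auto simp: GL_inf_def inf_mult_GL_embed GL_embed_one)
  qed
qed


section \<open>Strong regularity\<close>

definition mtrace :: "complex mat \<Rightarrow> complex" where
  "mtrace A = (\<Sum>i<dim_row A. A $$ (i, i))"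

definition f_tr :: "nat \<Rightarrow> nat \<Rightarrow> infmat \<Rightarrow> complex" where
  "f_tr n j X = mtrace (corner n X ^\<^sub>m j)"

text \<open>\<open>T*\<^sub>X(M(\<infinity>))\<close> is the direct limit of the spaces of linear forms on \<open>gl(n)\<close>; along the
  surjections \<open>M(\<infinity>) \<rightarrow> gl(n)\<close> it becomes a space of linear forms on \<open>M(\<infinity>)\<close>.\<close>

definition differential :: "(infmat \<Rightarrow> complex) \<Rightarrow> infmat \<Rightarrow> infmat \<Rightarrow> complex" where
  "differential f X Z = deriv (\<lambda>s. f (\<lambda>i j. X i j + s * Z i j)) 0"

definition strongly_regular :: "infmat \<Rightarrow> bool" where
  "strongly_regular X \<longleftrightarrow>
     (\<forall>F c. finite F \<and> F \<subseteq> {(n, j). 1 \<le> j \<and> j \<le> n} \<and>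
        (\<forall>Z. (\<Sum>(n, j)\<in>F. c (n, j) * differential (f_tr n j) X Z) = 0)
        \<longrightarrow> (\<forall>p\<in>F. c p = 0))"


section \<open>The action of \<open>A(\<infinity>)\<close>\<close>

definition mat_exp :: "complex mat \<Rightarrow> complex mat" where
  "mat_exp A = mat (dim_row A) (dim_col A) (\<lambda>(i, j). suminf (\<lambda>k. (A ^\<^sub>m k) $$ (i, j) / fact k))"

text \<open>An element of \<open>A(n)\<close> is a family \<open>t i j\<close> with \<open>1 \<le> j \<le> i \<le> n - 1\<close>, padded by zeros.\<close>

definition A_space :: "nat \<Rightarrow> (nat \<Rightarrow> nat \<Rightarrow> complex) set" where
  "A_space n = {t. \<forall>i j. \<not> (1 \<le> j \<and> j \<le> i \<and> i < n) \<longrightarrow> t i j = 0}"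

definition A_factor :: "(nat \<Rightarrow> nat \<Rightarrow> complex) \<Rightarrow> infmat \<Rightarrow> nat \<Rightarrow> complex mat" where
  "A_factor t X i =
     foldr (*) (map (\<lambda>j. mat_exp ((of_nat j * t i j) \<cdot>\<^sub>m (corner i X ^\<^sub>m (j - 1)))) [1..<Suc i])
       (1\<^sub>m i)"

definition A_act :: "nat \<Rightarrow> (nat \<Rightarrow> nat \<Rightarrow> complex) \<Rightarrow> infmat \<Rightarrow> infmat" where
  "A_act n t X =
     Ad (foldr (\<lambda>g h. g \<otimes>\<^bsub>GL_inf\<^esub> h) (map (\<lambda>i. GL_embed i (A_factor t X i)) [1..<n]) \<one>\<^bsub>GL_inf\<^esub>) X"

definition A_orbit :: "infmat \<Rightarrow> infmat set" where
  "A_orbit X = (\<Union>n. (\<lambda>t. A_act n t X) ` A_space n)"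


section \<open>Orbits as varieties\<close>

definition G_orbit :: "nat \<Rightarrow> infmat \<Rightarrow> infmat set" where
  "G_orbit n X = (\<lambda>g. Ad g X) ` GL n"

definition GL_inf_orbit :: "infmat \<Rightarrow> infmat set" where
  "GL_inf_orbit X = (\<Union>n. G_orbit n X)"

definition stab :: "nat \<Rightarrow> infmat \<Rightarrow> infmat set" where
  "stab n Y = {g \<in> GL n. Ad g Y = Y}"

inductive_set poly_funs :: "nat \<Rightarrow> (infmat \<Rightarrow> complex) set" for n where
  const: "(\<lambda>g. c) \<in> poly_funs n"
| coord: "i < n \<Longrightarrow> j < n \<Longrightarrow> (\<lambda>g. g i j) \<in> poly_funs n"
| add: "p \<in> poly_funs n \<Longrightarrow> q \<in> poly_funs n \<Longrightarrow> (\<lambda>g. p g + q g) \<in> poly_funs n"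
| mult: "p \<in> poly_funs n \<Longrightarrow> q \<in> poly_funs n \<Longrightarrow> (\<lambda>g. p g * q g) \<in> poly_funs n"

definition zariski_GL :: "nat \<Rightarrow> infmat topology" where
  "zariski_GL n = topology (\<lambda>U. \<exists>S\<subseteq>poly_funs n. U = {g \<in> GL n. \<exists>p\<in>S. p g \<noteq> 0})"

lemma istopology_zariski_GL:
  "istopology (\<lambda>U. \<exists>S\<subseteq>poly_funs n. U = {g \<in> GL n. \<exists>p\<in>S. p g \<noteq> 0})"
  unfolding istopology_def
proof (intro conjI allI impI)
  fix U V
  assume "\<exists>S\<subseteq>poly_funs n. U = {g \<in> GL n. \<exists>p\<in>S. p g \<noteq> 0}"
    and "\<exists>S\<subseteq>poly_funs n. V = {g \<in> GL n. \<exists>p\<in>S. p g \<noteq> 0}"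
  then obtain S S' where S: "S \<subseteq> poly_funs n" "U = {g \<in> GL n. \<exists>p\<in>S. p g \<noteq> 0}"
    and S': "S' \<subseteq> poly_funs n" "V = {g \<in> GL n. \<exists>p\<in>S'. p g \<noteq> 0}" by auto
  define P where "P = (\<lambda>(p, q) g. p g * q g) ` (S \<times> S')"
  have eq: "(\<exists>r\<in>P. r g \<noteq> 0) \<longleftrightarrow> (\<exists>p\<in>S. p g \<noteq> 0) \<and> (\<exists>q\<in>S'. q g \<noteq> 0)" for g
    by (auto simp: P_def)
  have "P \<subseteq> poly_funs n" using S(1) S'(1) by (auto simp: P_def intro: poly_funs.mult)
  moreover have "U \<inter> V = {g \<in> GL n. \<exists>p\<in>P. p g \<noteq> 0}"
    unfolding eq by (simp only: S(2) S'(2) Collect_conj_eq) (simp only: Int_ac)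
  ultimately show "\<exists>S\<subseteq>poly_funs n. U \<inter> V = {g \<in> GL n. \<exists>p\<in>S. p g \<noteq> 0}"
    by (intro exI conjI)
next
  fix K
  assume K: "\<forall>U\<in>K. \<exists>S\<subseteq>poly_funs n. U = {g \<in> GL n. \<exists>p\<in>S. p g \<noteq> 0}"
  then have "\<forall>U\<in>K. \<exists>S. S \<subseteq> poly_funs n \<and> U = {g \<in> GL n. \<exists>p\<in>S. p g \<noteq> 0}" by simp
  from bchoice[OF this] obtain S
    where S: "\<forall>U\<in>K. S U \<subseteq> poly_funs n \<and> U = {g \<in> GL n. \<exists>p\<in>S U. p g \<noteq> 0}" by (elim exE)
  show "\<exists>S\<subseteq>poly_funs n. \<Union>K = {g \<in> GL n. \<exists>p\<in>S. p g \<noteq> 0}"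
  proof (intro exI conjI)
    show "(\<Union>U\<in>K. S U) \<subseteq> poly_funs n" using S by (intro UN_least) simp
    show "\<Union>K = {g \<in> GL n. \<exists>p\<in>(\<Union>U\<in>K. S U). p g \<noteq> 0}"
    proof (rule Set.set_eqI)
      fix g
      have "g \<in> U \<longleftrightarrow> g \<in> GL n \<and> (\<exists>p\<in>S U. p g \<noteq> 0)" if "U \<in> K" for U
      proof -
        have "U = {g \<in> GL n. \<exists>p\<in>S U. p g \<noteq> 0}" using S that by (rule_tac conjunct2, rule bspec)
        from arg_cong[OF this, of "\<lambda>V. g \<in> V"] show ?thesis by (simp only: mem_Collect_eq)
      qed
      then have "(\<exists>U\<in>K. g \<in> U) \<longleftrightarrow> (\<exists>U\<in>K. g \<in> GL n \<and> (\<exists>p\<in>S U. p g \<noteq> 0))"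
        by (intro bex_cong refl)
      then show "g \<in> \<Union>K \<longleftrightarrow> g \<in> {g \<in> GL n. \<exists>p\<in>(\<Union>U\<in>K. S U). p g \<noteq> 0}"
        by (simp only: Union_iff mem_Collect_eq UN_iff bex_simps) blast
    qed
  qed
qed

definition final_topology ::
  "'a set \<Rightarrow> 'i set \<Rightarrow> ('i \<Rightarrow> 'b topology) \<Rightarrow> ('i \<Rightarrow> 'b \<Rightarrow> 'a) \<Rightarrow> 'a topology" where
  "final_topology S I T f =
     topology (\<lambda>U. U \<subseteq> S \<and> (\<forall>i\<in>I. openin (T i) {x \<in> topspace (T i). f i x \<in> U}))"

lemma istopology_final_topology:
  "istopology (\<lambda>U. U \<subseteq> S \<and> (\<forall>i\<in>I. openin (T i) {x \<in> topspace (T i). f i x \<in> U}))"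
  unfolding istopology_def
proof (intro conjI allI impI ballI)
  fix U V i
  assume "U \<subseteq> S \<and> (\<forall>i\<in>I. openin (T i) {x \<in> topspace (T i). f i x \<in> U})"
    and "V \<subseteq> S \<and> (\<forall>i\<in>I. openin (T i) {x \<in> topspace (T i). f i x \<in> V})" and "i \<in> I"
  then have "openin (T i) ({x \<in> topspace (T i). f i x \<in> U} \<inter> {x \<in> topspace (T i). f i x \<in> V})"
    by (intro openin_Int) auto
  then show "openin (T i) {x \<in> topspace (T i). f i x \<in> U \<inter> V}"
    by (rule back_subst[where P = "openin (T i)"]) auto
next
  fix K i
  assume "\<forall>U\<in>K. U \<subseteq> S \<and> (\<forall>i\<in>I. openin (T i) {x \<in> topspace (T i). f i x \<in> U})" and "i \<in> I"
  then have "openin (T i) (\<Union>U\<in>K. {x \<in> topspace (T i). f i x \<in> U})"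
    by (intro openin_Union) auto
  then show "openin (T i) {x \<in> topspace (T i). f i x \<in> \<Union>K}"
    by (rule back_subst[where P = "openin (T i)"]) auto
qed auto

text \<open>The orbit \<open>G\<^sub>n \<cdot> X\<close> carries the structure of the quotient variety \<open>G\<^sub>n / G\<^sub>n\<^sup>X\<close>, transported
  along \<open>g \<mapsto> Ad g X\<close>: its topology is the quotient topology, and its regular functions are
  those whose pullback to \<open>G\<^sub>n\<close> is regular, i.e. locally a quotient of polynomials.\<close>

definition zariski_orbit :: "nat \<Rightarrow> infmat \<Rightarrow> infmat topology" where
  "zariski_orbit n X =
     final_topology (G_orbit n X) {()} (\<lambda>_. zariski_GL n) (\<lambda>_ g. Ad g X)"

definition regular_fun_GL :: "nat \<Rightarrow> infmat set \<Rightarrow> (infmat \<Rightarrow> complex) \<Rightarrow> bool" where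
  "regular_fun_GL n V F \<longleftrightarrow>
     (\<forall>g\<in>V. \<exists>W p q. openin (zariski_GL n) W \<and> g \<in> W \<and> W \<subseteq> V \<and> p \<in> poly_funs n \<and> q \<in> poly_funs n \<and>
        (\<forall>h\<in>W. q h \<noteq> 0 \<and> F h = p h / q h))"

definition regular_fun_orbit :: "nat \<Rightarrow> infmat \<Rightarrow> infmat set \<Rightarrow> (infmat \<Rightarrow> complex) \<Rightarrow> bool" where
  "regular_fun_orbit n X U f \<longleftrightarrow>
     openin (zariski_orbit n X) U \<and> regular_fun_GL n {g \<in> GL n. Ad g X \<in> U} (\<lambda>g. f (Ad g X))"

definition locally_closed_in :: "'a topology \<Rightarrow> 'a set \<Rightarrow> bool" where
  "locally_closed_in T S \<longleftrightarrow> (\<exists>U C. openin T U \<and> closedin T C \<and> S = U \<inter> C)"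

definition ind_subvariety :: "infmat \<Rightarrow> infmat set \<Rightarrow> bool" where
  "ind_subvariety X L \<longleftrightarrow>
     L \<subseteq> GL_inf_orbit X \<and>
     (\<forall>n. locally_closed_in (zariski_orbit n X) (L \<inter> G_orbit n X))"

definition ind_topology :: "infmat \<Rightarrow> infmat set \<Rightarrow> infmat topology" where
  "ind_topology X L =
     final_topology L UNIV (\<lambda>n. subtopology (zariski_orbit n X) (L \<inter> G_orbit n X)) (\<lambda>n Y. Y)"

definition irreducible_top :: "'a topology \<Rightarrow> bool" where
  "irreducible_top T \<longleftrightarrow>
     topspace T \<noteq> {} \<and>
     (\<forall>C D. closedin T C \<and> closedin T D \<and> C \<union> D = topspace T \<longrightarrow> C = topspace T \<or> D = topspace T)"


section \<open>Tangent spaces and the symplectic form\<close>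

definition gl_exp :: "nat \<Rightarrow> infmat \<Rightarrow> infmat" where
  "gl_exp n A = GL_embed n (mat_exp (corner n A))"

definition lie_algebra :: "nat \<Rightarrow> infmat set \<Rightarrow> infmat set" where
  "lie_algebra n H = {A \<in> gl n. \<forall>s::complex. gl_exp n (\<lambda>i j. s * A i j) \<in> H}"

definition gl_inf_stab :: "infmat \<Rightarrow> infmat set" where
  "gl_inf_stab Y = (\<Union>n. lie_algebra n (stab n Y))"

definition tangent_class :: "infmat \<Rightarrow> infmat \<Rightarrow> infmat set" where
  "tangent_class Y A = {B \<in> gl_inf. (\<lambda>i j. B i j - A i j) \<in> gl_inf_stab Y}"

definition tangent_orbit :: "infmat \<Rightarrow> infmat set set" where
  "tangent_orbit Y = tangent_class Y ` gl_inf"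

text \<open>
  The Zariski tangent space at \<open>Y\<close> of the (reduced) subvariety \<open>S\<close> of \<open>G\<^sub>n \<cdot> X\<close>, as the space of
  tangent vectors of \<open>G\<^sub>n \<cdot> X\<close> at \<open>Y\<close> that annihilate all germs at \<open>Y\<close> of regular functions
  vanishing on \<open>S\<close>. The tangent vector \<open>A + gl(n)\<^sup>Y\<close> acts by differentiation along the curve
  \<open>s \<mapsto> Ad (exp (s A)) Y\<close>; its class is taken directly in \<open>gl(\<infinity>) / gl(\<infinity>)\<^sup>Y\<close>, which contains
  \<open>gl(n) / gl(n)\<^sup>Y\<close>.
\<close>

definition tangent_sub :: "nat \<Rightarrow> infmat \<Rightarrow> infmat set \<Rightarrow> infmat \<Rightarrow> infmat set set" where
  "tangent_sub n X S Y = tangent_class Y `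
     {A \<in> gl n. \<forall>U f. Y \<in> U \<and> regular_fun_orbit n X U f \<and> (\<forall>Z\<in>S \<inter> U. f Z = 0) \<longrightarrow>
        ((\<lambda>s. f (Ad (gl_exp n (\<lambda>i j. s * A i j)) Y)) has_field_derivative 0) (at (0::complex))}"

definition tangent_ind :: "infmat \<Rightarrow> infmat set \<Rightarrow> infmat \<Rightarrow> infmat set set" where
  "tangent_ind X L Y = (\<Union>n\<in>{n. Y \<in> L \<inter> G_orbit n X}. tangent_sub n X (L \<inter> G_orbit n X) Y)"

text \<open>The value \<open>tr(Y\<^sub>n [A, B])\<close> depends neither on \<open>n\<close> nor on the representatives \<open>A\<close>, \<open>B\<close>, since
  \<open>tr(Y\<^sub>n [C, B]) = tr([Y\<^sub>n, C] B) = 0\<close> when \<open>C \<in> gl(n)\<close> commutes with \<open>Y\<^sub>n\<close>.\<close>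

definition omega :: "infmat \<Rightarrow> infmat set \<Rightarrow> infmat set \<Rightarrow> complex" where
  "omega Y v w =
     (THE c. \<exists>n. \<exists>A\<in>v \<inter> gl n. \<exists>B\<in>w \<inter> gl n.
        c = mtrace (corner n Y * (corner n A * corner n B - corner n B * corner n A)))"

definition annihilator :: "infmat \<Rightarrow> infmat set set \<Rightarrow> infmat set set" where
  "annihilator Y W = {v \<in> tangent_orbit Y. \<forall>w\<in>W. omega Y v w = 0}"

definition lagrangian :: "infmat \<Rightarrow> infmat set \<Rightarrow> bool" where
  "lagrangian X L \<longleftrightarrow> (\<forall>Y\<in>L. tangent_ind X L Y = annihilator Y (tangent_ind X L Y))"

end

theory Submission
  imports
    Defs
    "Jordan_Normal_Form.Determinant"
    "HOL-Computational_Algebra.Fundamental_Theorem_Algebra"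
begin

text \<open>
  The differential of \<open>f\<^sub>i\<^sub>j\<close> at \<open>X\<close> is \<open>j tr(X\<^sub>i\<^sup>j\<^sup>-\<^sup>1 \<cdot>)\<close>, so strong regularity says that the powers
  \<open>X\<^sub>i\<^sup>j\<close> with \<open>j < i\<close>, all \<open>i\<close> together, are linearly independent in \<open>gl(\<infinity>)\<close>. Each \<open>X\<^sub>i\<close> is
  therefore nonderogatory, its centralizer in \<open>gl(i)\<close> is \<open>\<complex>[X\<^sub>i]\<close>, and no nonzero element of
  \<open>gl(i)\<close> commutes with \<open>X\<^sub>i\<^sub>+\<^sub>1\<close>. The last property makes all stabilizers trivial: the orbit
  of \<open>GL(n)\<close> is a copy of \<open>GL(n)\<close>. Since the exponential maps \<open>\<complex>[X\<^sub>i]\<close> onto its group of units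
  \<open>Z\<^sub>i\<close>, the part of \<open>A(\<infinity>) \<cdot> X\<close> in that orbit corresponds to the product set
  \<open>L\<^sub>n = Z\<^sub>1 \<cdots> Z\<^sub>n\<close>, which is irreducible because any two of its points lie on a polynomial
  curve. It is locally closed because the factor \<open>z \<in> Z\<^sub>n\<close> of \<open>g \<in> L\<^sub>n\<close> is locally a rational
  function of \<open>g\<close>, determined by its last row and by its action on the last column of \<open>g\<^sup>-\<^sup>1\<close>.
  At \<open>Y\<close> in the orbit, the flows of \<open>A(\<infinity>)\<close> show that the tangent space contains
  \<open>V = \<Sum>\<^sub>i \<complex>[Y\<^sub>i]\<close>, the functions \<open>f\<^sub>i\<^sub>j\<close> (constant on the orbit) that it is contained in
  \<open>V\<^sup>\<bottom>\<close>, and a dimension count gives \<open>V = V\<^sup>\<bottom>\<close>.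
\<close>

hide_const (open) Determinants.det Module.smult

section \<open>The ring of row- and column-finite matrices\<close>

text \<open>Two devices shape the proof. The action applies the last factor of
  \<open>z_1 ... z_n\<close> first, and \<open>z_n\<close> fixes the corner of size
  \<open>n\<close>; so inductions split off the last factor and continue at the moved point, whose
  corners up to size \<open>n\<close> are unchanged. It follows that the corner of size
  \<open>i + 1\<close> is only conjugated by elements of \<open>GL(i)\<close>, which is why the
  consequences of strong regularity persist at every \<open>Y\<close> in the orbit of
  \<open>A(\<infinity>)\<close>; an arbitrary conjugate of \<open>X\<close> need not have them. The
  other device is to calculate in one ring of infinite matrices in which each \<open>gl(n)\<close>
  is cut out by an idempotent, so that all sizes coexist without conversion. Two points are
  delicate. The flow of a sum of elements of different centralizers may leave the orbit, so tangency
  of \<open>V\<close> needs linearity of derivatives and not flows alone. And the exponential is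
  shown to reach every unit of \<open>\<complex>[X_i]\<close> by building a polynomial logarithm one
  root of the minimal polynomial at a time, without Jordan forms.\<close>

definition rc_finite :: "infmat \<Rightarrow> bool" where
  "rc_finite A \<longleftrightarrow> (\<forall>i. \<exists>N. \<forall>k\<ge>N. A i k = 0) \<and> (\<forall>j. \<exists>N. \<forall>k\<ge>N. A k j = 0)"

lemma inf_mult_sum_row:
  assumes "\<And>k. N \<le> k \<Longrightarrow> A i k = 0"
  shows "inf_mult A B i j = (\<Sum>k<N. A i k * B k j)"
  using assms by (intro inf_mult_eq_sum) simp

lemma inf_mult_sum_col:
  assumes "\<And>k. N \<le> k \<Longrightarrow> B k j = 0"
  shows "inf_mult A B i j = (\<Sum>k<N. A i k * B k j)"
  using assms by (intro inf_mult_eq_sum) simp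

lemma rc_finite_row_bound:
  assumes "rc_finite A"
  obtains N where "\<And>i k. i < n \<Longrightarrow> N \<le> k \<Longrightarrow> A i k = 0"
proof -
  from assms obtain f where f: "\<And>i k. f i \<le> k \<Longrightarrow> A i k = 0"
    unfolding rc_finite_def by metis
  show thesis
  proof (rule that[of "\<Sum>i<n. f i"])
    fix i k assume "i < n" "(\<Sum>i<n. f i) \<le> k"
    moreover have "f i \<le> (\<Sum>i<n. f i)" using \<open>i < n\<close> by (intro member_le_sum) auto
    ultimately show "A i k = 0" using f by auto
  qed
qed

lemma rc_finite_transpose: "rc_finite (\<lambda>i j. A j i) \<longleftrightarrow> rc_finite A"
  unfolding rc_finite_def by auto

lemma inf_mult_transpose: "inf_mult A B i j = inf_mult (\<lambda>i j. B j i) (\<lambda>i j. A j i) j i"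
  unfolding inf_mult_def by (simp add: mult.commute)

lemma rc_finite_mult_row:
  assumes "rc_finite A" "rc_finite B"
  shows "\<exists>N. \<forall>k\<ge>N. inf_mult A B i k = 0"
proof -
  obtain n where n: "\<And>k. n \<le> k \<Longrightarrow> A i k = 0" using assms(1) unfolding rc_finite_def by blast
  obtain N where N: "\<And>i k. i < n \<Longrightarrow> N \<le> k \<Longrightarrow> B i k = 0"
    using rc_finite_row_bound[OF assms(2)] by blast
  show ?thesis
  proof (intro exI[of _ N] allI impI)
    fix k assume "N \<le> k"
    then have "(\<Sum>l<n. A i l * B l k) = 0" by (intro sum.neutral) (simp add: N)
    then show "inf_mult A B i k = 0" by (subst inf_mult_sum_row[of n]) (simp_all add: n)
  qed
qed

lemma rc_finite_mult:
  assumes "rc_finite A" "rc_finite B"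
  shows "rc_finite (inf_mult A B)"
proof -
  have "\<exists>N. \<forall>k\<ge>N. inf_mult (\<lambda>i j. B j i) (\<lambda>i j. A j i) j k = 0" for j
    by (rule rc_finite_mult_row; rule iffD2[OF rc_finite_transpose]) (rule assms)+
  then have "\<exists>N. \<forall>k\<ge>N. inf_mult A B k j = 0" for j
    by (subst inf_mult_transpose)
  then show ?thesis
    using rc_finite_mult_row[OF assms] by (simp add: rc_finite_def)
qed

text \<open>Row \<open>i\<close> of \<open>A\<close> and column \<open>j\<close> of \<open>C\<close>
  have finite support, which reduces both iterated sums to the same finite double sum.\<close>

lemma inf_mult_assoc:
  assumes "rc_finite A" "rc_finite C"
  shows "inf_mult (inf_mult A B) C = inf_mult A (inf_mult B C)"
proof (intro ext)
  fix i j
  obtain n where n: "\<And>k. n \<le> k \<Longrightarrow> A i k = 0" using assms(1) unfolding rc_finite_def by blast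
  obtain m where m: "\<And>k. m \<le> k \<Longrightarrow> C k j = 0" using assms(2) unfolding rc_finite_def by blast
  have row: "inf_mult A D i l = (\<Sum>k<n. A i k * D k l)" for D l
    by (rule inf_mult_sum_row) (rule n)
  have col: "inf_mult D C l j = (\<Sum>k<m. D l k * C k j)" for D l
    by (rule inf_mult_sum_col) (rule m)
  have "inf_mult (inf_mult A B) C i j = (\<Sum>l<m. (\<Sum>k<n. A i k * B k l) * C l j)"
    by (simp add: row col)
  also have "\<dots> = (\<Sum>k<n. A i k * (\<Sum>l<m. B k l * C l j))"
    by (simp add: sum_distrib_left sum_distrib_right mult.assoc) (rule sum.swap)
  also have "\<dots> = inf_mult A (inf_mult B C) i j"
    by (simp add: row col)
  finally show "inf_mult (inf_mult A B) C i j = inf_mult A (inf_mult B C) i j" .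
qed

lemma rc_finite_one: "rc_finite inf_one"
  unfolding rc_finite_def inf_one_def by (metis Suc_n_not_le_n)

lemma rc_finite_binop:
  assumes "f 0 0 = 0" "rc_finite A" "rc_finite B"
  shows "rc_finite (\<lambda>i j. f (A i j) (B i j))"
proof -
  have *: "\<forall>\<^sub>F k in sequentially. f (u k) (v k) = 0"
    if "\<forall>\<^sub>F k in sequentially. u k = 0" "\<forall>\<^sub>F k in sequentially. v k = 0" for u v :: "nat \<Rightarrow> complex"
    using that by eventually_elim (simp add: assms(1))
  show ?thesis
    using assms(2,3) by (auto simp: rc_finite_def eventually_sequentially[symmetric] intro!: *)
qed

lemma rc_finite_eventually_diagonal:
  assumes "\<And>i j. n \<le> i \<or> n \<le> j \<Longrightarrow> i \<noteq> j \<Longrightarrow> A i j = 0"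
  shows "rc_finite A"
  unfolding rc_finite_def
proof (intro conjI allI)
  fix i
  show "\<exists>N. \<forall>k\<ge>N. A i k = 0" using assms by (intro exI[of _ "n + Suc i"]) auto
  show "\<exists>N. \<forall>k\<ge>N. A k i = 0" using assms by (intro exI[of _ "n + Suc i"]) auto
qed

text \<open>This ring contains \<open>gl(\<infinity>)\<close> and \<open>GL(\<infinity>)\<close>; an arbitrary infinite matrix \<open>X\<close> enters it
  through its corners \<open>pad n X\<close>, padded by zeros.\<close>

typedef rcmat = "{A. rc_finite A}"
  morphisms ent Abs_rcmat
  using rc_finite_one by blast

setup_lifting type_definition_rcmat

lemma rc_finite_ent [simp]: "rc_finite (ent A)"
  using ent by simp

lemma ent_row_bound: obtains N where "\<And>k. N \<le> k \<Longrightarrow> ent A i k = 0"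
  using rc_finite_ent[of A] unfolding rc_finite_def by blast

instantiation rcmat :: ring_1
begin
lift_definition zero_rcmat :: rcmat is "\<lambda>i j. 0" by (simp add: rc_finite_def)
lift_definition one_rcmat :: rcmat is inf_one by (rule rc_finite_one)
lift_definition plus_rcmat :: "rcmat \<Rightarrow> rcmat \<Rightarrow> rcmat" is "\<lambda>A B i j. A i j + B i j"
  by (rule rc_finite_binop) simp_all
lift_definition uminus_rcmat :: "rcmat \<Rightarrow> rcmat" is "\<lambda>A i j. - A i j"
  unfolding rc_finite_def by simp
lift_definition minus_rcmat :: "rcmat \<Rightarrow> rcmat \<Rightarrow> rcmat" is "\<lambda>A B i j. A i j - B i j"
  by (rule rc_finite_binop) simp_all
lift_definition times_rcmat :: "rcmat \<Rightarrow> rcmat \<Rightarrow> rcmat" is inf_mult by (rule rc_finite_mult)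
instance
proof
  fix A B C :: rcmat
  show "A * B * C = A * (B * C)" by transfer (rule inf_mult_assoc)
  show "1 * A = A"
  proof (transfer, intro ext)
    fix A :: infmat and i j
    have "inf_mult inf_one A i j = (\<Sum>k<Suc i. (if i = k then A k j else 0))"
      by (subst inf_mult_sum_row[of "Suc i"]) (auto simp: inf_one_def intro!: sum.cong)
    then show "inf_mult inf_one A i j = A i j" by simp
  qed
  show "A * 1 = A"
  proof (transfer, intro ext)
    fix A :: infmat and i j
    have "inf_mult A inf_one i j = (\<Sum>k<Suc j. (if k = j then A i k else 0))"
      by (subst inf_mult_sum_col[of "Suc j"]) (auto simp: inf_one_def intro!: sum.cong)
    then show "inf_mult A inf_one i j = A i j" by simp
  qed
  show "(A + B) * C = A * C + B * C"
  proof (transfer, intro ext)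
    fix A B C :: infmat and i j
    assume "rc_finite C"
    then obtain N where N: "\<And>k. N \<le> k \<Longrightarrow> C k j = 0" unfolding rc_finite_def by blast
    show "inf_mult (\<lambda>i j. A i j + B i j) C i j = inf_mult A C i j + inf_mult B C i j"
      by (subst (1 2 3) inf_mult_sum_col[of N]) (simp_all add: N distrib_right sum.distrib)
  qed
  show "A * (B + C) = A * B + A * C"
  proof (transfer, intro ext)
    fix A B C :: infmat and i j
    assume "rc_finite A"
    then obtain N where N: "\<And>k. N \<le> k \<Longrightarrow> A i k = 0" unfolding rc_finite_def by blast
    show "inf_mult A (\<lambda>i j. B i j + C i j) i j = inf_mult A B i j + inf_mult A C i j"
      by (subst (1 2 3) inf_mult_sum_row[of N]) (simp_all add: N distrib_left sum.distrib)
  qed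
  show "A + B + C = A + (B + C)" "A + B = B + A" "0 + A = A" "- A + A = 0" "A - B = A + - B"
    by (simp_all add: ent_inject[symmetric] fun_eq_iff plus_rcmat.rep_eq zero_rcmat.rep_eq
        uminus_rcmat.rep_eq minus_rcmat.rep_eq)
  show "(0::rcmat) \<noteq> 1" by transfer (auto simp: inf_one_def fun_eq_iff)
qed
end

lemma rcmat_eqI: "(\<And>i j. ent A i j = ent B i j) \<Longrightarrow> A = B"
  by (simp add: ent_inject[symmetric] fun_eq_iff)

lemma ent_add [simp]: "ent (A + B) i j = ent A i j + ent B i j" by transfer simp
lemma ent_diff [simp]: "ent (A - B) i j = ent A i j - ent B i j" by transfer simp
lemma ent_uminus [simp]: "ent (- A) i j = - ent A i j" by transfer simp
lemma ent_zero [simp]: "ent 0 i j = 0" by transfer simp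
lemma ent_one: "ent 1 i j = (if i = j then 1 else 0)" by transfer (simp add: inf_one_def)
lemma ent_mult: "ent (A * B) = inf_mult (ent A) (ent B)" by transfer simp
lemma ent_sum [simp]: "ent (\<Sum>x\<in>F. f x) i j = (\<Sum>x\<in>F. ent (f x) i j)"
  by (induction F rule: infinite_finite_induct) auto

lemma ent_Abs: "rc_finite A \<Longrightarrow> ent (Abs_rcmat A) = A"
  by (simp add: Abs_rcmat_inverse)

text \<open>Scalars act as multiplication by these central elements, so that the ring laws suffice
  and no module structure is needed on \<open>rcmat\<close>.\<close>

lift_definition sc :: "complex \<Rightarrow> rcmat" is "\<lambda>c i j. if i = j then c else 0"
  by (rule rc_finite_eventually_diagonal) auto

lemma ent_sc: "ent (sc c) i j = (if i = j then c else 0)" by transfer simp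

lemma ent_sc_mult [simp]: "ent (sc c * A) i j = c * ent A i j"
proof -
  have "ent (sc c * A) i j = (\<Sum>k<Suc i. (if i = k then c * ent A k j else 0))"
    unfolding ent_mult by (subst inf_mult_sum_row[of "Suc i"]) (auto simp: ent_sc intro!: sum.cong)
  then show ?thesis by simp
qed

lemma ent_mult_sc [simp]: "ent (A * sc c) i j = ent A i j * c"
proof -
  have "ent (A * sc c) i j = (\<Sum>k<Suc j. (if k = j then ent A i k * c else 0))"
    unfolding ent_mult by (subst inf_mult_sum_col[of "Suc j"]) (auto simp: ent_sc intro!: sum.cong)
  then show ?thesis by simp
qed

lemma sc_commute: "A * sc c = sc c * A" by (rule rcmat_eqI) simp
lemma sc_left_commute: "A * (sc c * B) = sc c * (A * B)"
  by (metis mult.assoc sc_commute)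
lemma sc_add: "sc (a + b) = sc a + sc b" by (rule rcmat_eqI) (simp add: ent_sc)
lemma sc_mult: "sc (a * b) = sc a * sc b" by (rule rcmat_eqI) (simp add: ent_sc)
lemma sc_diff: "sc (a - b) = sc a - sc b" by (rule rcmat_eqI) (simp add: ent_sc)
lemma sc_uminus: "sc (- a) = - sc a" by (rule rcmat_eqI) (simp add: ent_sc)
lemma sc_0 [simp]: "sc 0 = 0" by (rule rcmat_eqI) (simp add: ent_sc)
lemma sc_1 [simp]: "sc 1 = 1" by (rule rcmat_eqI) (simp add: ent_sc ent_one)
lemma sc_mult_left: "sc a * (sc b * A) = sc (a * b) * A" by (simp add: sc_mult mult.assoc)
lemma sc_inverse_cancel: "c \<noteq> 0 \<Longrightarrow> sc (inverse c) * (sc c * A) = A"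
  by (simp add: sc_mult_left)

section \<open>The corner rings \<open>gl(n)\<close> and their traces\<close>

definition glr :: "nat \<Rightarrow> rcmat set" where
  "glr n = {A. \<forall>i j. n \<le> i \<or> n \<le> j \<longrightarrow> ent A i j = 0}"

lift_definition pad :: "nat \<Rightarrow> infmat \<Rightarrow> rcmat" is "\<lambda>n X i j. if i < n \<and> j < n then X i j else 0"
  subgoal for n X by (rule rc_finite_eventually_diagonal[of n]) auto
  done

definition idn :: "nat \<Rightarrow> rcmat" where "idn n = pad n inf_one"

lemma ent_pad: "ent (pad n X) i j = (if i < n \<and> j < n then X i j else 0)" by transfer simp

lemma ent_idn: "ent (idn n) i j = (if i < n \<and> i = j then 1 else 0)"
  by (auto simp: idn_def ent_pad inf_one_def)

lemma glr_ent: "A \<in> glr n \<Longrightarrow> n \<le> i \<or> n \<le> j \<Longrightarrow> ent A i j = 0" by (auto simp: glr_def)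

lemma glr_ent_eqI:
  assumes "A \<in> glr n" "B \<in> glr n" "\<And>i j. i < n \<Longrightarrow> j < n \<Longrightarrow> ent A i j = ent B i j"
  shows "A = B"
proof (rule rcmat_eqI)
  fix i j
  show "ent A i j = ent B i j"
    using assms(3)[of i j] glr_ent[OF assms(1), of i j] glr_ent[OF assms(2), of i j]
    by (cases "i < n \<and> j < n") (auto simp: not_less)
qed

lemma glr_mult_ent: "A \<in> glr n \<Longrightarrow> ent (A * B) i j = (\<Sum>k<n. ent A i k * ent B k j)"
  unfolding ent_mult by (rule inf_mult_sum_row) (simp add: glr_ent)
lemma glr_mult_ent': "B \<in> glr n \<Longrightarrow> ent (A * B) i j = (\<Sum>k<n. ent A i k * ent B k j)"
  unfolding ent_mult by (rule inf_mult_sum_col) (simp add: glr_ent)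

lemma idn_glr [simp]: "idn n \<in> glr n" by (auto simp: glr_def ent_idn)
lemma pad_glr [simp]: "pad n X \<in> glr n" by (auto simp: glr_def ent_pad)

lemma ent_idn_mult: "ent (idn n * A) i j = (if i < n then ent A i j else 0)"
proof -
  have "ent (idn n * A) i j = (\<Sum>k<n. if i = k then ent A k j else 0)"
    by (subst glr_mult_ent[of _ n]) (auto simp: ent_idn if_distrib[of "\<lambda>x. x * _"] cong: if_cong)
  then show ?thesis by simp
qed
lemma ent_mult_idn: "ent (A * idn n) i j = (if j < n then ent A i j else 0)"
proof -
  have "ent (A * idn n) i j = (\<Sum>k<n. if k = j then ent A i k else 0)"
    by (subst glr_mult_ent'[of _ n]) (auto simp: ent_idn if_distrib[of "\<lambda>x. _ * x"] cong: if_cong)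
  then show ?thesis by simp
qed

text \<open>\<open>idn n\<close> is an idempotent and \<open>glr n\<close> is the corner ring that
  it cuts out; membership and compression to smaller corners become calculations with this
  idempotent.\<close>

lemma glr_iff: "A \<in> glr n \<longleftrightarrow> idn n * A = A \<and> A * idn n = A"
proof
  assume "A \<in> glr n"
  then show "idn n * A = A \<and> A * idn n = A"
    by (intro conjI rcmat_eqI; simp only: ent_idn_mult ent_mult_idn) (simp_all add: glr_ent)
next
  assume A: "idn n * A = A \<and> A * idn n = A"
  then have "ent A i j = (if i < n then ent A i j else 0)"
    "ent A i j = (if j < n then ent A i j else 0)" for i j
    using ent_idn_mult[of n A i j] ent_mult_idn[of A n i j] by simp_all
  then show "A \<in> glr n" unfolding glr_def by (simp add: leD) (metis leD)
qed

lemma idn_mult [simp]: "A \<in> glr n \<Longrightarrow> idn n * A = A" and mult_idn [simp]: "A \<in> glr n \<Longrightarrow> A * idn n = A"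
  by (simp_all add: glr_iff)

lemma idn_mult_left [simp]: "A \<in> glr n \<Longrightarrow> idn n * (A * B) = A * B"
  by (metis mult.assoc idn_mult)

lemma glr_mono: "n \<le> m \<Longrightarrow> glr n \<subseteq> glr m" by (auto simp: glr_def)
lemma glr_add: "A \<in> glr n \<Longrightarrow> B \<in> glr n \<Longrightarrow> A + B \<in> glr n" by (auto simp: glr_def)
lemma glr_diff: "A \<in> glr n \<Longrightarrow> B \<in> glr n \<Longrightarrow> A - B \<in> glr n" by (auto simp: glr_def)
lemma glr_uminus: "A \<in> glr n \<Longrightarrow> - A \<in> glr n" by (auto simp: glr_def)
lemma glr_zero: "0 \<in> glr n" by (auto simp: glr_def)
lemma glr_sc: "A \<in> glr n \<Longrightarrow> sc c * A \<in> glr n" by (auto simp: glr_def)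
lemma glr_mult: "A \<in> glr n \<Longrightarrow> B \<in> glr n \<Longrightarrow> A * B \<in> glr n"
  by (simp add: glr_iff[of "A * B"] mult.assoc)
lemma glr_sum: "(\<And>x. x \<in> F \<Longrightarrow> f x \<in> glr n) \<Longrightarrow> sum f F \<in> glr n"
  by (induction F rule: infinite_finite_induct) (auto intro: glr_add glr_zero)
lemma glr_idn_mult_power: "M \<in> glr n \<Longrightarrow> idn n * M ^ k \<in> glr n"
proof (induction k)
  case (Suc k)
  then show ?case
    using glr_mult[of "idn n * M ^ k" n M] by (simp only: power_Suc2 mult.assoc[symmetric])
qed simp

lemmas glr_intros = glr_add glr_diff glr_uminus glr_zero glr_sc glr_mult glr_sum glr_idn_mult_power idn_glr

definition tr :: "rcmat \<Rightarrow> nat \<Rightarrow> complex" where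
  "tr A n = (\<Sum>i<n. ent A i i)"

lemma tr_add: "tr (A + B) n = tr A n + tr B n" by (simp add: tr_def sum.distrib)
lemma tr_diff: "tr (A - B) n = tr A n - tr B n" by (simp add: tr_def sum_subtractf)
lemma tr_sc: "tr (sc c * A) n = c * tr A n" by (simp add: tr_def sum_distrib_left)
lemma tr_sum: "tr (sum f F) n = (\<Sum>x\<in>F. tr (f x) n)"
  by (simp add: tr_def) (rule sum.swap)
lemma tr_commute: "A \<in> glr n \<Longrightarrow> tr (A * B) n = tr (B * A) n"
  by (simp add: tr_def glr_mult_ent[of A n] glr_mult_ent'[of A n] mult.commute) (rule sum.swap)
lemma tr_stable: "A \<in> glr n \<Longrightarrow> n \<le> m \<Longrightarrow> tr A m = tr A n"
  unfolding tr_def by (rule sum.mono_neutral_right) (auto simp: glr_ent)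

section \<open>Linear algebra\<close>

text \<open>Gaussian elimination, by induction on the number of equations: an equation with a
  nonzero coefficient at \<open>j0\<close> is solved for the unknown \<open>j0\<close> and
  substituted into the others.\<close>

lemma homogeneous_system_nontrivial:
  fixes a :: "'i \<Rightarrow> 'j \<Rightarrow> complex"
  assumes "finite I" "finite J" "card I < card J"
  shows "\<exists>c. (\<exists>j\<in>J. c j \<noteq> 0) \<and> (\<forall>i\<in>I. (\<Sum>j\<in>J. a i j * c j) = 0)"
  using assms
proof (induction I arbitrary: a J rule: finite_induct)
  case empty
  then show ?case by (intro exI[of _ "\<lambda>_. 1"]) (auto simp: card_gt_0_iff)
next
  case (insert i0 I)
  show ?case
  proof (cases "\<forall>j\<in>J. a i0 j = 0")
    case True
    have "card I < card J" using insert by simp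
    then obtain c where "\<exists>j\<in>J. c j \<noteq> 0" "\<forall>i\<in>I. (\<Sum>j\<in>J. a i j * c j) = 0"
      using insert.IH[of J a] insert.prems by auto
    with True show ?thesis by (intro exI[of _ c]) auto
  next
    case False
    then obtain j0 where j0: "j0 \<in> J" "a i0 j0 \<noteq> 0" by auto
    define J' where "J' = J - {j0}"
    have J: "J = insert j0 J'" "j0 \<notin> J'" "finite J'" using j0 insert.prems by (auto simp: J'_def)
    then have "card I < card J'" using insert by simp
    then obtain c where c: "\<exists>j\<in>J'. c j \<noteq> 0"
      "\<And>i. i \<in> I \<Longrightarrow> (\<Sum>j\<in>J'. (a i j - a i j0 * a i0 j / a i0 j0) * c j) = 0"
      using insert.IH[of J' "\<lambda>i j. a i j - a i j0 * a i0 j / a i0 j0"] J by auto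
    define d where "d = c(j0 := - (\<Sum>j\<in>J'. a i0 j * c j) / a i0 j0)"
    have d: "(\<Sum>j\<in>J. a i j * d j)
        = (\<Sum>j\<in>J'. a i j * c j) - a i j0 * (\<Sum>j\<in>J'. a i0 j * c j) / a i0 j0" for i
    proof -
      have "(\<Sum>j\<in>J'. a i j * d j) = (\<Sum>j\<in>J'. a i j * c j)"
        using J by (intro sum.cong) (auto simp: d_def)
      then show ?thesis using J by (simp add: d_def)
    qed
    have "(\<Sum>j\<in>J. a i j * d j) = 0" if "i \<in> insert i0 I" for i
    proof (cases "i = i0")
      case True
      then show ?thesis using j0 by (simp add: d)
    next
      case False
      then have "i \<in> I" using that by simp
      from c(2)[OF this] show ?thesis
        by (simp add: d left_diff_distrib sum_subtractf sum_distrib_left sum_divide_distrib mult.assoc)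
    qed
    moreover have "\<exists>j\<in>J. d j \<noteq> 0" using c(1) J by (auto simp: d_def)
    ultimately show ?thesis by blast
  qed
qed

section \<open>Polynomials in a matrix, cyclic vectors and centralizers\<close>

definition pe :: "complex poly \<Rightarrow> rcmat \<Rightarrow> rcmat" where
  "pe p M = fold_coeffs (\<lambda>a f. sc a + M * f) p 0"

lemma pe_0 [simp]: "pe 0 M = 0" by (simp add: pe_def)
lemma pe_pCons [simp]: "pe (pCons a p) M = sc a + M * pe p M"
  by (cases "p = 0 \<and> a = 0") (auto simp: pe_def)
lemma pe_1 [simp]: "pe 1 M = 1" by (simp add: one_pCons)

lemma pe_commute:
  assumes "A * M = M * A"
  shows "A * pe p M = pe p M * A"
proof (induction p)
  case (pCons a p)
  then show ?case using assms
    by (simp add: distrib_left distrib_right sc_commute mult.assoc[symmetric])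
      (simp add: mult.assoc)
qed simp

lemma pe_add: "pe (p + q) M = pe p M + pe q M"
  by (induction p q rule: poly_induct2) (simp_all add: sc_add algebra_simps)
lemma pe_smult: "pe (smult c p) M = sc c * pe p M"
  by (induction p) (simp_all add: sc_mult distrib_left sc_left_commute)
lemma pe_mult: "pe (p * q) M = pe p M * pe q M"
  by (induction p) (simp_all add: pe_add pe_smult algebra_simps)

lemma pe_altdef: "degree p < n \<Longrightarrow> pe p M = (\<Sum>i<n. sc (coeff p i) * M ^ i)"
proof (induction p arbitrary: n)
  case (pCons a p)
  then obtain m where n: "n = Suc m" by (cases n) auto
  have "pe p M = (\<Sum>i<m. sc (coeff p i) * M ^ i)"
    using pCons n by (cases "p = 0") auto
  then show ?case
    by (simp add: n sum.lessThan_Suc_shift sum_distrib_left sc_left_commute del: sum.lessThan_Suc)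
qed simp

lemma pe_poly_sum: "pe (\<Sum>i<n. monom (c i) i) M = (\<Sum>i<n. sc (c i) * M ^ i)"
proof -
  have "pe (monom a i) M = sc a * M ^ i" for a i
    by (induction i) (simp_all add: monom_Suc monom_0 sc_left_commute)
  then show ?thesis by (induction n) (simp_all add: pe_add)
qed

lemma coeff_sum_monom: "coeff (\<Sum>i<n. monom (c i) i) j = (if j < n then c j else 0)"
  by (simp add: coeff_sum if_distrib cong: if_cong)

lemma degree_sum_monom: "0 < n \<Longrightarrow> degree (\<Sum>i<n. monom (c i) i) < n"
  by (rule le_less_trans[of _ "n - 1"], rule degree_le) (auto simp: coeff_sum_monom)

text \<open>Equivalently, no nonzero polynomial of degree below \<open>n\<close> annihilates
  \<open>M\<close>. The factor \<open>idn n\<close> matters only for \<open>j = 0\<close>: the power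
  \<open>M ^ 0\<close> is the infinite identity matrix, whereas the unit of \<open>glr n\<close> is
  \<open>idn n\<close>. For the same reason values \<open>pe p M\<close> are multiplied by
  \<open>idn n\<close> below.\<close>

definition nonderogatory :: "nat \<Rightarrow> rcmat \<Rightarrow> bool" where
  "nonderogatory n M \<longleftrightarrow>
     M \<in> glr n \<and> (\<forall>c. (\<Sum>j<n. sc (c j) * (idn n * M ^ j)) = 0 \<longrightarrow> (\<forall>j<n. c j = 0))"

lemma idn_pe:
  assumes "degree p < n"
  shows "idn m * pe p M = (\<Sum>j<n. sc (coeff p j) * (idn m * M ^ j))"
  by (simp add: pe_altdef[OF assms] sum_distrib_left sc_left_commute)

lemma nonderogatory_pe:
  assumes "nonderogatory n M" "q \<noteq> 0" "degree q < n"
  shows "idn n * pe q M \<noteq> 0"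
proof
  assume "idn n * pe q M = 0"
  then have "(\<Sum>j<n. sc (coeff q j) * (idn n * M ^ j)) = 0" by (simp add: idn_pe[OF assms(3)])
  with assms have "\<forall>j<n. coeff q j = 0" by (auto simp: nonderogatory_def)
  with assms show False using leading_coeff_0_iff by blast
qed

lemma idn_pe_glr:
  assumes "M \<in> glr n"
  shows "idn n * pe p M \<in> glr n"
proof -
  have "idn n * pe p M = (\<Sum>j<Suc (degree p). sc (coeff p j) * (idn n * M ^ j))"
    by (rule idn_pe) simp
  then show ?thesis using assms by (simp only:) (intro glr_intros)
qed

text \<open>Only \<open>n * m\<close> entries can be nonzero. Used with \<open>m = n\<close> for
  square matrices and with \<open>m = 1\<close> for column vectors, which are matrices supported in
  column 0.\<close>

lemma glr_dependent:
  assumes "finite J" "card J > n * m" "\<And>j. j \<in> J \<Longrightarrow> A j \<in> glr n" "m \<le> n"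
    "\<And>j. j \<in> J \<Longrightarrow> A j * idn m = A j"
  shows "\<exists>c. (\<exists>j\<in>J. c j \<noteq> 0) \<and> (\<Sum>j\<in>J. sc (c j) * A j) = 0"
proof -
  have "card ({..<n} \<times> {..<m}) < card J" using assms by simp
  then obtain c where c: "\<exists>j\<in>J. c j \<noteq> 0"
    "\<forall>x\<in>{..<n} \<times> {..<m}. (\<Sum>j\<in>J. ent (A j) (fst x) (snd x) * c j) = 0"
    using homogeneous_system_nontrivial[OF _ assms(1), of "{..<n} \<times> {..<m}"
        "\<lambda>x j. ent (A j) (fst x) (snd x)"] by auto
  have "(\<Sum>j\<in>J. sc (c j) * A j) = 0"
  proof (rule rcmat_eqI)
    fix i k
    show "ent (\<Sum>j\<in>J. sc (c j) * A j) i k = ent 0 i k"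
    proof (cases "i < n \<and> k < m")
      case True
      then show ?thesis using bspec[OF c(2), of "(i, k)"] by (simp add: mult.commute)
    next
      case False
      have "ent (A j) i k = 0" if "j \<in> J" for j
        using False glr_ent[OF assms(3)[OF that], of i k] ent_mult_idn[of "A j" m i k]
          assms(5)[OF that] by auto
      then show ?thesis by simp
    qed
  qed
  with c(1) show ?thesis by blast
qed

text \<open>The first \<open>n * n + 1\<close> powers of \<open>M\<close> are dependent.
  \<open>P\<close> is an annihilating polynomial of least degree, not normalized to be
  monic.\<close>

lemma minimal_polynomial:
  assumes "M \<in> glr n"
  obtains P where "P \<noteq> 0" "idn n * pe P M = 0"
    "\<And>q. q \<noteq> 0 \<Longrightarrow> degree q < degree P \<Longrightarrow> idn n * pe q M \<noteq> 0"
proof -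
  define K where "K = {p. p \<noteq> 0 \<and> idn n * pe p M = 0}"
  have "\<exists>c. (\<exists>j\<in>{..<Suc (n * n)}. c j \<noteq> 0) \<and> (\<Sum>j\<in>{..<Suc (n * n)}. sc (c j) * (idn n * M ^ j)) = 0"
    by (rule glr_dependent[of _ n n]) (use assms in \<open>auto intro: glr_idn_mult_power mult_idn\<close>)
  then obtain c where c: "\<exists>j<Suc (n * n). c j \<noteq> 0"
    "(\<Sum>j<Suc (n * n). sc (c j) * (idn n * M ^ j)) = 0"
    by auto
  define p where "p = (\<Sum>j<Suc (n * n). monom (c j) j)"
  have "idn n * pe p M = 0"
    using c(2) unfolding p_def pe_poly_sum by (simp add: sum_distrib_left sc_left_commute distrib_left)
  moreover have "p \<noteq> 0"
  proof
    assume "p = 0"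
    then have "coeff p j = 0" for j by simp
    then show False using c(1) unfolding p_def coeff_sum_monom by metis
  qed
  ultimately have "p \<in> K" by (simp add: K_def)
  then obtain P where "P \<in> K" "\<And>q. degree q < degree P \<Longrightarrow> q \<notin> K"
    using exists_least_iff[of "\<lambda>d. \<exists>p\<in>K. degree p = d"] by blast
  then show thesis using that[of P] by (auto simp: K_def)
qed

text \<open>The columns \<open>(1, s, s^2, ...)\<close> run through the moment curve. A nonzero row
  of \<open>A\<close> pairs with them to a nonzero polynomial in \<open>s\<close>.\<close>

lemma column_poly_nonzero:
  assumes "A \<in> glr n" "A \<noteq> 0"
  shows "finite {s. A * pad n (\<lambda>i j. if j = 0 then s ^ i else 0) = 0}"
proof -
  obtain a b where ab: "ent A a b \<noteq> 0" using assms(2) by (metis rcmat_eqI ent_zero)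
  then have lt: "a < n" "b < n" using glr_ent[OF assms(1)] by (metis not_less)+
  define p where "p = (\<Sum>k<n. monom (ent A a k) k)"
  have "p \<noteq> 0" using ab lt unfolding p_def by (metis coeff_sum_monom coeff_0)
  moreover have "poly p s = 0" if "A * pad n (\<lambda>i j. if j = 0 then s ^ i else 0) = 0" for s
  proof -
    have "ent (A * pad n (\<lambda>i j. if j = 0 then s ^ i else 0)) a 0 = (\<Sum>k<n. ent A a k * s ^ k)"
      using lt by (simp add: glr_mult_ent[OF assms(1)] ent_pad)
    then show ?thesis using that by (simp add: p_def poly_sum poly_monom)
  qed
  ultimately show ?thesis using poly_roots_finite[of p] by (auto elim: finite_subset[rotated])
qed

text \<open>A least-degree annihilator \<open>Q\<close> of \<open>v\<close> divides the least-degree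
  annihilator \<open>P\<close> of \<open>M\<close>. If \<open>P = Q * h\<close> with
  \<open>h\<close> nonconstant, a root \<open>l\<close> of \<open>h\<close> makes \<open>Q\<close>
  divide the cofactor \<open>P / (x - l)\<close>, which then kills \<open>v\<close>. But each of the
  finitely many cofactors is nonzero at \<open>M\<close>, by minimality of \<open>P\<close>, and
  kills only finitely many vectors of the moment curve; so some \<open>v\<close> on the curve avoids
  them all.\<close>

lemma cyclic_vector:
  assumes "nonderogatory n M" "0 < n"
  obtains v where "v \<in> glr n" "v * idn 1 = v" "\<And>q. q \<noteq> 0 \<Longrightarrow> degree q < n \<Longrightarrow> pe q M * v \<noteq> 0"
proof -
  have M: "M \<in> glr n" using assms by (simp add: nonderogatory_def)
  obtain P where P: "P \<noteq> 0" "idn n * pe P M = 0"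
    "\<And>q. q \<noteq> 0 \<Longrightarrow> degree q < degree P \<Longrightarrow> idn n * pe q M \<noteq> 0"
    using minimal_polynomial[OF M] by blast
  have deg: "n \<le> degree P" using nonderogatory_pe[OF assms(1) P(1)] P(2) by (metis not_le)
  define V where "V s = pad n (\<lambda>i j. if j = 0 then s ^ i else 0)" for s
  have V: "V s \<in> glr n" "V s * idn 1 = V s" for s
    by (auto simp: V_def intro!: rcmat_eqI simp: ent_mult_idn ent_pad)
  define co where "co l = P div [:- l, 1:]" for l
  have co: "P = [:- l, 1:] * co l" if "poly P l = 0" for l
    using that unfolding co_def poly_eq_0_iff_dvd by (simp only: dvd_mult_div_cancel)
  have "finite (\<Union>l\<in>{l. poly P l = 0}. {s. idn n * pe (co l) M * V s = 0})"
  proof (intro finite_UN_I poly_roots_finite P(1))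
    fix l assume "l \<in> {l. poly P l = 0}"
    then have Pl: "P = [:- l, 1:] * co l" using co by simp
    then have "co l \<noteq> 0" using P(1) by auto
    moreover have "degree P = Suc (degree (co l))"
      using Pl \<open>co l \<noteq> 0\<close> degree_mult_eq[of "[:- l, 1:]" "co l"] by simp
    ultimately have "idn n * pe (co l) M \<noteq> 0" by (intro P(3)) auto
    then show "finite {s. idn n * pe (co l) M * V s = 0}"
      unfolding V_def by (intro column_poly_nonzero idn_pe_glr M)
  qed
  from ex_new_if_finite[OF infinite_UNIV_char_0 this] obtain s
    where s: "\<And>l. poly P l = 0 \<Longrightarrow> idn n * pe (co l) M * V s \<noteq> 0" by auto
  have idn_V: "idn n * pe q M * V s = pe q M * V s" for q
  proof -
    have "idn n * M = M * idn n" using M by simp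
    then have "idn n * pe q M = pe q M * idn n" by (rule pe_commute)
    then show ?thesis using V by (simp add: mult.assoc)
  qed
  define K where "K = {q. q \<noteq> 0 \<and> pe q M * V s = 0}"
  have "P \<in> K" using P idn_V[of P] by (simp add: K_def)
  then obtain Q where Q: "Q \<in> K" "\<And>q. degree q < degree Q \<Longrightarrow> q \<notin> K"
    using exists_least_iff[of "\<lambda>d. \<exists>p\<in>K. degree p = d"] by blast
  then have Q0: "Q \<noteq> 0" "pe Q M * V s = 0" by (auto simp: K_def)
  have "P mod Q = 0"
  proof (rule ccontr)
    assume ne: "P mod Q \<noteq> 0"
    have eq: "P = (P div Q) * Q + P mod Q" by simp
    have "pe P M * V s = pe (P div Q) M * (pe Q M * V s) + pe (P mod Q) M * V s"
      by (subst eq) (simp only: pe_add pe_mult distrib_right mult.assoc)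
    then have "P mod Q \<in> K" using \<open>P \<in> K\<close> ne Q0 by (simp add: K_def)
    moreover have "degree (P mod Q) < degree Q" using degree_mod_less[OF Q0(1), of P] ne by simp
    ultimately show False using Q(2) by blast
  qed
  then obtain h where h: "P = Q * h" by (metis dvd_eq_mod_eq_0 dvdE)
  have "degree h = 0"
  proof (rule ccontr)
    assume "degree h \<noteq> 0"
    then obtain l where l: "poly h l = 0"
      using fundamental_theorem_of_algebra[of h] by (auto simp: constant_degree)
    then obtain h' where h': "h = [:- l, 1:] * h'" by (auto simp: poly_eq_0_iff_dvd dvd_def)
    have "poly P l = 0" using l h by simp
    have "[:- l, 1:] * co l = [:- l, 1:] * (h' * Q)"
      using co[OF \<open>poly P l = 0\<close>] h h' by (simp only: mult_ac)
    then have "co l = h' * Q" by (rule iffD1[OF mult_left_cancel, rotated]) simp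
    then have "idn n * pe (co l) M * V s = pe h' M * (pe Q M * V s)"
      using idn_V[of "co l"] by (simp add: pe_mult mult.assoc)
    then show False using s[OF \<open>poly P l = 0\<close>] Q0 by simp
  qed
  then have "degree Q = degree P" using h P(1) degree_mult_eq[of Q h] by auto
  then have "q \<notin> K" if "degree q < n" for q using Q(2) deg that by simp
  then show thesis by (intro that[of "V s"] V) (auto simp: K_def)
qed

text \<open>For a cyclic vector \<open>v\<close> there is a polynomial \<open>r\<close> with
  \<open>B v = r(M) v\<close>. As \<open>B\<close> commutes with \<open>M\<close>, both sides agree
  on all vectors \<open>s(M) v\<close>, that is, on the whole space.\<close>

theorem nonderogatory_centralizer:
  assumes nd: "nonderogatory n M" and B: "B \<in> glr n" "B * M = M * B"
  obtains c where "B = (\<Sum>j<n. sc (c j) * (idn n * M ^ j))"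
proof (cases "n = 0")
  case True
  then have "B = 0" using B by (intro rcmat_eqI) (simp add: glr_ent)
  with True that show thesis by auto
next
  case False
  then have n: "0 < n" by simp
  have M: "M \<in> glr n" using nd by (simp add: nonderogatory_def)
  obtain v where v: "v \<in> glr n" "v * idn 1 = v"
    "\<And>q. q \<noteq> 0 \<Longrightarrow> degree q < n \<Longrightarrow> pe q M * v \<noteq> 0"
    using cyclic_vector[OF nd n] by blast
  have idn_comm: "idn n * pe q M = pe q M * idn n" for q
    by (rule pe_commute) (use M in simp)
  have span: "\<exists>r. degree r < n \<and> w = pe r M * v" if w: "w \<in> glr n" "w * idn 1 = w" for w
  proof -
    define A where "A j = (if j < n then idn n * M ^ j * v else w)" for j
    have "\<exists>c. (\<exists>j\<in>{..<Suc n}. c j \<noteq> 0) \<and> (\<Sum>j\<in>{..<Suc n}. sc (c j) * A j) = 0"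
    proof (rule glr_dependent[of _ n 1])
      fix j
      show "A j \<in> glr n" using w v M by (auto simp: A_def intro: glr_mult glr_idn_mult_power)
      show "A j * idn 1 = A j" using w v by (simp add: A_def mult.assoc)
    qed (use n in auto)
    then obtain c where c: "\<exists>j<Suc n. c j \<noteq> 0" "(\<Sum>j<Suc n. sc (c j) * A j) = 0" by auto
    define q where "q = (\<Sum>j<n. monom (c j) j)"
    have q: "pe q M * v = (\<Sum>j<n. sc (c j) * A j)"
    proof -
      have "pe q M * v = idn n * pe q M * v"
        using v idn_comm[of q] by (simp add: mult.assoc)
      then show ?thesis
        by (simp add: q_def pe_poly_sum A_def sum_distrib_right sum_distrib_left mult.assoc sc_left_commute)
    qed
    have dq: "degree q < n" unfolding q_def using n by (rule degree_sum_monom)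
    have eq: "pe q M * v + sc (c n) * w = 0" using c(2) q by (simp add: A_def)
    \<comment> \<open>Otherwise the relation involves only \<open>v, M v, ..., M^(n-1) v\<close>,
      which are independent by cyclicity.\<close>
    have cn: "c n \<noteq> 0"
    proof
      assume "c n = 0"
      then have "q = 0" using v(3)[of q] dq eq by auto
      then have "coeff q j = 0" for j by simp
      then have "c j = 0" if "j < n" for j using that unfolding q_def coeff_sum_monom by metis
      then show False using c(1) \<open>c n = 0\<close> less_Suc_eq by auto
    qed
    have "w = pe (smult (- inverse (c n)) q) M * v"
    proof -
      have "sc (c n) * w = - (pe q M * v)" using eq by (simp add: eq_neg_iff_add_eq_0 add.commute)
      then have "sc (inverse (c n)) * (sc (c n) * w) = sc (inverse (c n)) * - (pe q M * v)" by simp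
      then show ?thesis using cn by (simp add: sc_inverse_cancel pe_smult sc_uminus mult.assoc del: smult_minus_left)
    qed
    then show ?thesis using dq by (intro exI[of _ "smult (- inverse (c n)) q"]) simp
  qed
  obtain r where r: "degree r < n" "B * v = pe r M * v"
    using span[of "B * v"] B v by (auto intro: glr_mult simp: mult.assoc)
  have Bw: "B * w = pe r M * w" if w: "w \<in> glr n" "w * idn 1 = w" for w
  proof -
    obtain s where s: "w = pe s M * v" using span[OF w] by blast
    have "B * w = pe s M * (B * v)"
      using pe_commute[OF B(2), of s] by (simp add: s mult.assoc[symmetric])
    also have "\<dots> = pe (s * r) M * v" by (simp add: r(2) pe_mult mult.assoc)
    also have "\<dots> = pe (r * s) M * v" by (simp only: mult.commute)
    also have "\<dots> = pe r M * w" by (simp add: s pe_mult mult.assoc)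
    finally show ?thesis .
  qed
  have "B = idn n * pe r M"
  proof (rule glr_ent_eqI[OF B(1) idn_pe_glr[OF M]])
    fix i j assume ij: "i < n" "j < n"
    define w where "w = pad n (\<lambda>a b. if a = j \<and> b = 0 then 1 else 0)"
    have w: "w \<in> glr n" "w * idn 1 = w"
      by (auto simp: w_def intro!: rcmat_eqI simp: ent_mult_idn ent_pad)
    have col: "ent (A * w) i 0 = ent A i j" if "A \<in> glr n" for A
    proof -
      have "ent (A * w) i 0 = (\<Sum>k<n. if k = j then ent A i k else 0)"
        using n by (intro trans[OF glr_mult_ent[OF that]] sum.cong refl) (auto simp: w_def ent_pad)
      then show ?thesis using ij by simp
    qed
    have "B * w = idn n * pe r M * w"
      using Bw[OF w] w by (simp add: idn_comm mult.assoc)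
    then show "ent B i j = ent (idn n * pe r M) i j"
      using col[OF B(1)] col[OF idn_pe_glr[OF M]] by metis
  qed
  then show thesis using that[of "coeff r"] by (simp add: idn_pe[OF r(1)])
qed

section \<open>The exponential\<close>

text \<open>\<open>pser a A\<close> is used for \<open>A \<in> glr n\<close> and \<open>exp_bounded a\<close> only; otherwise the entrywise series may
  diverge or fail to be row- and column-finite.\<close>

definition pser :: "(nat \<Rightarrow> complex) \<Rightarrow> rcmat \<Rightarrow> rcmat" where
  "pser a A = Abs_rcmat (\<lambda>i j. suminf (\<lambda>k. a k * ent (A ^ k) i j))"

text \<open>Covers the exponential series and its shifts, which are the cofactors left over when the
  first terms of the series are split off.\<close>

definition exp_bounded :: "(nat \<Rightarrow> complex) \<Rightarrow> bool" where
  "exp_bounded a \<longleftrightarrow> (\<forall>k. cmod (a k) \<le> 1 / fact k)"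

definition fexp :: "rcmat \<Rightarrow> rcmat" where
  "fexp = pser (\<lambda>k. 1 / fact k)"

lemma exp_bounded_shift: "exp_bounded (\<lambda>k. 1 / fact (k + m))"
  unfolding exp_bounded_def by (auto simp: norm_divide intro!: divide_left_mono fact_mono)

lemma exp_bounded_Suc: "exp_bounded a \<Longrightarrow> exp_bounded (\<lambda>k. a (Suc k))"
  unfolding exp_bounded_def
proof
  fix k assume "\<forall>k. cmod (a k) \<le> 1 / fact k"
  then have "cmod (a (Suc k)) \<le> 1 / fact (Suc k)" by blast
  also have "\<dots> \<le> 1 / fact k" by (intro divide_left_mono fact_mono) auto
  finally show "cmod (a (Suc k)) \<le> 1 / fact k" .
qed

lemma glr_power: "A \<in> glr n \<Longrightarrow> A ^ Suc k \<in> glr n"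
  by (induction k) (auto simp: intro: glr_mult)

lemma glr_power_bound:
  assumes "A \<in> glr n"
  obtains K where "K \<ge> 0" "\<And>k i j. cmod (ent (A ^ k) i j) \<le> K ^ k"
proof -
  define b where "b = (\<Sum>i<n. \<Sum>l<n. cmod (ent A i l))"
  have b0: "b \<ge> 0" unfolding b_def by (intro sum_nonneg) auto
  have row: "(\<Sum>l<n. cmod (ent A i l)) \<le> b" for i
  proof (cases "i < n")
    case True
    then show ?thesis unfolding b_def
      by (intro member_le_sum[of i "{..<n}" "\<lambda>i. \<Sum>l<n. cmod (ent A i l)"]) (auto intro: sum_nonneg)
  next
    case False
    then show ?thesis using b0 glr_ent[OF assms, of i] by simp
  qed
  have "cmod (ent (A ^ k) i j) \<le> b ^ k" for k i j
  proof (induction k arbitrary: i)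
    case 0
    show ?case by (simp add: ent_one)
  next
    case (Suc k)
    have "cmod (ent (A ^ Suc k) i j) \<le> (\<Sum>l<n. cmod (ent A i l) * cmod (ent (A ^ k) l j))"
      by (simp add: glr_mult_ent[OF assms] flip: norm_mult) (rule norm_sum)
    also have "\<dots> \<le> (\<Sum>l<n. cmod (ent A i l) * b ^ k)"
      by (intro sum_mono mult_left_mono Suc) auto
    also have "\<dots> \<le> b * b ^ k"
      unfolding sum_distrib_right[symmetric] by (intro mult_right_mono row) (simp add: b0)
    finally show ?case by simp
  qed
  with b0 that show thesis by blast
qed

lemma pser_norm_summable:
  assumes "A \<in> glr n" "exp_bounded a"
  shows "summable (\<lambda>k. norm (a k * ent (A ^ k) i j))"
proof -
  obtain K where K: "K \<ge> 0" "\<And>k i j. cmod (ent (A ^ k) i j) \<le> K ^ k"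
    using glr_power_bound[OF assms(1)] by blast
  show ?thesis
  proof (rule summable_comparison_test[OF _ summable_exp[of K]], intro exI allI impI)
    fix k
    have "cmod (a k) * cmod (ent (A ^ k) i j) \<le> 1 / fact k * K ^ k"
      using assms(2) K unfolding exp_bounded_def by (intro mult_mono) auto
    then show "norm (norm (a k * ent (A ^ k) i j)) \<le> inverse (fact k) * K ^ k"
      by (simp add: norm_mult inverse_eq_divide)
  qed
qed

lemma pser_sums:
  assumes "A \<in> glr n" "exp_bounded a"
  shows "(\<lambda>k. a k * ent (A ^ k) i j) sums ent (pser a A) i j"
proof -
  have "rc_finite (\<lambda>i j. suminf (\<lambda>k. a k * ent (A ^ k) i j))"
  proof (rule rc_finite_eventually_diagonal)
    fix i j assume ij: "n \<le> i \<or> n \<le> j" "i \<noteq> j"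
    have "ent (A ^ k) i j = 0" for k
      using ij by (cases k) (auto simp: ent_one simp del: power_Suc intro: glr_ent[OF glr_power[OF assms(1)]])
    then show "(suminf (\<lambda>k. a k * ent (A ^ k) i j)) = 0" by simp
  qed
  then have "ent (pser a A) i j = (suminf (\<lambda>k. a k * ent (A ^ k) i j))"
    by (simp add: pser_def ent_Abs)
  then show ?thesis
    using summable_norm_cancel[OF pser_norm_summable[OF assms, of i j]] by (simp add: summable_sums)
qed

lemma pser_mult_left_sums:
  assumes "A \<in> glr n" "exp_bounded a"
  shows "(\<lambda>k. a k * ent (B * A ^ k) i j) sums ent (B * pser a A) i j"
proof -
  obtain N where N: "\<And>k. N \<le> k \<Longrightarrow> ent B i k = 0" using ent_row_bound[where A = B and i = i] by blast
  have eq: "ent (B * C) i j = (\<Sum>l<N. ent B i l * ent C l j)" for C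
    unfolding ent_mult by (rule inf_mult_sum_row) (rule N)
  have "(\<lambda>k. \<Sum>l<N. ent B i l * (a k * ent (A ^ k) l j)) sums (\<Sum>l<N. ent B i l * ent (pser a A) l j)"
    by (intro sums_sum sums_mult pser_sums[OF assms])
  then show ?thesis by (simp add: eq sum_distrib_left mult.left_commute)
qed

lemma ent_col_bound: obtains N where "\<And>k. N \<le> k \<Longrightarrow> ent A k j = 0"
  using rc_finite_ent[of A] unfolding rc_finite_def by blast

lemma pser_mult_right_sums:
  assumes "A \<in> glr n" "exp_bounded a"
  shows "(\<lambda>k. a k * ent (A ^ k * B) i j) sums ent (pser a A * B) i j"
proof -
  obtain N where N: "\<And>k. N \<le> k \<Longrightarrow> ent B k j = 0" using ent_col_bound[where A = B and j = j] by blast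
  have eq: "ent (C * B) i j = (\<Sum>l<N. ent C i l * ent B l j)" for C
    unfolding ent_mult by (rule inf_mult_sum_col) (rule N)
  have "(\<lambda>k. \<Sum>l<N. (a k * ent (A ^ k) i l) * ent B l j) sums (\<Sum>l<N. ent (pser a A) i l * ent B l j)"
    by (intro sums_sum sums_mult2 pser_sums[OF assms])
  then show ?thesis by (simp add: eq sum_distrib_left mult.assoc)
qed

lemma pser_commute:
  assumes "A \<in> glr n" "exp_bounded a" "B * A = A * B"
  shows "B * pser a A = pser a A * B"
proof (rule rcmat_eqI)
  fix i j
  have "B * A ^ k = A ^ k * B" for k using power_commuting_commutes[OF assms(3)[symmetric], of k] by simp
  then show "ent (B * pser a A) i j = ent (pser a A * B) i j"
    using pser_mult_left_sums[OF assms(1,2), of B i j] pser_mult_right_sums[OF assms(1,2), of B i j]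
    by (simp add: sums_unique2)
qed

lemma pser_unfold:
  assumes "A \<in> glr n" "exp_bounded a"
  shows "pser a A = sc (a 0) + A * pser (\<lambda>k. a (Suc k)) A"
proof (rule rcmat_eqI)
  fix i j
  have "(\<lambda>k. a (Suc k) * ent (A ^ Suc k) i j) sums ent (A * pser (\<lambda>k. a (Suc k)) A) i j"
    using pser_mult_left_sums[OF assms(1) exp_bounded_Suc[OF assms(2)], of A i j] by simp
  then have "(\<lambda>k. a k * ent (A ^ k) i j) sums
      (ent (A * pser (\<lambda>k. a (Suc k)) A) i j + a 0 * ent (A ^ 0) i j)"
    by (rule sums_Suc)
  then show "ent (pser a A) i j = ent (sc (a 0) + A * pser (\<lambda>k. a (Suc k)) A) i j"
    using pser_sums[OF assms, of i j] by (auto simp: ent_one ent_sc dest: sums_unique2)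
qed

lemma fexp_first_term:
  assumes "A \<in> glr n"
  shows "fexp A = 1 + A * pser (\<lambda>k. 1 / fact (Suc k)) A"
  using pser_unfold[OF assms exp_bounded_shift[of 0]] by (simp add: fexp_def del: fact_Suc)

lemma fexp_first_two_terms:
  assumes "A \<in> glr n"
  shows "fexp A = 1 + A + A * A * pser (\<lambda>k. 1 / fact (Suc (Suc k))) A"
  using fexp_first_term[OF assms] pser_unfold[OF assms exp_bounded_shift[of 1]]
  by (simp add: distrib_left mult.assoc del: fact_Suc)

lemma fexp_minus_one_glr: "A \<in> glr n \<Longrightarrow> fexp A - 1 \<in> glr n"
proof -
  assume A: "A \<in> glr n"
  let ?p = "pser (\<lambda>k. 1 / fact (Suc k)) A"
  have "A * ?p = ?p * A" by (rule pser_commute[OF A]) (use exp_bounded_shift[of 1] in simp_all)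
  then have "A * ?p * idn n = A * ?p" using A by (simp add: mult.assoc)
  then have "A * ?p \<in> glr n" unfolding glr_iff using A by (simp add: mult.assoc[symmetric])
  then show ?thesis using fexp_first_term[OF A] by simp
qed

lemma fexp_0 [simp]: "fexp 0 = 1"
  using fexp_first_term[OF glr_zero[of 0]] by simp

text \<open>The binomial theorem divided by \<open>n!\<close>. In the induction, multiplying by
  \<open>x + y\<close> raises one index in each term with a factor \<open>i\<close> or
  \<open>Suc n - i\<close>; these two factors add up to \<open>Suc n\<close>.\<close>

lemma exp_series_add:
  fixes x y :: rcmat
  defines "S \<equiv> \<lambda>(x::rcmat) n. sc (1 / fact n) * x ^ n"
  assumes comm: "x * y = y * x"
  shows "S (x + y) n = (\<Sum>i\<le>n. S x i * S y (n - i))"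
proof (induction n)
  case 0
  show ?case unfolding S_def by simp
next
  case (Suc n)
  have times_S: "x * S x n = sc (of_nat (Suc n)) * S x (Suc n)" for x n
  proof -
    have "of_nat (Suc n) * (1 / fact (Suc n)) = (1 / fact n :: complex)"
      by (simp del: of_nat_Suc)
    then show ?thesis unfolding S_def sc_mult_left by (simp add: sc_left_commute)
  qed
  have S_comm: "S x n * y = y * S x n" for n
    unfolding S_def by (simp add: power_commuting_commutes[OF comm] sc_left_commute[of y] mult.assoc)
  let ?c = "\<lambda>n. sc (of_nat n)"
  have "?c (Suc n) * S (x + y) (Suc n) = (x + y) * (\<Sum>i\<le>n. S x i * S y (n - i))"
    by (metis Suc times_S)
  also have "\<dots> = (\<Sum>i\<le>n. x * S x i * S y (n - i)) + (\<Sum>i\<le>n. S x i * (y * S y (n - i)))"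
    by (simp add: distrib_right sum_distrib_left mult.assoc[symmetric] S_comm sum.distrib)
  also have "\<dots> = (\<Sum>i\<le>n. ?c (Suc i) * (S x (Suc i) * S y (n - i)))
      + (\<Sum>i\<le>n. ?c (Suc n - i) * (S x i * S y (Suc n - i)))"
    by (simp add: times_S Suc_diff_le mult.assoc sc_left_commute[of "S x _"] del: of_nat_Suc)
  also have "(\<Sum>i\<le>n. ?c (Suc i) * (S x (Suc i) * S y (n - i)))
      = (\<Sum>i\<le>Suc n. ?c i * (S x i * S y (Suc n - i)))"
    by (subst sum.atMost_Suc_shift) simp
  also have "(\<Sum>i\<le>n. ?c (Suc n - i) * (S x i * S y (Suc n - i)))
      = (\<Sum>i\<le>Suc n. ?c (Suc n - i) * (S x i * S y (Suc n - i)))"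
    by simp
  also have "(\<Sum>i\<le>Suc n. ?c i * (S x i * S y (Suc n - i)))
      + (\<Sum>i\<le>Suc n. ?c (Suc n - i) * (S x i * S y (Suc n - i)))
      = (\<Sum>i\<le>Suc n. ?c (Suc n) * (S x i * S y (Suc n - i)))"
    unfolding sum.distrib[symmetric] distrib_right[symmetric] sc_add[symmetric] of_nat_add[symmetric]
    by (intro sum.cong) auto
  also have "\<dots> = ?c (Suc n) * (\<Sum>i\<le>Suc n. S x i * S y (Suc n - i))"
    by (simp only: sum_distrib_left)
  finally have "sc (inverse (of_nat (Suc n))) * (?c (Suc n) * S (x + y) (Suc n))
      = sc (inverse (of_nat (Suc n))) * (?c (Suc n) * (\<Sum>i\<le>Suc n. S x i * S y (Suc n - i)))"
    by simp
  then show ?case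
    by (subst (asm) (1 2) sc_inverse_cancel) (simp_all only: of_nat_neq_0 not_False_eq_True)
qed

theorem fexp_add:
  assumes A: "A \<in> glr n" and B: "B \<in> glr n" and comm: "A * B = B * A"
  shows "fexp (A + B) = fexp A * fexp B"
proof (rule rcmat_eqI)
  fix i j
  let ?a = "\<lambda>k. 1 / fact k :: complex"
  have eb: "exp_bounded ?a" using exp_bounded_shift[of 0] by simp
  obtain N where N: "\<And>k. N \<le> k \<Longrightarrow> ent (fexp A) i k = 0" using ent_row_bound[where A = "fexp A" and i = i] by blast
  \<comment> \<open>A common bound for row \<open>i\<close>: \<open>N\<close> for the exponential of
    \<open>A\<close>, \<open>n\<close> for the positive powers of \<open>A\<close>, and
    \<open>Suc i\<close> for the power 0, whose row \<open>i\<close> has its entry at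
    \<open>i\<close>.\<close>
  define m where "m = max N (max n (Suc i))"
  have Ak: "ent (A ^ k) i l = 0" if "m \<le> l" for k l
    using that by (cases k) (auto simp: m_def ent_one simp del: power_Suc intro: glr_ent[OF glr_power[OF A]])
  have term_eq: "?a p * ent ((A + B) ^ p) i j
      = (\<Sum>l<m. \<Sum>k\<le>p. (?a k * ent (A ^ k) i l) * (?a (p - k) * ent (B ^ (p - k)) l j))" for p
  proof -
    have "?a p * ent ((A + B) ^ p) i j = ent (sc (?a p) * (A + B) ^ p) i j" by simp
    also have "\<dots> = (\<Sum>k\<le>p. ent (sc (?a k) * A ^ k * (sc (?a (p - k)) * B ^ (p - k))) i j)"
      by (subst exp_series_add[OF comm]) simp
    also have "\<dots> = (\<Sum>k\<le>p. \<Sum>l<m. (?a k * ent (A ^ k) i l) * (?a (p - k) * ent (B ^ (p - k)) l j))"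
    proof (intro sum.cong refl)
      fix k
      show "ent (sc (?a k) * A ^ k * (sc (?a (p - k)) * B ^ (p - k))) i j
        = (\<Sum>l<m. (?a k * ent (A ^ k) i l) * (?a (p - k) * ent (B ^ (p - k)) l j))"
        by (subst ent_mult, subst inf_mult_sum_row[of m]) (auto simp: Ak)
    qed
    finally show ?thesis by (subst sum.swap)
  qed
  have "(\<lambda>p. ?a p * ent ((A + B) ^ p) i j) sums (\<Sum>l<m. ent (fexp A) i l * ent (fexp B) l j)"
    unfolding term_eq fexp_def
  proof (rule sums_sum)
    fix l
    show "(\<lambda>p. \<Sum>k\<le>p. (?a k * ent (A ^ k) i l) * (?a (p - k) * ent (B ^ (p - k)) l j)) sums
        (ent (pser ?a A) i l * ent (pser ?a B) l j)"
      using Cauchy_product_sums[OF pser_norm_summable[OF A eb, of i l] pser_norm_summable[OF B eb, of l j]]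
        pser_sums[OF A eb, of i l] pser_sums[OF B eb, of l j] by (simp add: sums_iff)
  qed
  also have "(\<Sum>l<m. ent (fexp A) i l * ent (fexp B) l j) = ent (fexp A * fexp B) i j"
    unfolding ent_mult by (rule inf_mult_sum_row[symmetric]) (simp add: N m_def)
  finally show "ent (fexp (A + B)) i j = ent (fexp A * fexp B) i j"
    using pser_sums[OF glr_add[OF A B] eb, of i j] by (simp add: fexp_def sums_unique2)
qed

lemma fexp_minus:
  assumes "A \<in> glr n"
  shows "fexp A * fexp (- A) = 1" "fexp (- A) * fexp A = 1"
  using fexp_add[OF assms glr_uminus[OF assms]] fexp_add[OF glr_uminus[OF assms] assms] by simp_all

lemma fexp_scalar: "fexp (sc l * idn n) = 1 - idn n + sc (exp l) * idn n"
proof (rule rcmat_eqI)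
  fix i j
  have pw: "(sc l * idn n) ^ k = (if k = 0 then 1 else sc (l ^ k) * idn n)" for k
    by (induction k) (auto simp: sc_mult_left mult.assoc sc_left_commute[of "idn n"])
  have "(\<lambda>k. 1 / fact k * ent ((sc l * idn n) ^ k) i j) sums ent (fexp (sc l * idn n)) i j"
    unfolding fexp_def by (rule pser_sums[of _ n]) (use exp_bounded_shift[of 0] in \<open>auto intro: glr_sc\<close>)
  moreover have "(\<lambda>k. 1 / fact k * ent ((sc l * idn n) ^ k) i j) sums
      ent (1 - idn n + sc (exp l) * idn n) i j"
  proof (cases "i < n \<and> i = j")
    case True
    then have "1 / fact k * ent ((sc l * idn n) ^ k) i j = l ^ k /\<^sub>R fact k" for k
      by (simp add: pw ent_one ent_idn scaleR_conv_of_real field_simps)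
    then show ?thesis using True exp_converges[of l] by (simp add: ent_one ent_idn)
  next
    case False
    then have "1 / fact k * ent ((sc l * idn n) ^ k) i j = (if k = 0 then ent 1 i j else 0)" for k
      by (auto simp: pw ent_idn)
    moreover have "(\<lambda>k::nat. if k = 0 then ent 1 i j else 0) sums ent 1 i j"
      by (rule sums_single)
    ultimately show ?thesis using False by (auto simp: ent_idn)
  qed
  ultimately show "ent (fexp (sc l * idn n)) i j = ent (1 - idn n + sc (exp l) * idn n) i j"
    by (rule sums_unique2)
qed

text \<open>Each entry is an everywhere convergent power series in \<open>s\<close> whose linear
  coefficient is the entry of \<open>A\<close>.\<close>

lemma fexp_has_derivative_0:
  assumes A: "A \<in> glr n"
  shows "((\<lambda>s. ent (fexp (sc s * A)) i j) has_field_derivative ent A i j) (at 0)"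
proof -
  have eb: "exp_bounded (\<lambda>k. 1 / fact k)" using exp_bounded_shift[of 0] by simp
  have pw: "(sc s * A) ^ k = sc (s ^ k) * A ^ k" for s k
    by (induction k) (auto simp: sc_mult mult.assoc sc_left_commute[of A])
  define c where "c k = ent (A ^ k) i j / fact k" for k
  have sums: "(\<lambda>k. c k * s ^ k) sums ent (fexp (sc s * A)) i j" for s
    using pser_sums[OF glr_sc[OF A] eb, of s i j] by (simp add: pw c_def fexp_def field_simps)
  have "((\<lambda>s. suminf (\<lambda>k. c k * s ^ k)) has_field_derivative suminf (\<lambda>k. diffs c k * 0 ^ k)) (at 0)"
    by (rule termdiffs_strong_converges_everywhere) (rule sums_summable[OF sums])
  moreover have "(suminf (\<lambda>k. diffs c k * 0 ^ k)) = ent A i j" by (simp add: diffs_def c_def)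
  moreover have "(\<lambda>s. suminf (\<lambda>k. c k * s ^ k)) = (\<lambda>s. ent (fexp (sc s * A)) i j)"
    using sums by (simp add: sums_iff)
  ultimately show ?thesis by simp
qed

section \<open>The exponential on the centralizer of a nonderogatory matrix\<close>

text \<open>For nonderogatory \<open>M\<close>, every matrix commuting with \<open>M\<close> is \<open>pev n M p\<close> for some polynomial \<open>p\<close>,
  so that computations in the centralizer can be done with polynomials.\<close>

definition pev :: "nat \<Rightarrow> rcmat \<Rightarrow> complex poly \<Rightarrow> rcmat" where
  "pev n M p = idn n * pe p M"

lemma pev_glr: "M \<in> glr n \<Longrightarrow> pev n M p \<in> glr n"
  unfolding pev_def by (rule idn_pe_glr)

lemma pev_idn: "M \<in> glr n \<Longrightarrow> pev n M p = pe p M * idn n"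
  unfolding pev_def by (rule pe_commute) simp

lemma pev_commute:
  assumes "M \<in> glr n" "A \<in> glr n" "A * M = M * A"
  shows "A * pev n M p = pev n M p * A"
proof -
  have "A * pev n M p = A * pe p M" unfolding pev_def using assms(2) by (simp add: mult.assoc[symmetric])
  also have "\<dots> = pe p M * A" by (rule pe_commute) (rule assms(3))
  also have "\<dots> = pev n M p * A" using assms by (simp add: pev_idn mult.assoc)
  finally show ?thesis .
qed

lemma pev_add: "pev n M (p + q) = pev n M p + pev n M q"
  by (simp add: pev_def pe_add distrib_left)
lemma pev_mult: "M \<in> glr n \<Longrightarrow> pev n M (p * q) = pev n M p * pev n M q"
  by (subst (3) pev_def) (simp add: pev_idn pe_mult mult.assoc, simp add: mult.assoc[symmetric] pe_mult pev_idn[symmetric] pev_def)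
lemma pev_0 [simp]: "pev n M 0 = 0" by (simp add: pev_def)
lemma pev_1 [simp]: "pev n M 1 = idn n" by (simp add: pev_def)
lemma pev_const: "pev n M [:a:] = sc a * idn n" by (simp add: pev_def sc_commute)
lemma pev_diff: "pev n M (p - q) = pev n M p - pev n M q"
  using pev_add[of n M "p - q" q] by simp

lemma centralizer_pev:
  assumes "nonderogatory n M" "B \<in> glr n" "B * M = M * B"
  obtains p where "B = pev n M p"
proof -
  obtain c where "B = (\<Sum>j<n. sc (c j) * (idn n * M ^ j))"
    using nonderogatory_centralizer[OF assms] by blast
  then have "B = pev n M (\<Sum>j<n. monom (c j) j)"
    by (simp add: pev_def pe_poly_sum sum_distrib_left sc_left_commute[of "idn n"])
  with that show thesis .
qed

lemma pev_self_commute: "M \<in> glr n \<Longrightarrow> pev n M p * M = M * pev n M p"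
  using pev_commute[of M n M p] by simp

text \<open>The sum of the series commutes with \<open>M\<close>, so the centralizer theorem makes
  it a polynomial in \<open>M\<close>; no limit of polynomials has to be taken.\<close>

lemma idn_pser_pev:
  assumes nd: "nonderogatory n M" and eb: "exp_bounded a"
  obtains q where "idn n * pser a (pev n M p) = pev n M q"
proof -
  have M: "M \<in> glr n" using nd by (simp add: nonderogatory_def)
  let ?E = "pser a (pev n M p)"
  have c: "idn n * ?E = ?E * idn n" "M * ?E = ?E * M"
    using pev_glr[OF M, of p] pev_self_commute[OF M, of p] by (intro pser_commute[OF pev_glr[OF M] eb]; simp)+
  have "idn n * ?E \<in> glr n"
    unfolding glr_iff using c(1) by (metis idn_glr idn_mult mult.assoc)
  moreover have "idn n * ?E * M = M * (idn n * ?E)"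
    using M c(2)[symmetric] by (metis mult.assoc idn_mult mult_idn)
  ultimately obtain q where "idn n * ?E = pev n M q" using centralizer_pev[OF nd] by blast
  with that show thesis .
qed

text \<open>All that the logarithm construction needs to know about the exponential on nonconstant
  parts: it is \<open>1 + p\<close> up to a multiple of \<open>p * p\<close>.\<close>

lemma idn_fexp_pev:
  assumes nd: "nonderogatory n M"
  obtains q where "idn n * fexp (pev n M p) = pev n M (1 + p + p * p * q)"
proof -
  have M: "M \<in> glr n" using nd by (simp add: nonderogatory_def)
  let ?A = "pev n M p"
  have A: "?A \<in> glr n" by (rule pev_glr[OF M])
  let ?a = "\<lambda>k. 1 / fact (Suc (Suc k)) :: complex"
  obtain q where q: "idn n * pser ?a ?A = pev n M q"
    using idn_pser_pev[OF nd, of ?a p] exp_bounded_shift[of 2] by (auto simp del: fact_Suc)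
  have "idn n * fexp ?A = idn n + ?A + ?A * (?A * pser ?a ?A)"
    unfolding fexp_first_two_terms[OF A] using A by (simp add: distrib_left mult.assoc del: fact_Suc)
  also have "?A * pser ?a ?A = ?A * (idn n * pser ?a ?A)"
    using A by (simp add: mult.assoc[symmetric] del: fact_Suc)
  also have "idn n + ?A + ?A * (?A * (idn n * pser ?a ?A)) = pev n M (1 + p + p * p * q)"
    unfolding q by (simp add: pev_add pev_mult[OF M] mult.assoc)
  finally show thesis by (rule that)
qed

lemma idn_fexp_mult: "A \<in> glr n \<Longrightarrow> idn n * fexp A * (idn n * B) = idn n * fexp A * B"
proof -
  assume A: "A \<in> glr n"
  have c: "idn n * fexp A = fexp A * idn n"
  proof -
    have "idn n * (fexp A - 1) = (fexp A - 1) * idn n" using fexp_minus_one_glr[OF A] by simp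
    then show ?thesis by (simp add: right_diff_distrib left_diff_distrib)
  qed
  have "idn n * fexp A * (idn n * B) = fexp A * (idn n * (idn n * B))" by (simp only: c mult.assoc)
  also have "\<dots> = fexp A * (idn n * B)" by simp
  also have "\<dots> = idn n * fexp A * B" by (simp only: c mult.assoc)
  finally show ?thesis .
qed

text \<open>Induction over the divisors \<open>Q\<close> of \<open>P\<close>: some exponential is
  represented by a polynomial \<open>T\<close> congruent to \<open>Z\<close> modulo
  \<open>Q\<close>. To pass from \<open>Q'\<close> to \<open>Q = (x - l) Q'\<close>, the exponent is
  changed by \<open>c Q'\<close>, which multiplies \<open>T\<close> by \<open>1 + c Q'\<close> up to
  a multiple of the square of \<open>Q'\<close>. If \<open>l\<close> is already a root of
  \<open>Q'\<close>, then \<open>Q\<close> divides that square and \<open>c\<close> solves a linear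
  equation; if \<open>l\<close> is new, \<open>c\<close> adjusts the value of the exponent at
  \<open>l\<close> to a logarithm. For \<open>Q = P\<close> the congruence is an equality at
  \<open>M\<close>.\<close>

theorem fexp_surj_centralizer:
  assumes nd: "nonderogatory n M" and z: "z \<in> glr n" "z * M = M * z"
    and inv: "w \<in> glr n" "z * w = idn n"
  obtains p where "idn n * fexp (pev n M p) = z"
proof -
  have M: "M \<in> glr n" using nd by (simp add: nonderogatory_def)
  obtain P where P: "P \<noteq> 0" "pev n M P = 0"
    "\<And>q. q \<noteq> 0 \<Longrightarrow> degree q < degree P \<Longrightarrow> pev n M q \<noteq> 0"
    using minimal_polynomial[OF M] unfolding pev_def by blast
  obtain Z where Z: "z = pev n M Z" using centralizer_pev[OF nd z] by blast
  \<comment> \<open>At a common root \<open>l\<close>, the cofactor \<open>P1\<close> of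
    \<open>P\<close> satisfies \<open>P1(M) z = 0\<close>; since \<open>z\<close> is invertible,
    \<open>P1(M) = 0\<close>, against minimality of \<open>P\<close>.\<close>
  have Z0: "poly Z l \<noteq> 0" if root: "poly P l = 0" for l
  proof
    assume "poly Z l = 0"
    then obtain Z1 where Z1: "Z = [:- l, 1:] * Z1" unfolding poly_eq_0_iff_dvd by (rule dvdE)
    obtain P1 where P1: "P = [:- l, 1:] * P1" using root unfolding poly_eq_0_iff_dvd by (rule dvdE)
    have "P1 \<noteq> 0" using P1 P(1) by auto
    moreover have "degree P1 < degree P"
      using P1 \<open>P1 \<noteq> 0\<close> degree_mult_eq[of "[:- l, 1:]" P1] by simp
    moreover have "pev n M P1 = 0"
    proof -
      have "P1 * Z = P * Z1" using P1 Z1 by (simp only: mult_ac)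
      then have "pev n M P1 * z = 0"
        using pev_mult[OF M, of P1 Z] pev_mult[OF M, of P Z1] P(2) Z by simp
      then have "pev n M P1 * (z * w) = 0" by (simp add: mult.assoc[symmetric])
      then show ?thesis using inv(2) pev_glr[OF M, of P1] by simp
    qed
    ultimately show False using P(3) by blast
  qed
  have "\<exists>L T. idn n * fexp (pev n M L) = pev n M T \<and> Q dvd T - Z" if "Q dvd P" for Q
    using that
  proof (induction "degree Q" arbitrary: Q)
    case 0
    then obtain c where "Q = [:c:]" using degree_eq_zeroE[of Q] by metis
    moreover have "c \<noteq> 0" using 0 P(1) calculation by auto
    ultimately have "1 - Z = Q * smult (inverse c) (1 - Z)" by simp
    then have "Q dvd 1 - Z" by (rule dvdI)
    then show ?case by (intro exI[of _ 0] exI[of _ 1]) simp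
  next
    case (Suc d)
    then obtain l where l: "poly Q l = 0"
      using fundamental_theorem_of_algebra[of Q] by (auto simp: constant_degree)
    define D where "D = [:- l, 1:]"
    have D0: "D dvd p \<longleftrightarrow> poly p l = 0" for p unfolding D_def by (simp add: poly_eq_0_iff_dvd)
    obtain Q' where Q': "Q = D * Q'" using l D0 by (auto elim: dvdE)
    have "poly P l = 0" using Suc.prems l by (auto elim!: dvdE)
    then have Zl: "poly Z l \<noteq> 0" by (rule Z0)
    have "Q' \<noteq> 0" using Suc.hyps(2) Q' by auto
    then have "degree Q' = d" using Suc.hyps(2) Q' degree_mult_eq[of D Q'] by (simp add: D_def)
    moreover have "Q' dvd P" using Suc.prems Q' dvd_mult_right by blast
    ultimately obtain L T where LT: "idn n * fexp (pev n M L) = pev n M T" "Q' dvd T - Z"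
      using Suc.hyps(1)[of Q'] by blast
    then obtain W where W: "T = Z + Q' * W" by (metis dvdE add_diff_cancel_left' diff_add_cancel add.commute)
    have step: "\<exists>q. idn n * fexp (pev n M (L + smult c Q')) =
        pev n M (T * (1 + smult c Q' + smult c Q' * smult c Q' * q))" for c
    proof -
      obtain q where q: "idn n * fexp (pev n M (smult c Q'))
          = pev n M (1 + smult c Q' + smult c Q' * smult c Q' * q)"
        using idn_fexp_pev[OF nd] by blast
      have "fexp (pev n M (L + smult c Q')) = fexp (pev n M L) * fexp (pev n M (smult c Q'))"
        unfolding pev_add by (intro fexp_add[of _ n] pev_glr M) (simp add: pev_mult[OF M, symmetric] mult.commute)
      then have "idn n * fexp (pev n M (L + smult c Q'))
          = (idn n * fexp (pev n M L)) * (idn n * fexp (pev n M (smult c Q')))"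
        using idn_fexp_mult[OF pev_glr[OF M], of L] by (simp add: mult.assoc)
      then show ?thesis using q LT(1) by (auto simp: pev_mult[OF M])
    qed
    show ?case
    proof (cases "poly Q' l = 0")
      case True
      \<comment> \<open>Here \<open>T\<close> and \<open>Z\<close> agree at \<open>l\<close>, so
        this is the solution of \<open>W(l) + c T(l) = 0\<close>.\<close>
      define c where "c = - poly W l / poly Z l"
      obtain q where q: "idn n * fexp (pev n M (L + smult c Q')) =
          pev n M (T * (1 + smult c Q' + smult c Q' * smult c Q' * q))" using step by blast
      have eq: "T * (1 + smult c Q' + smult c Q' * smult c Q' * q) - Z
          = Q' * (W + smult c T + smult c T * (smult c Q' * q))"
        unfolding W by (simp add: algebra_simps smult_add_right)
      have "D dvd W + smult c T + smult c T * (smult c Q' * q)"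
        unfolding D0 using True Zl by (simp add: W c_def)
      then have "Q dvd T * (1 + smult c Q' + smult c Q' * smult c Q' * q) - Z"
        unfolding eq Q' by (subst mult.commute) (rule mult_dvd_mono[OF dvd_refl])
      with q show ?thesis by blast
    next
      case False
      \<comment> \<open>Chosen so that the new exponent takes the value \<open>Ln (poly Z l)\<close>
        at \<open>l\<close>; then the exponential is also represented by a polynomial
        \<open>T2\<close> with the right value at \<open>l\<close>.\<close>
      define c where "c = (Ln (poly Z l) - poly L l) / poly Q' l"
      define L' where "L' = L + smult c Q'"
      obtain q where q: "idn n * fexp (pev n M L') =
          pev n M (T * (1 + smult c Q' + smult c Q' * smult c Q' * q))"
        using step unfolding L'_def by blast
      define T1 where "T1 = T * (1 + smult c Q' + smult c Q' * smult c Q' * q)"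
      have "T1 - Z = Q' * (W + smult c T + smult c T * (smult c Q' * q))"
        unfolding T1_def W by (simp add: algebra_simps smult_add_right)
      then have T1: "Q' dvd T1 - Z" by simp
      define m where "m = Ln (poly Z l)"
      have "D dvd L' - [:m:]"
        unfolding D0 using False by (simp add: L'_def c_def m_def)
      then obtain x where x: "L' = [:m:] + D * x" by (metis dvdE add_diff_cancel_left' diff_add_cancel add.commute)
      obtain r where r: "idn n * fexp (pev n M (D * x)) = pev n M (1 + D * x + D * x * (D * x) * r)"
        using idn_fexp_pev[OF nd] by blast
      define T2 where "T2 = [:exp m:] * (1 + D * x + D * x * (D * x) * r)"
      have "fexp (pev n M L') = fexp (pev n M [:m:]) * fexp (pev n M (D * x))"
        unfolding x pev_add by (intro fexp_add[of _ n] pev_glr M) (simp only: pev_mult[OF M, symmetric] mult.commute)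
      then have "idn n * fexp (pev n M L') = idn n * fexp (pev n M [:m:]) * (idn n * fexp (pev n M (D * x)))"
        using idn_fexp_mult[OF pev_glr[OF M], of "[:m:]"] by (simp add: mult.assoc)
      also have "idn n * fexp (pev n M [:m:]) = pev n M [:exp m:]"
        by (simp add: pev_const fexp_scalar distrib_left right_diff_distrib sc_left_commute[of "idn n"])
      finally have hT: "pev n M T1 = pev n M T2" using q r by (simp only: T1_def T2_def pev_mult[OF M])
      have qT1: "idn n * fexp (pev n M L') = pev n M T1" using q by (simp add: T1_def)
      have T2: "D dvd T2 - Z"
        unfolding D0 T2_def using Zl by (simp add: m_def D_def)
      have "D dvd Q' - [:poly Q' l:]" unfolding D0 by simp
      then obtain Q1 where Q1: "Q' = [:poly Q' l:] + D * Q1"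
        by (metis dvdE add_diff_cancel_left' diff_add_cancel add.commute)
      define u v where "u = [:inverse (poly Q' l):]" and "v = - (Q1 * u)"
      have "[:poly Q' l:] * u = 1" using False by (simp add: u_def one_pCons)
      then have uv: "D * v + Q' * u = 1"
        by (subst Q1) (simp add: v_def algebra_simps)
      \<comment> \<open>Chinese remainders: \<open>T1\<close> is right modulo \<open>Q'\<close>,
        \<open>T2\<close> is right modulo \<open>D\<close>, and both represent the same matrix, so
        the glued polynomial still represents it.\<close>
      define T3 where "T3 = T1 * (D * v) + T2 * (Q' * u)"
      have "pev n M T3 = pev n M T1 * pev n M (D * v + Q' * u)"
        unfolding T3_def pev_add pev_mult[OF M, of T1] pev_mult[OF M, of T2] hT
        by (simp add: distrib_left)
      then have "pev n M T3 = pev n M T1" unfolding uv using pev_glr[OF M, of T1] by simp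
      moreover have "Q dvd T3 - Z"
      proof -
        have "T3 - Z = T3 - Z * (D * v + Q' * u)" by (simp add: uv)
        also have "\<dots> = D * v * (T1 - Z) + Q' * u * (T2 - Z)"
          by (simp add: T3_def algebra_simps)
        also have "Q dvd \<dots>"
        proof (rule dvd_add)
          show "Q dvd D * v * (T1 - Z)"
            unfolding Q' by (rule mult_dvd_mono[OF dvd_triv_left T1])
          show "Q dvd Q' * u * (T2 - Z)"
            unfolding Q' by (subst mult.commute[of D]) (rule mult_dvd_mono[OF dvd_triv_left T2])
        qed
        finally show ?thesis .
      qed
      ultimately show ?thesis using qT1 by metis
    qed
  qed
  from this[OF dvd_refl] obtain L T where LT: "idn n * fexp (pev n M L) = pev n M T" "P dvd T - Z" by blast
  from LT(2) obtain W where "T - Z = P * W" by (auto elim: dvdE)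
  then have "pev n M T - pev n M Z = 0"
    using P(2) pev_mult[OF M, of P W] by (simp add: pev_diff[symmetric])
  then show thesis using LT(1) Z that[of L] by simp
qed

section \<open>Translation to the ring of row- and column-finite matrices\<close>

definition rm :: "nat \<Rightarrow> complex mat \<Rightarrow> rcmat" where
  "rm n A = pad n (\<lambda>i j. A $$ (i, j))"

lemma rm_glr [simp]: "rm n A \<in> glr n" by (simp add: rm_def)
lemma ent_rm: "ent (rm n A) i j = (if i < n \<and> j < n then A $$ (i, j) else 0)"
  by (simp add: rm_def ent_pad)

lemma rm_corner: "rm n (corner n X) = pad n X"
  by (rule rcmat_eqI) (simp add: ent_rm ent_pad)

lemma rm_mult:
  assumes "A \<in> carrier_mat n n" "B \<in> carrier_mat n n"
  shows "rm n (A * B) = rm n A * rm n B"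
proof (rule glr_ent_eqI[of _ n])
  fix i j assume "i < n" "j < n"
  then show "ent (rm n (A * B)) i j = ent (rm n A * rm n B) i j"
    using assms by (subst glr_mult_ent[of _ n]) (auto simp: ent_rm scalar_prod_def lessThan_atLeast0)
qed (auto intro: glr_mult)

lemma rm_one: "rm n (1\<^sub>m n) = idn n"
  by (rule rcmat_eqI) (auto simp: ent_rm ent_idn)

lemma rm_smult: "A \<in> carrier_mat n n \<Longrightarrow> rm n (c \<cdot>\<^sub>m A) = sc c * rm n A"
  by (rule rcmat_eqI) (auto simp: ent_rm)

lemma rm_diff: "A \<in> carrier_mat n n \<Longrightarrow> B \<in> carrier_mat n n \<Longrightarrow> rm n (A - B) = rm n A - rm n B"
  by (rule rcmat_eqI) (auto simp: ent_rm)

lemma rm_pow: "A \<in> carrier_mat n n \<Longrightarrow> rm n (A ^\<^sub>m k) = idn n * rm n A ^ k"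
proof (induction k)
  case (Suc k)
  then show ?case by (simp add: rm_mult pow_carrier_mat mult.assoc power_commutes)
qed (simp add: rm_one)

lemma mtrace_rm: "A \<in> carrier_mat n n \<Longrightarrow> mtrace A = tr (rm n A) n"
  by (auto simp: mtrace_def tr_def ent_rm)

definition emb :: "nat \<Rightarrow> complex mat \<Rightarrow> rcmat" where
  "emb n a = 1 - idn n + rm n a"

lemma ent_emb: "ent (emb n a) = GL_embed n a"
  by (intro ext) (auto simp: emb_def GL_embed_def ent_one ent_idn ent_rm inf_one_def)

lemma emb_mult:
  assumes "a \<in> carrier_mat n n" "b \<in> carrier_mat n n"
  shows "emb n a * emb n b = emb n (a * b)"
  by (simp add: emb_def rm_mult[OF assms] algebra_simps)

lemma emb_one: "emb n (1\<^sub>m n) = 1" by (simp add: emb_def rm_one)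

lemma emb_corner: "g - 1 \<in> glr n \<Longrightarrow> emb n (corner n (ent g)) = g"
proof (rule rcmat_eqI)
  fix i j assume "g - 1 \<in> glr n"
  then have "ent g i j = ent 1 i j" if "n \<le> i \<or> n \<le> j" using glr_ent[OF _ that, of "g - 1"] by simp
  then show "ent (emb n (corner n (ent g))) i j = ent g i j"
    by (cases "i < n \<and> j < n") (auto simp: emb_def ent_one ent_idn ent_rm)
qed

lemma emb_inj:
  assumes "emb n c = emb n d" "c \<in> carrier_mat n n" "d \<in> carrier_mat n n"
  shows "c = d"
proof (rule eq_matI)
  fix i j assume "i < dim_row d" "j < dim_col d"
  then show "c $$ (i, j) = d $$ (i, j)"
    using arg_cong[OF assms(1), of "\<lambda>A. ent A i j"] assms(2,3) by (simp add: emb_def ent_rm)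
qed (use assms in auto)

lemma emb_minus_one: "emb n a - 1 \<in> glr n"
  by (simp add: emb_def glr_diff)

section \<open>The groups \<open>GL(n)\<close> inside the ring and their action by
  conjugation\<close>

definition GU :: "nat \<Rightarrow> rcmat set" where
  "GU n = {g. g - 1 \<in> glr n \<and> (\<exists>h. h - 1 \<in> glr n \<and> g * h = 1 \<and> h * g = 1)}"

definition rinv :: "rcmat \<Rightarrow> rcmat" where
  "rinv g = (THE h. g * h = 1 \<and> h * g = 1)"

lemma rinv_eq: "g * h = 1 \<Longrightarrow> h * g = 1 \<Longrightarrow> rinv g = h"
  unfolding rinv_def by (rule the_equality) (auto, metis mult.assoc mult_1_left mult_1_right)

lemma GU_rinv:
  assumes "g \<in> GU n"
  shows "g * rinv g = 1" "rinv g * g = 1" "rinv g \<in> GU n" "rinv (rinv g) = g"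
proof -
  obtain h where h: "h - 1 \<in> glr n" "g * h = 1" "h * g = 1" using assms by (auto simp: GU_def)
  then have "rinv g = h" by (intro rinv_eq)
  then show "g * rinv g = 1" "rinv g * g = 1" "rinv g \<in> GU n" "rinv (rinv g) = g"
    using h assms rinv_eq[of h g] by (auto simp: GU_def)
qed

lemma GU_cancel:
  assumes "g \<in> GU n"
  shows "g * (rinv g * A) = A" "rinv g * (g * A) = A"
  using GU_rinv[OF assms] by (simp_all add: mult.assoc[symmetric])

lemma GU_minus_one: "g \<in> GU n \<Longrightarrow> g - 1 \<in> glr n" by (simp add: GU_def)

lemma unip_mult: "g - 1 \<in> glr n \<Longrightarrow> h - 1 \<in> glr n \<Longrightarrow> g * h - 1 \<in> glr n"
proof -
  assume "g - 1 \<in> glr n" "h - 1 \<in> glr n"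
  then have "(g - 1) * (h - 1) + (g - 1) + (h - 1) \<in> glr n" by (intro glr_add glr_mult)
  then show "g * h - 1 \<in> glr n" by (simp add: algebra_simps)
qed

lemma GU_mult: "g \<in> GU n \<Longrightarrow> h \<in> GU n \<Longrightarrow> g * h \<in> GU n"
  and rinv_mult: "g \<in> GU n \<Longrightarrow> h \<in> GU n \<Longrightarrow> rinv (g * h) = rinv h * rinv g"
proof -
  assume g: "g \<in> GU n" and h: "h \<in> GU n"
  have eq: "g * h * (rinv h * rinv g) = 1" "rinv h * rinv g * (g * h) = 1"
    by (simp_all add: mult.assoc GU_cancel[OF g] GU_cancel[OF h] GU_rinv[OF g] GU_rinv[OF h])
  then show "rinv (g * h) = rinv h * rinv g" by (rule rinv_eq)
  show "g * h \<in> GU n"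
    unfolding GU_def using eq
      unip_mult[OF GU_minus_one[OF g] GU_minus_one[OF h]]
      unip_mult[OF GU_minus_one[OF GU_rinv(3)[OF h]] GU_minus_one[OF GU_rinv(3)[OF g]]]
    by blast
qed

lemma GU_one: "1 \<in> GU n" by (auto simp: GU_def glr_zero intro!: exI[of _ 1])

lemma GU_mono: "n \<le> m \<Longrightarrow> GU n \<subseteq> GU m"
  unfolding GU_def using glr_mono[of n m] by blast

lemma fexp_GU: "A \<in> glr n \<Longrightarrow> fexp A \<in> GU n"
  unfolding GU_def using fexp_minus[of A n] fexp_minus_one_glr[of A n] fexp_minus_one_glr[of "- A" n]
  by (auto intro: glr_uminus)

lemma unip_idn: "g - 1 \<in> glr n \<Longrightarrow> idn n * g = g * idn n"
proof -
  assume "g - 1 \<in> glr n"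
  then have "idn n * (g - 1) = (g - 1) * idn n" by simp
  then show ?thesis by (simp add: right_diff_distrib left_diff_distrib)
qed

lemma unip_glr: "g - 1 \<in> glr n \<Longrightarrow> A \<in> glr n \<Longrightarrow> g * A \<in> glr n"
  "g - 1 \<in> glr n \<Longrightarrow> A \<in> glr n \<Longrightarrow> A * g \<in> glr n"
proof -
  assume g: "g - 1 \<in> glr n" and A: "A \<in> glr n"
  then have "(g - 1) * A + A \<in> glr n" "A * (g - 1) + A \<in> glr n" by (simp_all add: glr_add glr_mult)
  then show "g * A \<in> glr n" "A * g \<in> glr n" by (simp_all add: algebra_simps)
qed

lemma idn_GU_glr: "g \<in> GU n \<Longrightarrow> idn n * g \<in> glr n"
  using unip_glr(2)[OF GU_minus_one, of g n "idn n"] by simp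

lemma GU_split: "g - 1 \<in> glr n \<Longrightarrow> g = 1 - idn n + idn n * g"
proof -
  assume "g - 1 \<in> glr n"
  then have "idn n * (g - 1) = g - 1" by simp
  then have "idn n * g - idn n = g - 1" by (simp add: right_diff_distrib)
  then show ?thesis by (simp add: algebra_simps)
qed

lemma GL_eq_GU: "GL n = ent ` GU n"
proof (intro equalityI subsetI)
  fix g assume "g \<in> GL n"
  then obtain a b where ab: "g = GL_embed n a" "a \<in> carrier_mat n n" "b \<in> carrier_mat n n"
    "a * b = 1\<^sub>m n" "b * a = 1\<^sub>m n" by (rule GL_E)
  then have "emb n a \<in> GU n"
    unfolding GU_def by (auto intro!: emb_minus_one exI[of _ "emb n b"] simp: emb_mult emb_one)
  then show "g \<in> ent ` GU n" using ab by (auto simp: ent_emb[symmetric])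
next
  fix g assume "g \<in> ent ` GU n"
  then obtain G H where G: "g = ent G" "G - 1 \<in> glr n" "H - 1 \<in> glr n" "G * H = 1" "H * G = 1"
    by (auto simp: GU_def)
  define a b where "a = corner n (ent G)" and "b = corner n (ent H)"
  have ab: "emb n a = G" "emb n b = H" using G by (simp_all add: a_def b_def emb_corner)
  have c: "a \<in> carrier_mat n n" "b \<in> carrier_mat n n" by (simp_all add: a_def b_def)
  have "a * b = 1\<^sub>m n" "b * a = 1\<^sub>m n"
    using c G ab by (auto intro!: emb_inj simp: emb_mult[symmetric] emb_one)
  then have "GL_embed n a \<in> GL n" using c by (intro GL_I)
  then show "g \<in> GL n" using G ab by (simp add: ent_emb[symmetric])
qed

lemma inv_GL_inf:
  assumes "g \<in> GU n"
  shows "inv\<^bsub>GL_inf\<^esub> (ent g) = ent (rinv g)"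
proof (rule group.inv_equality[OF group_GL_inf])
  show "ent (rinv g) \<otimes>\<^bsub>GL_inf\<^esub> ent g = \<one>\<^bsub>GL_inf\<^esub>"
    using GU_rinv(2)[OF assms]
    by (simp add: GL_inf_def ent_mult[symmetric] one_rcmat.rep_eq[symmetric])
  show "ent g \<in> carrier GL_inf" "ent (rinv g) \<in> carrier GL_inf"
    using assms GU_rinv(3)[OF assms] by (auto simp: GL_inf_def GL_eq_GU)
qed

text \<open>\<open>X\<close> may have infinite rows and columns, so it is not an element of
  \<open>rcmat\<close> and the raw product is used; \<open>pad_AD\<close> leads back to the
  ring.\<close>

definition AD :: "rcmat \<Rightarrow> infmat \<Rightarrow> infmat" where
  "AD g X = inf_mult (inf_mult (ent g) X) (ent (rinv g))"

lemma Ad_ent: "g \<in> GU n \<Longrightarrow> Ad (ent g) X = AD g X"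
  by (simp add: Ad_def AD_def inv_GL_inf)

lemma unip_ent: "g - 1 \<in> glr n \<Longrightarrow> n \<le> i \<or> n \<le> j \<Longrightarrow> ent g i j = (if i = j then 1 else 0)"
  using glr_ent[of "g - 1" n i j] by (simp add: ent_one)

text \<open>Outside the corner of size \<open>m\<close> both \<open>g\<close> and its inverse are
  the identity, so truncation at \<open>m\<close> commutes with the conjugation.\<close>

lemma pad_AD:
  assumes "g \<in> GU m"
  shows "pad m (AD g X) = g * pad m X * rinv g"
proof (rule glr_ent_eqI[of _ m])
  have g: "g - 1 \<in> glr m" "rinv g - 1 \<in> glr m" using assms GU_rinv(3)[OF assms] by (auto intro: GU_minus_one)
  show "g * pad m X * rinv g \<in> glr m" by (intro unip_glr g pad_glr)
  fix i j assume ij: "i < m" "j < m"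
  have row: "inf_mult (ent g) Y i k = (\<Sum>l<m. ent g i l * Y l k)" for Y k
    by (rule inf_mult_sum_row) (use unip_ent[OF g(1)] ij in auto)
  have col: "inf_mult Y (ent (rinv g)) k j = (\<Sum>l<m. Y k l * ent (rinv g) l j)" for Y k
    by (rule inf_mult_sum_col) (use unip_ent[OF g(2)] ij in auto)
  show "ent (pad m (AD g X)) i j = ent (g * pad m X * rinv g) i j"
    using ij by (simp add: ent_pad AD_def ent_mult row col)
qed simp

lemma pad_eq_imp_eq:
  assumes "\<And>m. n \<le> m \<Longrightarrow> pad m X = pad m Y"
  shows "X = Y"
proof (intro ext)
  fix i j
  let ?m = "max n (Suc (max i j))"
  have "ent (pad ?m X) i j = ent (pad ?m Y) i j" using assms by simp
  moreover have "i < ?m" "j < ?m" by linarith+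
  ultimately show "X i j = Y i j" by (simp add: ent_pad)
qed

lemma GU_le: "g \<in> GU n \<Longrightarrow> n \<le> m \<Longrightarrow> g \<in> GU m" using GU_mono by blast

lemma AD_mult:
  assumes "g \<in> GU n" "h \<in> GU n"
  shows "AD g (AD h X) = AD (g * h) X"
proof (rule pad_eq_imp_eq[of n])
  fix m assume "n \<le> m"
  then have gh: "g \<in> GU m" "h \<in> GU m" using assms GU_le by blast+
  show "pad m (AD g (AD h X)) = pad m (AD (g * h) X)"
    by (simp add: pad_AD gh GU_mult rinv_mult[OF gh] mult.assoc)
qed

lemma AD_one: "AD 1 X = X"
  by (rule pad_eq_imp_eq[of 0]) (simp add: pad_AD GU_one rinv_eq[of 1 1])

lemma AD_eq_iff:
  assumes "g \<in> GU n"
  shows "AD g X = X \<longleftrightarrow> (\<forall>m\<ge>n. g * pad m X = pad m X * g)"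
proof -
  have "pad m (AD g X) = pad m X \<longleftrightarrow> g * pad m X = pad m X * g" if "n \<le> m" for m
  proof -
    have g: "g \<in> GU m" using assms that by (rule GU_le)
    show ?thesis unfolding pad_AD[OF g]
      using GU_rinv(1,2)[OF g] by (metis mult.assoc mult_1_right)
  qed
  then show ?thesis using pad_eq_imp_eq[of n "AD g X" X] by auto
qed

lemma pad_pad: "n \<le> m \<Longrightarrow> idn n * pad m X * idn n = pad n X"
  by (rule rcmat_eqI) (simp only: ent_mult_idn ent_idn_mult, simp add: ent_pad)

lemma GL_embed_mat_exp:
  assumes A: "A \<in> carrier_mat n n"
  shows "rm n (mat_exp A) = idn n * fexp (rm n A)" "GL_embed n (mat_exp A) = ent (fexp (rm n A))"
proof -
  show 1: "rm n (mat_exp A) = idn n * fexp (rm n A)"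
  proof (rule rcmat_eqI)
    fix i j
    show "ent (rm n (mat_exp A)) i j = ent (idn n * fexp (rm n A)) i j"
    proof (cases "i < n \<and> j < n")
      case True
      have "(A ^\<^sub>m k) $$ (i, j) = ent (rm n A ^ k) i j" for k
        using arg_cong[OF rm_pow[OF A, of k], of "\<lambda>B. ent B i j"] True
        by (simp add: ent_rm ent_idn_mult)
      then have "ent (rm n (mat_exp A)) i j = suminf (\<lambda>k. 1 / fact k * ent (rm n A ^ k) i j)"
        using True A by (simp add: ent_rm mat_exp_def)
      also have "\<dots> = ent (fexp (rm n A)) i j"
        unfolding fexp_def using pser_sums[OF rm_glr exp_bounded_shift[of 0], of n A i j]
        by (simp add: sums_iff)
      finally show ?thesis using True by (simp add: ent_idn_mult)
    next
      case False
      have "idn n * fexp (rm n A) \<in> glr n" by (rule idn_GU_glr[OF fexp_GU]) simp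
      then show ?thesis using False glr_ent[of _ n i j] by (auto simp: ent_rm not_less)
    qed
  qed
  have "emb n (mat_exp A) = fexp (rm n A)"
    unfolding emb_def 1 by (rule GU_split[symmetric]) (intro GU_minus_one fexp_GU rm_glr)
  then show "GL_embed n (mat_exp A) = ent (fexp (rm n A))" by (simp add: ent_emb[symmetric])
qed

lemma mat_exp_carrier: "A \<in> carrier_mat n n \<Longrightarrow> mat_exp A \<in> carrier_mat n n"
  by (simp add: mat_exp_def)

definition cpow :: "infmat \<Rightarrow> nat \<Rightarrow> nat \<Rightarrow> rcmat" where
  "cpow X i j = idn i * pad i X ^ j"

lemma cpow_glr [simp]: "cpow X i j \<in> glr i"
  unfolding cpow_def by (intro glr_idn_mult_power pad_glr)

lemma cpow_eq_pev: "cpow X i j = pev i (pad i X) (monom 1 j)"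
proof -
  have "pe (monom 1 j) M = M ^ j" for M by (induction j) (simp_all add: monom_Suc monom_0)
  then show ?thesis by (simp add: cpow_def pev_def)
qed

lemma cpow_commute: "cpow X i j * cpow X i k = cpow X i k * cpow X i j"
  by (simp add: cpow_eq_pev pev_mult[symmetric] mult.commute)

text \<open>The powers of one corner commute, which merges the product of exponentials into the
  exponential of a sum.\<close>

lemma A_factor_eq:
  "GL_embed i (A_factor t X i) = ent (fexp (\<Sum>j=1..i. sc (of_nat j * t i j) * cpow X i (j - 1)))"
proof -
  let ?B = "\<lambda>j. sc (of_nat j * t i j) * cpow X i (j - 1)"
  let ?m = "\<lambda>j. (of_nat j * t i j) \<cdot>\<^sub>m (corner i X ^\<^sub>m (j - 1))"
  have m: "?m j \<in> carrier_mat i i" for j by (intro smult_carrier_mat pow_carrier_mat corner_carrier)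
  have rmm: "rm i (?m j) = ?B j" for j
    by (simp add: rm_smult[OF pow_carrier_mat] rm_pow rm_corner cpow_def)
  have *: "foldr (*) (map (\<lambda>j. mat_exp (?m j)) js) (1\<^sub>m i) \<in> carrier_mat i i \<and>
      emb i (foldr (*) (map (\<lambda>j. mat_exp (?m j)) js) (1\<^sub>m i)) = fexp (sum_list (map ?B js))" for js
  proof (induction js)
    case (Cons j js)
    let ?R = "foldr (*) (map (\<lambda>j. mat_exp (?m j)) js) (1\<^sub>m i)"
    have e: "emb i (mat_exp (?m j)) = fexp (?B j)"
      using GL_embed_mat_exp(2)[OF m, of j] unfolding rmm ent_emb[symmetric] by (simp add: ent_inject)
    have c: "cpow X i k * sum_list (map ?B js) = sum_list (map ?B js) * cpow X i k" for k
      by (induction js) (simp_all add: distrib_left distrib_right sc_left_commute[of "cpow _ _ _"] mult.assoc cpow_commute)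
    have g: "sum_list (map ?B js) \<in> glr i"
      by (induction js) (auto intro: glr_intros cpow_glr)
    have "fexp (?B j + sum_list (map ?B js)) = fexp (?B j) * fexp (sum_list (map ?B js))"
      by (rule fexp_add[OF _ g])
        (auto intro!: glr_sc simp only: cpow_glr mult.assoc c sc_left_commute[of "sum_list _"])
    then show ?case using Cons mat_exp_carrier[OF m, of j] e emb_mult[OF mat_exp_carrier[OF m, of j], of ?R]
      by simp
  qed (simp add: emb_one)
  have "sum_list (map ?B [1..<Suc i]) = (\<Sum>j=1..i. ?B j)"
    by (simp only: interv_sum_list_conv_sum_set_nat set_upt atLeastLessThanSuc_atLeastAtMost)
  then show ?thesis
    using *[of "[1..<Suc i]"] unfolding A_factor_def ent_emb[symmetric] by simp
qed

section \<open>The product sets \<open>L_n\<close> and the orbit of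
  \<open>A(\<infinity>)\<close>\<close>

definition ZZ :: "infmat \<Rightarrow> nat \<Rightarrow> rcmat set" where
  "ZZ X i = {z \<in> GU i. z * pad i X = pad i X * z}"

primrec LS :: "infmat \<Rightarrow> nat \<Rightarrow> rcmat set" where
  "LS X 0 = {1}"
| "LS X (Suc n) = {g * z | g z. g \<in> LS X n \<and> z \<in> ZZ X (Suc n)}"

lemma ZZ_GU: "z \<in> ZZ X i \<Longrightarrow> z \<in> GU i" by (simp add: ZZ_def)

lemma ZZ_idn_commute:
  assumes "z \<in> ZZ X i"
  shows "idn i * z * pad i X = pad i X * (idn i * z)"
proof -
  have "idn i * z * pad i X = idn i * (pad i X * z)" using assms by (simp add: ZZ_def mult.assoc)
  also have "\<dots> = pad i X * idn i * z" by simp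
  finally show ?thesis by (simp only: mult.assoc)
qed

lemma LS_GU: "g \<in> LS X n \<Longrightarrow> g \<in> GU n"
proof (induction n arbitrary: g)
  case (Suc n)
  then obtain h z where "g = h * z" "h \<in> LS X n" "z \<in> ZZ X (Suc n)" by auto
  then show ?case using GU_mult[OF GU_le[OF Suc.IH[of h]] ZZ_GU[of z X "Suc n"]] by simp
qed (simp add: GU_one)

lemma ZZ_one: "1 \<in> ZZ X n" by (simp add: ZZ_def GU_one)

lemma LS_Suc_subset: "LS X n \<subseteq> LS X (Suc n)"
  using ZZ_one[of X "Suc n"] by force

lemma LS_mono: "n \<le> m \<Longrightarrow> LS X n \<subseteq> LS X m"
  by (induction m rule: dec_induct) (use LS_Suc_subset in blast)+

definition A_exponent :: "(nat \<Rightarrow> nat \<Rightarrow> complex) \<Rightarrow> infmat \<Rightarrow> nat \<Rightarrow> rcmat" where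
  "A_exponent t X i = (\<Sum>j=1..i. sc (of_nat j * t i j) * cpow X i (j - 1))"

lemma A_exponent_glr: "A_exponent t X i \<in> glr i"
  unfolding A_exponent_def by (intro glr_sum glr_sc cpow_glr)

primrec A_group :: "(nat \<Rightarrow> nat \<Rightarrow> complex) \<Rightarrow> infmat \<Rightarrow> nat \<Rightarrow> rcmat" where
  "A_group t X 0 = 1"
| "A_group t X (Suc n) = A_group t X n * fexp (A_exponent t X (Suc n))"

lemma A_group_GU: "A_group t X n \<in> GU n"
proof (induction n)
  case (Suc n)
  then show ?case using GU_le[OF Suc, of "Suc n"] by (auto intro!: GU_mult fexp_GU A_exponent_glr)
qed (simp add: GU_one)

text \<open>Elements of \<open>A(n + 1)\<close> have components of index at most \<open>n\<close>,
  so they act through \<open>z_1 ... z_n\<close>; hence the shift between \<open>A_act\<close> and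
  \<open>A_group\<close>.\<close>

lemma A_act_eq: "A_act (Suc n) t X = AD (A_group t X n) X"
proof -
  let ?f = "\<lambda>i. fexp (A_exponent t X i)"
  have "foldr (\<lambda>g h. g \<otimes>\<^bsub>GL_inf\<^esub> h) (map (\<lambda>i. GL_embed i (A_factor t X i)) js) \<one>\<^bsub>GL_inf\<^esub>
      = ent (prod_list (map ?f js))" for js
    by (induction js) (simp_all add: GL_inf_def one_rcmat.rep_eq A_factor_eq A_exponent_def ent_mult)
  moreover have "prod_list (map ?f [1..<Suc n]) = A_group t X n"
    by (induction n) simp_all
  ultimately show ?thesis
    using Ad_ent[OF A_group_GU, of t X n X] by (simp add: A_act_def del: upt_Suc)
qed

lemma A_act_0: "A_act 0 t X = X"
  using A_act_eq[of 0 t X] by (simp add: A_act_def AD_one)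

lemma cpow_pad_commute: "cpow X i j * pad i X = pad i X * cpow X i j"
  by (simp add: cpow_eq_pev pev_self_commute)

lemma fexp_commute: "A \<in> glr n \<Longrightarrow> B * A = A * B \<Longrightarrow> B * fexp A = fexp A * B"
  unfolding fexp_def using pser_commute[OF _ exp_bounded_shift[of 0]] by simp

lemma fexp_A_exponent_ZZ: "fexp (A_exponent t X i) \<in> ZZ X i"
proof -
  have "pad i X * A_exponent t X i = A_exponent t X i * pad i X"
    by (simp add: A_exponent_def sum_distrib_left sum_distrib_right mult.assoc
        sc_left_commute[of "pad _ _"] cpow_pad_commute)
  then show ?thesis
    using fexp_commute[OF A_exponent_glr, of "pad i X" t X i] fexp_GU[OF A_exponent_glr, of t X i]
    by (simp add: ZZ_def)
qed

lemma A_group_LS: "A_group t X n \<in> LS X n"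
proof (induction n)
  case (Suc n)
  then show ?case using fexp_A_exponent_ZZ[of t X "Suc n"] by auto
qed simp

text \<open>\<open>fexp_surj_centralizer\<close> gives a logarithm that is a polynomial in
  \<open>X_i\<close>; its coefficients provide the coordinates \<open>t\<close>.\<close>

lemma ZZ_eq_fexp:
  assumes nd: "nonderogatory i (pad i X)" and z: "z \<in> ZZ X i"
  obtains t where "z = fexp (A_exponent t X i)"
proof -
  have zG: "z \<in> GU i" by (rule ZZ_GU[OF z])
  note zi = unip_idn[OF GU_minus_one[OF zG]] unip_idn[OF GU_minus_one[OF GU_rinv(3)[OF zG]]]
  have "idn i * z * (idn i * rinv z) = idn i"
  proof -
    have "idn i * z * (idn i * rinv z) = z * (idn i * (idn i * rinv z))"
      by (simp only: zi(1) mult.assoc)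
    also have "\<dots> = z * (idn i * rinv z)" by simp
    also have "\<dots> = z * rinv z * idn i" by (simp only: zi(2) mult.assoc)
    finally show ?thesis using GU_rinv(1)[OF zG] by simp
  qed
  then obtain p where p: "idn i * fexp (pev i (pad i X) p) = idn i * z"
    using fexp_surj_centralizer[OF nd idn_GU_glr[OF zG] ZZ_idn_commute[OF z]
      idn_GU_glr[OF GU_rinv(3)[OF zG]]] by blast
  let ?L = "pev i (pad i X) p"
  have L: "?L \<in> glr i" "?L * pad i X = pad i X * ?L" by (simp_all add: pev_glr pev_self_commute)
  obtain c where c: "?L = (\<Sum>j<i. sc (c j) * (idn i * pad i X ^ j))"
    using nonderogatory_centralizer[OF nd L] by blast
  \<comment> \<open>Division by \<open>j\<close> undoes the factor \<open>j\<close> in the exponent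
    \<open>j t_ij X_i^(j-1)\<close>.\<close>
  define t where "t = (\<lambda>(k::nat) j. c (j - 1) / of_nat j :: complex)"
  have "A_exponent t X i = (\<Sum>j=1..i. sc (c (j - 1)) * cpow X i (j - 1))"
    unfolding A_exponent_def t_def by (intro sum.cong) auto
  also have "\<dots> = (\<Sum>j<i. sc (c j) * cpow X i j)"
    by (rule sum.reindex_bij_witness[of _ Suc "\<lambda>j. j - 1"]) auto
  finally have "A_exponent t X i = ?L" using c by (simp add: cpow_def)
  moreover have "z = fexp ?L"
    using GU_split[OF GU_minus_one[OF zG]] GU_split[OF GU_minus_one[OF fexp_GU[OF L(1)]]] p by simp
  ultimately show thesis using that[of t] by simp
qed

lemma A_group_cong: "(\<And>i j. i \<le> n \<Longrightarrow> t i j = s i j) \<Longrightarrow> A_group t X n = A_group s X n"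
  by (induction n) (auto simp: A_exponent_def)

lemma LS_eq_A_group:
  assumes nd: "\<And>i. nonderogatory i (pad i X)" and g: "g \<in> LS X n"
  obtains t where "t \<in> A_space (Suc n)" "g = A_group t X n"
proof -
  have "\<exists>t. t \<in> A_space (Suc n) \<and> g = A_group t X n"
    using g
  proof (induction n arbitrary: g)
    case 0
    then show ?case by (intro exI[of _ "\<lambda>_ _. 0"]) (simp add: A_space_def)
  next
    case (Suc n)
    then obtain h z where hz: "g = h * z" "h \<in> LS X n" "z \<in> ZZ X (Suc n)" by auto
    obtain t where t: "t \<in> A_space (Suc n)" "h = A_group t X n" using Suc.IH[OF hz(2)] by blast
    obtain s where s: "z = fexp (A_exponent s X (Suc n))" using ZZ_eq_fexp[OF nd hz(3)] by blast
    define u where "u i j = (if i = Suc n then (if 1 \<le> j \<and> j \<le> i then s i j else 0) else t i j)" for i j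
    have "u \<in> A_space (Suc (Suc n))"
      using t(1) unfolding A_space_def u_def by (auto simp: less_Suc_eq)
    moreover have "A_group u X n = A_group t X n" by (rule A_group_cong) (auto simp: u_def)
    moreover have "A_exponent u X (Suc n) = A_exponent s X (Suc n)"
      unfolding A_exponent_def u_def by (intro sum.cong) auto
    ultimately show ?case using hz t s by (intro exI[of _ u]) simp
  qed
  with that show thesis by blast
qed

theorem A_orbit_eq:
  assumes nd: "\<And>i. nonderogatory i (pad i X)"
  shows "A_orbit X = (\<Union>n. (\<lambda>g. AD g X) ` LS X n)"
proof (intro equalityI subsetI)
  fix Y assume "Y \<in> A_orbit X"
  then obtain n t where nt: "Y = A_act n t X" by (auto simp: A_orbit_def)
  show "Y \<in> (\<Union>n. (\<lambda>g. AD g X) ` LS X n)"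
  proof (cases n)
    case 0
    then show ?thesis using nt by (auto simp: A_act_0 AD_one intro!: exI[of _ 0])
  next
    case (Suc m)
    then have "Y = AD (A_group t X m) X" using nt by (simp add: A_act_eq)
    then show ?thesis using A_group_LS[of t X m] by auto
  qed
next
  fix Y assume "Y \<in> (\<Union>n. (\<lambda>g. AD g X) ` LS X n)"
  then obtain n g where g: "g \<in> LS X n" "Y = AD g X" by auto
  obtain t where "t \<in> A_space (Suc n)" "g = A_group t X n" using LS_eq_A_group[OF nd g(1)] by blast
  then have "Y = A_act (Suc n) t X" using g(2) by (simp add: A_act_eq)
  then show "Y \<in> A_orbit X" using \<open>t \<in> A_space (Suc n)\<close> unfolding A_orbit_def by blast
qed

section \<open>Strong regularity\<close>

text \<open>An arbitrary block of size \<open>n\<close> together with an arbitrary diagonal: a shape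
  shared by \<open>glr n\<close> and \<open>1 + glr n\<close> and closed under products. Row
  \<open>i\<close> ends before \<open>max n (Suc i)\<close> uniformly, so entries of products along
  a curve are finite sums of fixed length.\<close>

definition banded :: "nat \<Rightarrow> rcmat \<Rightarrow> bool" where
  "banded n A \<longleftrightarrow> (\<forall>i j. (n \<le> i \<or> n \<le> j) \<and> i \<noteq> j \<longrightarrow> ent A i j = 0)"

definition mat_deriv :: "nat \<Rightarrow> (complex \<Rightarrow> rcmat) \<Rightarrow> rcmat \<Rightarrow> bool" where
  "mat_deriv n M D \<longleftrightarrow> (\<forall>s. banded n (M s)) \<and>
     (\<forall>i j. ((\<lambda>s. ent (M s) i j) has_field_derivative ent D i j) (at 0))"

lemma banded_mult_ent:
  "banded n A \<Longrightarrow> ent (A * B) i j = (\<Sum>k<max n (Suc i). ent A i k * ent B k j)"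
  unfolding ent_mult by (rule inf_mult_sum_row) (auto simp: banded_def)

lemma banded_mult: "banded n A \<Longrightarrow> banded n B \<Longrightarrow> banded n (A * B)"
  unfolding banded_def[of n "A * B"]
proof (intro allI impI)
  fix i j assume A: "banded n A" and B: "banded n B" and ij: "(n \<le> i \<or> n \<le> j) \<and> i \<noteq> j"
  have "ent A i k * ent B k j = 0" for k
    using A B ij unfolding banded_def by (cases "k = i"; cases "n \<le> i"; cases "k = j") auto
  then show "ent (A * B) i j = 0" unfolding banded_mult_ent[OF A] by (intro sum.neutral) blast
qed

lemma banded_one: "banded n 1" by (simp add: banded_def ent_one)
lemma glr_banded: "A \<in> glr n \<Longrightarrow> banded n A" by (auto simp: banded_def glr_ent)
lemma unip_banded: "g - 1 \<in> glr n \<Longrightarrow> banded n g" by (auto simp: banded_def unip_ent)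

lemma mat_deriv_mult:
  assumes "mat_deriv n M D" "mat_deriv n N E"
  shows "mat_deriv n (\<lambda>s. M s * N s) (D * N 0 + M 0 * E)"
  unfolding mat_deriv_def
proof (intro conjI allI)
  fix s show "banded n (M s * N s)" using assms by (auto simp: mat_deriv_def intro: banded_mult)
next
  fix i j
  let ?m = "max n (Suc i)"
  have bM: "banded n (M s)" for s using assms by (simp add: mat_deriv_def)
  \<comment> \<open>Entries outside the band vanish identically along the curve, and so do their
    derivatives.\<close>
  have D: "ent D i k = 0" if "?m \<le> k" for k
  proof -
    have "(\<lambda>s. ent (M s) i k) = (\<lambda>_. 0)" using bM that by (auto simp: banded_def)
    then have "((\<lambda>_. 0) has_field_derivative ent D i k) (at (0::complex))"
      using assms(1) by (auto simp: mat_deriv_def dest: spec2[of _ i k])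
    then show ?thesis using DERIV_unique[OF _ DERIV_const] by blast
  qed
  have "((\<lambda>s. \<Sum>k<?m. ent (M s) i k * ent (N s) k j) has_field_derivative
      (\<Sum>k<?m. ent D i k * ent (N 0) k j + ent E k j * ent (M 0) i k)) (at 0)"
    using assms by (intro DERIV_sum DERIV_mult) (auto simp: mat_deriv_def)
  moreover have "(\<Sum>k<?m. ent D i k * ent (N 0) k j) = ent (D * N 0) i j"
    unfolding ent_mult by (rule inf_mult_sum_row[symmetric]) (rule D)
  moreover have "(\<Sum>k<?m. ent E k j * ent (M 0) i k) = ent (M 0 * E) i j"
    by (simp add: banded_mult_ent[OF bM] mult.commute)
  ultimately show "((\<lambda>s. ent (M s * N s) i j) has_field_derivative ent (D * N 0 + M 0 * E) i j) (at 0)"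
    by (simp add: banded_mult_ent[OF bM] sum.distrib)
qed

lemma mat_deriv_const: "banded n A \<Longrightarrow> mat_deriv n (\<lambda>_. A) 0"
  by (simp add: mat_deriv_def)

lemma mat_deriv_fexp: "A \<in> glr n \<Longrightarrow> mat_deriv n (\<lambda>s. fexp (sc s * A)) A"
  unfolding mat_deriv_def
  by (auto intro: fexp_has_derivative_0 unip_banded fexp_minus_one_glr glr_sc)

lemma mat_deriv_pow:
  assumes "mat_deriv n M D"
  shows "mat_deriv n (\<lambda>s. M s ^ k) (\<Sum>l<k. M 0 ^ l * D * M 0 ^ (k - Suc l))"
proof (induction k)
  case 0
  show ?case using mat_deriv_const[OF banded_one, of n] by simp
next
  case (Suc k)
  have "(\<Sum>l<Suc k. M 0 ^ l * D * M 0 ^ (Suc k - Suc l))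
      = D * M 0 ^ k + M 0 * (\<Sum>l<k. M 0 ^ l * D * M 0 ^ (k - Suc l))"
    by (simp add: sum.lessThan_Suc_shift sum_distrib_left mult.assoc del: sum.lessThan_Suc)
  then show ?case using mat_deriv_mult[OF assms Suc] by simp
qed

lemma glr_mult_power: "A \<in> glr n \<Longrightarrow> M \<in> glr n \<Longrightarrow> A * M ^ k \<in> glr n"
  by (induction k) (simp_all add: power_Suc2 glr_mult mult.assoc[symmetric] del: power_Suc)

text \<open>Cyclicity of the trace makes all \<open>k\<close> terms of the noncommutative power rule
  equal.\<close>

lemma tr_power_deriv:
  assumes "mat_deriv n M D" "D \<in> glr n" "M 0 \<in> glr n"
  shows "((\<lambda>s. tr (M s ^ k) n) has_field_derivative of_nat k * tr (M 0 ^ (k - 1) * D) n) (at 0)"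
proof -
  have "((\<lambda>s. tr (M s ^ k) n) has_field_derivative
      tr (\<Sum>l<k. M 0 ^ l * D * M 0 ^ (k - Suc l)) n) (at 0)"
    unfolding tr_def using mat_deriv_pow[OF assms(1), of k]
    by (intro DERIV_sum) (auto simp: mat_deriv_def)
  moreover have "tr (M 0 ^ l * D * M 0 ^ (k - Suc l)) n = tr (M 0 ^ (k - 1) * D) n" if "l < k" for l
  proof -
    have "tr (M 0 ^ l * D * M 0 ^ (k - Suc l)) n = tr (D * M 0 ^ (k - Suc l) * M 0 ^ l) n"
      using tr_commute[OF glr_mult_power[OF assms(2,3)], of "k - Suc l" "M 0 ^ l"]
      by (simp add: mult.assoc)
    also have "\<dots> = tr (D * M 0 ^ (k - 1)) n"
      using that by (simp add: mult.assoc power_add[symmetric])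
    finally show ?thesis by (simp add: tr_commute[OF assms(2)])
  qed
  ultimately show ?thesis by (simp add: tr_sum)
qed

lemma f_tr_eq: "f_tr n j X = tr (pad n X ^ j) n"
proof -
  have "f_tr n j X = tr (idn n * pad n X ^ j) n"
    unfolding f_tr_def by (subst mtrace_rm[of _ n]) (simp_all add: pow_carrier_mat rm_pow rm_corner)
  then show ?thesis by (simp add: tr_def ent_idn_mult)
qed

text \<open>Under the trace pairing, truncation to the corner of size \<open>n\<close> is adjoint to
  the inclusion of \<open>glr n\<close>.\<close>

lemma tr_corner:
  assumes "A \<in> glr n" "n \<le> m"
  shows "tr (A * B) m = tr (A * (idn n * B * idn n)) n"
proof -
  have A: "A = A * idn n" "A = idn n * A" using assms by simp_all
  have im: "idn n \<in> glr m" using glr_mono[OF assms(2)] by auto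
  have "tr (A * B) m = tr (idn n * (A * (idn n * B))) m"
    using assms(1) by (simp add: mult.assoc[symmetric])
  also have "\<dots> = tr (A * (idn n * B) * idn n) m" by (rule tr_commute[OF im])
  also have "\<dots> = tr (A * (idn n * B) * idn n) n"
  proof (rule tr_stable[OF _ assms(2)])
    show "A * (idn n * B) * idn n \<in> glr n"
      unfolding glr_iff using assms(1) by (simp add: mult.assoc)
  qed
  finally show ?thesis by (simp add: mult.assoc)
qed

lemma differential_f_tr:
  "differential (f_tr n j) X Z = of_nat j * tr (pad n X ^ (j - 1) * pad n Z) n"
proof -
  have p: "pad n (\<lambda>i j. X i j + s * Z i j) = pad n X + sc s * pad n Z" for s
    by (rule rcmat_eqI) (simp add: ent_pad)
  have "mat_deriv n (\<lambda>s. pad n X + sc s * pad n Z) (pad n Z)"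
    unfolding mat_deriv_def
  proof (intro conjI allI)
    fix s show "banded n (pad n X + sc s * pad n Z)"
      by (intro glr_banded glr_add glr_sc pad_glr)
  next
    fix i j
    have "((\<lambda>s. ent (pad n X) i j + s * ent (pad n Z) i j) has_field_derivative ent (pad n Z) i j) (at 0)"
      by (auto intro!: derivative_eq_intros)
    then show "((\<lambda>s. ent (pad n X + sc s * pad n Z) i j) has_field_derivative ent (pad n Z) i j) (at 0)"
      by simp
  qed
  from tr_power_deriv[OF this, of j] show ?thesis
    unfolding differential_def f_tr_eq p by (simp add: DERIV_imp_deriv)
qed

text \<open>Written as traces against \<open>Z_m\<close> for one large \<open>m\<close>, the
  differentials at \<open>X\<close> are the pairings with \<open>j\<close> times the powers
  \<open>X_n^(j-1)\<close>. A relation between the powers, with coefficients divided by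
  \<open>j\<close>, is thus a relation between the differentials.\<close>

lemma strongly_regular_independent:
  assumes sr: "strongly_regular X" and F: "finite F" "F \<subseteq> {(n, j). 1 \<le> j \<and> j \<le> n}"
    and zero: "(\<Sum>(n, j)\<in>F. sc (c (n, j)) * cpow X n (j - 1)) = 0" and p: "p \<in> F"
  shows "c p = 0"
proof -
  define c' where "c' = (\<lambda>p. c p / of_nat (snd p))"
  obtain m where m: "\<And>n j. (n, j) \<in> F \<Longrightarrow> n \<le> m"
  proof (rule that[of "\<Sum>p\<in>F. fst p"])
    fix n j assume "(n, j) \<in> F"
    then show "n \<le> (\<Sum>p\<in>F. fst p)" using member_le_sum[of "(n, j)" F fst] F(1) by simp
  qed
  have "(\<Sum>(n, j)\<in>F. c' (n, j) * differential (f_tr n j) X Z) = 0" for Z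
  proof -
    have "c' (n, j) * differential (f_tr n j) X Z = tr (sc (c (n, j)) * cpow X n (j - 1) * pad m Z) m"
      if nj: "(n, j) \<in> F" for n j
    proof -
      have "j \<noteq> 0" using F(2) nj by auto
      have "tr (cpow X n (j - 1) * pad m Z) m = tr (cpow X n (j - 1) * pad n Z) n"
        using tr_corner[OF cpow_glr m[OF nj], of X "j - 1" "pad m Z"] pad_pad[OF m[OF nj]] by simp
      also have "\<dots> = tr (pad n X ^ (j - 1) * pad n Z) n"
        unfolding cpow_def mult.assoc by (simp add: tr_def ent_idn_mult)
      finally show ?thesis
        using \<open>j \<noteq> 0\<close> by (simp add: differential_f_tr c'_def mult.assoc tr_sc)
    qed
    then have "(\<Sum>(n, j)\<in>F. c' (n, j) * differential (f_tr n j) X Z)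
        = (\<Sum>(n, j)\<in>F. tr (sc (c (n, j)) * cpow X n (j - 1) * pad m Z) m)"
      by (intro sum.cong refl) auto
    also have "\<dots> = tr ((\<Sum>(n, j)\<in>F. sc (c (n, j)) * cpow X n (j - 1)) * pad m Z) m"
      by (simp add: sum_distrib_right tr_sum case_prod_beta)
    finally show ?thesis unfolding zero by (simp add: tr_def)
  qed
  then have "c' p = 0" using sr F p unfolding strongly_regular_def by blast
  then show ?thesis using F(2) p by (auto simp: c'_def)
qed

section \<open>Centralizers of the corners\<close>

definition cent :: "infmat \<Rightarrow> nat \<Rightarrow> rcmat set" where
  "cent X i = {B \<in> glr i. B * pad i X = pad i X * B}"

text \<open>The algebraic content of strong regularity, in a form that can be transported to the
  other points of the orbit (\<open>sreg_AD\<close>).\<close>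

definition sreg :: "infmat \<Rightarrow> bool" where
  "sreg X \<longleftrightarrow> (\<forall>n. nonderogatory n (pad n X)) \<and> (\<forall>n. \<forall>B\<in>glr n. B \<in> cent X (Suc n) \<longrightarrow> B = 0)"

lemma cpow_cent: "cpow X i j \<in> cent X i"
  by (simp add: cent_def cpow_pad_commute)

lemma cent_commute_corner:
  assumes "B \<in> glr n" "n \<le> m" "B * pad m X = pad m X * B"
  shows "B \<in> cent X n"
proof -
  have "B * pad n X = B * (idn n * pad m X * idn n)" using pad_pad[OF assms(2)] by simp
  also have "\<dots> = B * pad m X * idn n" using assms(1) by (simp add: mult.assoc[symmetric])
  also have "\<dots> = idn n * (pad m X * B)" using assms by (simp add: mult.assoc) (simp add: mult.assoc[symmetric] assms(3)[symmetric])
  also have "\<dots> = idn n * pad m X * idn n * B" using assms(1) by (simp add: mult.assoc)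
  also have "\<dots> = pad n X * B" using pad_pad[OF assms(2)] by simp
  finally show ?thesis using assms(1) by (simp add: cent_def)
qed

lemma cent_span:
  assumes "nonderogatory n (pad n X)" "B \<in> cent X n"
  obtains c where "B = (\<Sum>j<n. sc (c j) * cpow X n j)"
  using nonderogatory_centralizer[OF assms(1), of B] assms(2) unfolding cent_def cpow_def by blast

text \<open>An element of \<open>gl(n)\<close> commuting with \<open>X_(n+1)\<close> also commutes
  with \<open>X_n\<close>, by compression. Being a polynomial in each of the two, it yields a linear
  relation between powers of two different corners, whose coefficients all vanish.\<close>

theorem strongly_regular_imp_sreg:
  assumes sr: "strongly_regular X"
  shows "sreg X"
proof -
  have shift: "(\<Sum>j<n. f j) = (\<Sum>(k, j)\<in>{n} \<times> {1..n}. f (j - 1))" for n and f :: "nat \<Rightarrow> rcmat"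
    by (rule sum.reindex_bij_witness[of _ "\<lambda>(k, j). j - 1" "\<lambda>j. (n, Suc j)"]) auto
  have nd: "nonderogatory n (pad n X)" for n
    unfolding nonderogatory_def
  proof (intro conjI allI impI)
    fix c j assume "(\<Sum>j<n. sc (c j) * (idn n * pad n X ^ j)) = 0" and j: "j < n"
    then have "(\<Sum>j<n. sc (c j) * cpow X n j) = 0" by (simp add: cpow_def)
    then have "(\<Sum>(k, j)\<in>{n} \<times> {1..n}. sc (c (j - 1)) * cpow X n (j - 1)) = 0" unfolding shift .
    also have "(\<Sum>(k, j)\<in>{n} \<times> {1..n}. sc (c (j - 1)) * cpow X n (j - 1))
        = (\<Sum>(k, j)\<in>{n} \<times> {1..n}. sc ((\<lambda>p. c (snd p - 1)) (k, j)) * cpow X k (j - 1))"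
      by (intro sum.cong) auto
    finally have "(\<lambda>p. c (snd p - 1)) (n, Suc j) = 0"
      by (rule strongly_regular_independent[OF sr, rotated 2]) (use j in auto)
    then show "c j = 0" by simp
  qed simp
  moreover have "B = 0" if B: "B \<in> glr n" "B \<in> cent X (Suc n)" for n B
  proof -
    have "B \<in> cent X n" using B by (intro cent_commute_corner[of B n "Suc n"]) (auto simp: cent_def)
    then obtain c where c: "B = (\<Sum>j<n. sc (c j) * cpow X n j)" using cent_span[OF nd] by blast
    obtain d where d: "B = (\<Sum>j<Suc n. sc (d j) * cpow X (Suc n) j)" using cent_span[OF nd B(2)] by blast
    define e where "e = (\<lambda>p::nat \<times> nat. if fst p = n then c (snd p - 1) else - d (snd p - 1))"
    let ?F1 = "{n} \<times> {1..n}" and ?F2 = "{Suc n} \<times> {1..Suc n}"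
    have "(\<Sum>(k, j)\<in>?F1 \<union> ?F2. sc (e (k, j)) * cpow X k (j - 1))
        = (\<Sum>(k, j)\<in>?F1. sc (e (k, j)) * cpow X k (j - 1)) + (\<Sum>(k, j)\<in>?F2. sc (e (k, j)) * cpow X k (j - 1))"
      by (rule sum.union_disjoint) auto
    also have "(\<Sum>(k, j)\<in>?F1. sc (e (k, j)) * cpow X k (j - 1)) = (\<Sum>(k, j)\<in>?F1. sc (c (j - 1)) * cpow X n (j - 1))"
      by (intro sum.cong) (auto simp: e_def)
    also have "\<dots> = B" unfolding c shift ..
    also have "(\<Sum>(k, j)\<in>?F2. sc (e (k, j)) * cpow X k (j - 1))
        = - (\<Sum>(k, j)\<in>?F2. sc (d (j - 1)) * cpow X (Suc n) (j - 1))"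
      unfolding sum_negf[symmetric] by (intro sum.cong) (auto simp: e_def sc_uminus)
    also have "(\<Sum>(k, j)\<in>?F2. sc (d (j - 1)) * cpow X (Suc n) (j - 1)) = B" unfolding d shift ..
    finally have z: "(\<Sum>(k, j)\<in>?F1 \<union> ?F2. sc (e (k, j)) * cpow X k (j - 1)) = 0" by simp
    have "c j = 0" if "j < n" for j
    proof -
      have "e (n, Suc j) = 0"
        by (rule strongly_regular_independent[OF sr _ _ z]) (use that in auto)
      then show ?thesis by (simp add: e_def)
    qed
    then show ?thesis using c by simp
  qed
  ultimately show ?thesis by (auto simp: sreg_def)
qed

lemma sreg_nd: "sreg X \<Longrightarrow> nonderogatory n (pad n X)" by (simp add: sreg_def)

lemma sreg_stab:
  assumes "sreg X" "g - 1 \<in> glr n" "g * pad (Suc n) X = pad (Suc n) X * g"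
  shows "g = 1"
proof -
  have "g - 1 \<in> cent X (Suc n)"
    using assms(2,3) glr_mono[of n "Suc n"] by (auto simp: cent_def algebra_simps)
  then have "g - 1 = 0" using assms(1,2) unfolding sreg_def by blast
  then show ?thesis by simp
qed

text \<open>\<open>rinv h * g\<close> fixes \<open>X\<close>, hence commutes with the corner of size
  \<open>n + 1\<close>, one larger than its own block.\<close>

lemma AD_inj:
  assumes "sreg X" "g \<in> GU n" "h \<in> GU n" "AD g X = AD h X"
  shows "g = h"
proof -
  let ?k = "rinv h * g"
  have k: "?k \<in> GU n" using assms GU_rinv(3) GU_mult by blast
  have "AD ?k X = AD (rinv h) (AD h X)"
    using assms by (simp add: AD_mult[OF GU_rinv(3)[OF assms(3)] assms(2), symmetric])
  also have "\<dots> = X" using assms(3) by (simp add: AD_mult[OF GU_rinv(3)] GU_rinv AD_one)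
  finally have "?k = 1"
    using AD_eq_iff[OF k] by (intro sreg_stab[OF assms(1) GU_minus_one[OF k]]) auto
  then have "h * (rinv h * g) = h" by simp
  then show ?thesis by (simp add: GU_cancel[OF assms(3)])
qed

lemma LS_restrict:
  assumes "sreg X" "g \<in> LS X m" "g \<in> GU n"
  shows "g \<in> LS X n"
proof (cases "m \<le> n")
  case True
  then show ?thesis using LS_mono assms by blast
next
  case False
  then have "n \<le> m" by simp
  then show ?thesis using assms(2)
  proof (induction m rule: dec_induct)
    case (step m)
    then obtain h z where hz: "g = h * z" "h \<in> LS X m" "z \<in> ZZ X (Suc m)" by auto
    have hG: "h \<in> GU m" by (rule LS_GU[OF hz(2)])
    have "z = rinv h * g" using hz(1) by (simp add: GU_cancel[OF hG])
    then have "z \<in> GU m" using GU_mult[OF GU_rinv(3)[OF hG] GU_le[OF assms(3)]] step(1) by simp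
    then have "z = 1"
      using hz(3) by (intro sreg_stab[OF assms(1)] GU_minus_one) (auto simp: ZZ_def)
    then show ?case using step hz by simp
  qed
qed

lemma pad_cong_le: "pad n W = pad n X \<Longrightarrow> i \<le> n \<Longrightarrow> pad i W = pad i X"
  by (metis pad_pad)

lemma LS_cong: "pad n W = pad n X \<Longrightarrow> m \<le> n \<Longrightarrow> LS W m = LS X m"
proof (induction m)
  case (Suc m)
  then have "ZZ W (Suc m) = ZZ X (Suc m)" using pad_cong_le[of n W X "Suc m"] by (simp add: ZZ_def)
  then show ?case using Suc by simp
qed simp

text \<open>The induction step for statements about \<open>AD g X\<close>: the point
  \<open>AD z X\<close> has the same corner of size \<open>n + 1\<close> as \<open>X\<close>, hence
  the same \<open>LS\<close> at level \<open>n\<close>, so an induction hypothesis for all base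
  points applies to \<open>h\<close> there.\<close>

lemma LS_Suc_split:
  assumes "g \<in> LS X (Suc n)"
  obtains h z where "g = h * z" "h \<in> LS X n" "z \<in> ZZ X (Suc n)" "AD g X = AD h (AD z X)"
    "pad (Suc n) (AD z X) = pad (Suc n) X" "LS (AD z X) n = LS X n"
proof -
  from assms obtain h z where hz: "g = h * z" "h \<in> LS X n" "z \<in> ZZ X (Suc n)" by auto
  have z: "z \<in> GU (Suc n)" "z * pad (Suc n) X = pad (Suc n) X * z" using hz by (auto simp: ZZ_def)
  have h: "h \<in> GU (Suc n)" using LS_GU[OF hz(2)] GU_le[of h n "Suc n"] by simp
  have p: "pad (Suc n) (AD z X) = pad (Suc n) X"
    using GU_rinv(1)[OF z(1)] by (simp add: pad_AD[OF z(1)] z(2) mult.assoc)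
  show thesis
    by (rule that[OF hz _ p]) (use hz AD_mult[OF h z(1)] LS_cong[OF p] in simp_all)
qed

text \<open>Conjugation by the last factor \<open>z_n\<close> leaves all corners up to size
  \<open>n\<close> alone, so only the factors \<open>z_1, ..., z_i\<close> can change the corner of
  size \<open>i + 1\<close>. The conjugating element therefore lies in \<open>GL(i)\<close>, one
  size below the corner.\<close>

lemma pad_AD_LS:
  assumes "g \<in> LS X n"
  shows "\<exists>k\<in>LS X i. pad (Suc i) (AD g X) = k * pad (Suc i) X * rinv k"
  using assms
proof (induction n arbitrary: g X)
  case 0
  have "(1::rcmat) \<in> LS X i" using LS_mono[of 0 i X] by auto
  then show ?case using 0 by (intro bexI[of _ 1]) (auto simp: AD_one rinv_eq[of 1 1])
next
  case (Suc n)
  show ?case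
  proof (cases "Suc n \<le> i")
    case True
    have "g \<in> GU (Suc i)" using LS_GU[OF Suc.prems] True GU_le by simp
    then show ?thesis using Suc.prems LS_mono[OF True, of X] by (intro bexI[of _ g]) (auto simp: pad_AD)
  next
    case False
    obtain h z where hz: "h \<in> LS X n" "AD g X = AD h (AD z X)"
      "pad (Suc n) (AD z X) = pad (Suc n) X" "LS (AD z X) n = LS X n"
      using LS_Suc_split[OF Suc.prems] by metis
    then obtain k where k: "k \<in> LS (AD z X) i" "pad (Suc i) (AD h (AD z X)) = k * pad (Suc i) (AD z X) * rinv k"
      using Suc.IH[of h "AD z X"] by auto
    have "pad (Suc i) (AD z X) = pad (Suc i) X" "LS (AD z X) i = LS X i"
      using False pad_cong_le[OF hz(3), of "Suc i"] LS_cong[OF hz(3), of i] by auto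
    then show ?thesis using k hz(2) by auto
  qed
qed

text \<open>Conjugation by \<open>GL(i)\<close> maps \<open>gl(i)\<close> to itself and therefore
  preserves both requirements on the corner of size \<open>i + 1\<close>; by
  \<open>pad_AD_LS\<close> this corner is moved by nothing larger.\<close>

theorem sreg_AD:
  assumes X: "sreg X" and g: "g \<in> LS X n"
  shows "sreg (AD g X)"
proof -
  let ?Y = "AD g X"
  have K: "\<exists>k\<in>GU i. pad (Suc i) ?Y = k * pad (Suc i) X * rinv k" for i
    using pad_AD_LS[OF g, of i] LS_GU by blast
  have "nonderogatory m (pad m ?Y)" for m
  proof (cases m)
    case 0
    then show ?thesis by (simp add: nonderogatory_def)
  next
    case (Suc i)
    obtain k where k: "k \<in> GU i" "pad m ?Y = k * pad m X * rinv k" using K[of i] Suc by auto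
    have kG: "k \<in> GU m" using k(1) Suc GU_le[of k i m] by simp
    have pw: "idn m * pad m ?Y ^ j = k * (idn m * pad m X ^ j) * rinv k" for j
    proof (induction j)
      case 0
      have "k * (idn m * rinv k) = k * (rinv k * idn m)"
        using unip_idn[OF GU_minus_one[OF GU_rinv(3)[OF kG]]] by simp
      then show ?case by (simp add: mult.assoc GU_cancel[OF kG])
    next
      case (Suc j)
      have "idn m * pad m ?Y ^ Suc j = idn m * pad m ?Y ^ j * pad m ?Y"
        by (simp only: power_Suc2 mult.assoc)
      also have "\<dots> = k * (idn m * pad m X ^ j) * (rinv k * (k * (pad m X * rinv k)))"
        by (subst Suc, subst k(2)) (simp only: mult.assoc)
      also have "\<dots> = k * (idn m * pad m X ^ Suc j) * rinv k"
        by (simp only: GU_cancel[OF kG] power_Suc2 mult.assoc)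
      finally show ?case .
    qed
    show ?thesis
      unfolding nonderogatory_def
    proof (intro conjI allI impI)
      fix c j assume z: "(\<Sum>j<m. sc (c j) * (idn m * pad m ?Y ^ j)) = 0" and j: "j < m"
      let ?S = "\<Sum>j<m. sc (c j) * (idn m * pad m X ^ j)"
      have "(\<Sum>j<m. sc (c j) * (idn m * pad m ?Y ^ j)) = k * ?S * rinv k"
        unfolding pw by (simp add: sum_distrib_left sum_distrib_right mult.assoc sc_left_commute[of k])
      then have "rinv k * (k * (?S * rinv k)) * k = 0" using z by (simp add: mult.assoc)
      then have "?S = 0" unfolding GU_cancel[OF kG] using GU_rinv(2)[OF kG] by (simp add: mult.assoc)
      then show "c j = 0" using sreg_nd[OF X, of m] j by (simp add: nonderogatory_def)
    qed simp
  qed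
  moreover have "B = 0" if B: "B \<in> glr i" "B \<in> cent ?Y (Suc i)" for i B
  proof -
    obtain k where k: "k \<in> GU i" "pad (Suc i) ?Y = k * pad (Suc i) X * rinv k" using K by blast
    define C where "C = rinv k * B * k"
    have C: "C \<in> glr i" unfolding C_def by (intro unip_glr GU_minus_one k(1) GU_rinv(3)[OF k(1)] B(1))
    have "C * pad (Suc i) X = rinv k * (B * pad (Suc i) ?Y) * k"
      unfolding C_def k(2) using GU_rinv(2)[OF k(1)] by (simp add: mult.assoc)
    also have "\<dots> = pad (Suc i) X * C"
      using B(2) unfolding cent_def C_def k(2) by (simp add: mult.assoc GU_cancel[OF k(1)])
    finally have "C \<in> cent X (Suc i)" using C glr_mono[of i "Suc i"] by (auto simp: cent_def)
    then have "C = 0" using X C unfolding sreg_def by blast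
    then have "k * (rinv k * (B * (k * rinv k))) = 0" by (simp add: C_def mult.assoc[symmetric])
    then show ?thesis by (simp add: GU_cancel[OF k(1)] GU_rinv(1)[OF k(1)])
  qed
  ultimately show ?thesis by (auto simp: sreg_def)
qed

text \<open>At the top level, \<open>Y_(n+1) = h X_(n+1) h^-1\<close> shows that
  \<open>w = h^-1 fexp(A) h\<close> commutes with \<open>X_(n+1)\<close>, and
  \<open>fexp A * g = h * (w * z)\<close> absorbs it into the last factor. At lower levels the flow
  acts on \<open>h\<close> alone, over the base point \<open>AD z X\<close>.\<close>

theorem LS_flow:
  assumes "g \<in> LS X n" "i \<le> n" "A \<in> cent (AD g X) i"
  shows "fexp A * g \<in> LS X n"
  using assms
proof (induction n arbitrary: g X)
  case 0
  then have "A = 0" by (intro glr_ent_eqI[of _ 0]) (auto simp: cent_def glr_zero)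
  then show ?case using 0 by simp
next
  case (Suc n)
  obtain h z where hz: "g = h * z" "h \<in> LS X n" "z \<in> ZZ X (Suc n)" "AD g X = AD h (AD z X)"
      "pad (Suc n) (AD z X) = pad (Suc n) X" "LS (AD z X) n = LS X n"
    using LS_Suc_split[OF Suc.prems(1)] by metis
  show ?case
  proof (cases "i \<le> n")
    case True
    then have "fexp A * h \<in> LS (AD z X) n"
      using Suc.IH[of h "AD z X"] Suc.prems hz by simp
    then show ?thesis using hz by (auto simp: mult.assoc[symmetric])
  next
    case False
    then have i: "i = Suc n" using Suc.prems by simp
    have h: "h \<in> GU (Suc n)" using LS_GU[OF hz(2)] GU_le[of h n "Suc n"] by simp
    have A: "A \<in> glr (Suc n)" "A * pad (Suc n) (AD g X) = pad (Suc n) (AD g X) * A"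
      using Suc.prems(3) unfolding cent_def i by auto
    have Y: "pad (Suc n) (AD g X) = h * pad (Suc n) X * rinv h"
      by (simp add: hz(4,5) pad_AD[OF h])
    define w where "w = rinv h * fexp A * h"
    have E: "pad (Suc n) (AD g X) * fexp A = fexp A * pad (Suc n) (AD g X)"
      by (rule fexp_commute[OF A(1)]) (use A in simp)
    have "w * pad (Suc n) X = rinv h * (fexp A * pad (Suc n) (AD g X)) * h"
      unfolding w_def Y using GU_rinv(2)[OF h] by (simp add: mult.assoc)
    also have "\<dots> = pad (Suc n) X * w"
      unfolding E[symmetric] unfolding w_def Y by (simp add: mult.assoc GU_cancel[OF h])
    finally have w: "w \<in> ZZ X (Suc n)"
      unfolding ZZ_def w_def using h A by (auto intro!: GU_mult GU_rinv(3) fexp_GU)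
    have wz: "w * z \<in> ZZ X (Suc n)"
    proof -
      have "w * (z * pad (Suc n) X) = pad (Suc n) X * w * z"
        using w hz(3) by (simp add: ZZ_def mult.assoc[symmetric])
      then show ?thesis using w hz(3) by (auto simp: ZZ_def GU_mult mult.assoc)
    qed
    have "fexp A * g = h * (w * z)"
      unfolding hz(1) w_def by (simp add: mult.assoc GU_cancel[OF h])
    then show ?thesis using wz hz(2) by auto
  qed
qed

section \<open>The symplectic form on the Lie algebra\<close>

definition kk_form :: "nat \<Rightarrow> infmat \<Rightarrow> rcmat \<Rightarrow> rcmat \<Rightarrow> complex" where
  "kk_form n Y A B = tr (pad n Y * (A * B - B * A)) n"

lemma kk_form_alt:
  assumes "A \<in> glr n" "B \<in> glr n"
  shows "kk_form n Y A B = tr (A * (B * pad n Y - pad n Y * B)) n"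
proof -
  have "tr (pad n Y * (A * B)) n = tr (A * (B * pad n Y)) n"
    using tr_commute[OF pad_glr, of n Y "A * B"] by (simp add: mult.assoc)
  moreover have "tr (pad n Y * (B * A)) n = tr (A * (pad n Y * B)) n"
    using tr_commute[OF assms(1), of "pad n Y * B"] by (simp add: mult.assoc)
  ultimately show ?thesis by (simp add: kk_form_def right_diff_distrib tr_diff)
qed

lemma kk_form_antisym: "kk_form n Y A B = - kk_form n Y B A"
  by (simp add: kk_form_def right_diff_distrib tr_diff)

lemma kk_form_stable:
  assumes "A \<in> glr n" "B \<in> glr n" "n \<le> m"
  shows "kk_form m Y A B = kk_form n Y A B"
proof -
  have C: "A * B - B * A \<in> glr n" using assms by (intro glr_intros)
  have "kk_form m Y A B = tr ((A * B - B * A) * pad m Y) m"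
    unfolding kk_form_def by (rule tr_commute) simp
  also have "\<dots> = tr ((A * B - B * A) * pad n Y) n"
    using tr_corner[OF C assms(3), of "pad m Y"] pad_pad[OF assms(3)] by simp
  also have "\<dots> = kk_form n Y A B"
    unfolding kk_form_def by (rule tr_commute[OF C])
  finally show ?thesis .
qed

lemma kk_form_sum_left: "kk_form n Y (\<Sum>x\<in>F. f x) B = (\<Sum>x\<in>F. kk_form n Y (f x) B)"
  by (simp add: kk_form_def sum_distrib_left sum_distrib_right sum_subtractf[symmetric] tr_sum)

lemma cent_glr: "A \<in> cent Y i \<Longrightarrow> i \<le> n \<Longrightarrow> A \<in> glr n"
  using glr_mono by (auto simp: cent_def)

text \<open>Let \<open>i \<le> k\<close>. The form is the trace of \<open>A\<close> against
  \<open>[B, Y_n]\<close>, of which only the corner of size \<open>i\<close> counts; already the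
  corner of size \<open>k\<close> vanishes, being \<open>[B, Y_k]\<close>.\<close>

lemma cent_isotropic:
  assumes "A \<in> cent Y i" "B \<in> cent Y k" "i \<le> n" "k \<le> n"
  shows "kk_form n Y A B = 0"
proof -
  have *: "kk_form n Y A B = 0" if A: "A \<in> cent Y i" and B: "B \<in> cent Y k" and "i \<le> k" "k \<le> n" for A B i k
  proof -
    have "i \<le> n" using that by simp
    let ?D = "B * pad n Y - pad n Y * B"
    have Bk: "B \<in> glr k" "B * pad k Y = pad k Y * B" using B by (auto simp: cent_def)
    have "idn k * ?D * idn k = B * (idn k * pad n Y * idn k) - idn k * pad n Y * idn k * B"
      using Bk(1) by (simp add: right_diff_distrib left_diff_distrib mult.assoc)
        (simp add: mult.assoc[symmetric])
    then have k0: "idn k * ?D * idn k = 0" using Bk(2) pad_pad[OF \<open>k \<le> n\<close>, of Y] by simp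
    have ik: "idn i \<in> glr k" using glr_mono[OF \<open>i \<le> k\<close>] by auto
    have "idn i * (idn k * ?D * idn k) * idn i = idn i * ?D * idn i"
      using ik by (simp add: mult.assoc del: right_diff_distrib) (simp add: mult.assoc[symmetric])
    then have "idn i * ?D * idn i = 0" using k0 by simp
    moreover have "A \<in> glr i" using A by (simp add: cent_def)
    ultimately have "tr (A * ?D) n = 0" using tr_corner[OF _ \<open>i \<le> n\<close>, of A ?D] by (simp add: tr_def)
    then show ?thesis using kk_form_alt[OF cent_glr[OF A \<open>i \<le> n\<close>] cent_glr[OF B \<open>k \<le> n\<close>]] by simp
  qed
  show ?thesis
  proof (cases "i \<le> k")
    case True
    then show ?thesis using * assms by blast
  next
    case False
    then have "kk_form n Y B A = 0" using *[of B k A i] assms by simp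
    then show ?thesis using kk_form_antisym[of n Y A B] by simp
  qed
qed

text \<open>Conjugate transpose. Its positive definite trace form supplies the complement needed in
  the dimension count: if \<open>T\<close> is trace-orthogonal to its own adjoint, it is
  zero.\<close>

lift_definition ctr :: "rcmat \<Rightarrow> rcmat" is "\<lambda>A i j. cnj (A j i)"
  unfolding rc_finite_def by simp

lemma ent_ctr [simp]: "ent (ctr A) i j = cnj (ent A j i)" by transfer simp

lemma ctr_sum: "ctr (\<Sum>x\<in>F. sc (c x) * f x) = (\<Sum>x\<in>F. sc (cnj (c x)) * ctr (f x))"
  by (rule rcmat_eqI) simp

lemma ctr_glr: "A \<in> glr n \<Longrightarrow> ctr A \<in> glr n" by (auto simp: glr_def)

lemma tr_ctr_eq_0:
  assumes "A \<in> glr n" "tr (ctr A * A) n = 0"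
  shows "A = 0"
proof (rule glr_ent_eqI[OF assms(1) glr_zero])
  fix i j assume ij: "i < n" "j < n"
  have "tr (ctr A * A) n = of_real (\<Sum>j<n. \<Sum>i<n. (cmod (ent A i j))\<^sup>2)"
    unfolding tr_def
    by (subst glr_mult_ent[OF ctr_glr[OF assms(1)]]) (simp add: complex_norm_square[symmetric] mult.commute)
  then have "(\<Sum>j<n. \<Sum>i<n. (cmod (ent A i j))\<^sup>2) = 0" using assms(2) by (metis of_real_eq_0_iff)
  then have "(\<Sum>i<n. (cmod (ent A i j))\<^sup>2) = 0"
    using ij by (subst (asm) sum_nonneg_eq_0_iff) (auto intro: sum_nonneg)
  then have "(cmod (ent A i j))\<^sup>2 = 0" using ij by (subst (asm) sum_nonneg_eq_0_iff) auto
  then show "ent A i j = ent 0 i j" by simp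
qed

lemma cent_sum: "(\<And>j. j \<in> F \<Longrightarrow> f j \<in> cent Y i) \<Longrightarrow> (\<Sum>j\<in>F. sc (c j) * f j) \<in> cent Y i"
  unfolding cent_def
  by (auto intro!: glr_sum glr_sc simp: sum_distrib_left sum_distrib_right mult.assoc sc_left_commute[of "pad _ _"])

text \<open>The terms of level \<open>n + 1\<close> add up to minus the lower ones, hence to an
  element of \<open>gl(n)\<close> that commutes with \<open>Y_(n+1)\<close> and vanishes; the
  nonderogatory property then kills the coefficients of that level.\<close>

lemma sreg_independent:
  assumes "sreg Y" "(\<Sum>i\<le>n. \<Sum>j<i. sc (c i j) * cpow Y i j) = 0" "i \<le> n" "j < i"
  shows "c i j = 0"
  using assms(2-)
proof (induction n)
  case (Suc n)
  let ?B = "\<Sum>j<Suc n. sc (c (Suc n) j) * cpow Y (Suc n) j"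
  let ?S = "\<Sum>i\<le>n. \<Sum>j<i. sc (c i j) * cpow Y i j"
  have "?S + ?B = 0" using Suc.prems(1) by simp
  then have BS: "?B = - ?S" by (simp add: eq_neg_iff_add_eq_0 add.commute)
  have "?S \<in> glr n"
    by (intro glr_sum glr_sc) (use cpow_glr glr_mono in blast)
  then have "?B \<in> glr n" unfolding BS by (rule glr_uminus)
  moreover have "?B \<in> cent Y (Suc n)" by (intro cent_sum cpow_cent)
  ultimately have B0: "?B = 0" using assms(1) unfolding sreg_def by blast
  then have "?S = 0" using BS by simp
  then show ?case
  proof (cases "i = Suc n")
    case True
    have "\<forall>j<Suc n. c (Suc n) j = 0"
      using sreg_nd[OF assms(1), of "Suc n"] B0 unfolding nonderogatory_def cpow_def by blast
    then show ?thesis using True Suc.prems by simp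
  next
    case False
    then show ?thesis using Suc \<open>?S = 0\<close> by simp
  qed
qed simp

section \<open>The subspace \<open>V\<close> at level \<open>n\<close> and its maximality\<close>

definition Vsp :: "infmat \<Rightarrow> nat \<Rightarrow> rcmat set" where
  "Vsp Y n = {\<Sum>i\<le>n. B i | B. \<forall>i\<le>n. B i \<in> cent Y i}"

lemma Vsp_glr: "A \<in> Vsp Y n \<Longrightarrow> A \<in> glr n"
  unfolding Vsp_def by (auto intro!: glr_sum cent_glr)

lemma Vsp_isotropic: "A \<in> Vsp Y n \<Longrightarrow> i \<le> n \<Longrightarrow> B \<in> cent Y i \<Longrightarrow> kk_form n Y A B = 0"
proof -
  assume A: "A \<in> Vsp Y n" and i: "i \<le> n" and B: "B \<in> cent Y i"
  then obtain C where C: "A = (\<Sum>k\<le>n. C k)" "\<And>k. k \<le> n \<Longrightarrow> C k \<in> cent Y k" by (auto simp: Vsp_def)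
  then have "kk_form n Y (C k) B = 0" if "k \<le> n" for k
    using cent_isotropic[OF C(2)[OF that] B that i] by simp
  then show ?thesis unfolding C(1) kk_form_sum_left by (intro sum.neutral) simp
qed

text \<open>Dimension count: the \<open>n(n+1)/2\<close> powers \<open>Y\<^sub>i\<^sup>j\<close> with \<open>j < i \<le> n\<close>, the conjugate transposes
  of the \<open>n(n-1)/2\<close> commutators \<open>[Y\<^sub>i\<^sup>j, Y\<^sub>n]\<close> with \<open>j < i < n\<close>, and \<open>A\<close> are \<open>n\<^sup>2 + 1\<close> elements
  of \<open>gl n\<close>; the conjugate transposes are Hermitian orthogonal to the others.\<close>

theorem Vsp_maximal:
  assumes sreg: "sreg Y" and A: "A \<in> glr n"
    and orth: "\<And>i B. i \<le> n \<Longrightarrow> B \<in> cent Y i \<Longrightarrow> kk_form n Y A B = 0"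
  shows "A \<in> Vsp Y n"
proof (cases n)
  case 0
  then have "A = 0" using A by (intro glr_ent_eqI[of _ 0]) (auto simp: glr_zero)
  then have "(\<Sum>i\<le>n. (0::rcmat)) = A" "\<forall>i\<le>n. 0 \<in> cent Y i" by (simp_all add: cent_def glr_zero)
  then show ?thesis unfolding Vsp_def by force
next
  case (Suc m)
  define I where "I n = Sigma {..n} (\<lambda>i. {..<i})" for n :: nat
  have cardI: "2 * card (I k) = k * (k + 1)" for k
    unfolding I_def by (induction k) (simp_all add: card_SigmaI)
  have finI: "finite (I k)" for k by (auto simp: I_def)
  define P where "P = (\<lambda>p. cpow Y (fst p) (snd p))"
  define K where "K p = P p * pad n Y - pad n Y * P p" for p
  have Pc: "P p \<in> cent Y (fst p)" for p unfolding P_def by (rule cpow_cent)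
  have In: "fst p \<le> k" if "p \<in> I k" for p k using that by (auto simp: I_def)
  have Pg: "P p \<in> glr n" if "fst p \<le> n" for p using Pc that by (rule cent_glr)
  have Kg: "K p \<in> glr n" if "fst p \<le> n" for p unfolding K_def by (intro glr_intros Pg that pad_glr)
  define J :: "((nat \<times> nat) + (nat \<times> nat) + unit) set" where
    "J = Inl ` I n \<union> ((Inr \<circ> Inl) ` I m \<union> {Inr (Inr ())})"
  define F where "F x = (case x of Inl p \<Rightarrow> P p | Inr (Inl p) \<Rightarrow> ctr (K p) | Inr (Inr _) \<Rightarrow> A)"
    for x :: "(nat \<times> nat) + (nat \<times> nat) + unit"
  have sumJ: "(\<Sum>x\<in>J. f x) = (\<Sum>p\<in>I n. f (Inl p)) + ((\<Sum>p\<in>I m. f (Inr (Inl p))) + f (Inr (Inr ())))"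
    for f :: "_ \<Rightarrow> rcmat"
    unfolding J_def using finI
    by (subst sum.union_disjoint; (subst sum.union_disjoint)?)
      (auto simp: sum.reindex inj_on_def comp_def)
  have "card J = card (I n) + (card (I m) + 1)"
    unfolding J_def using finI
    by (subst card_Un_disjoint; (subst card_Un_disjoint)?) (auto simp: card_image inj_on_def comp_def)
  then have "2 * card J > 2 * (n * n)" using cardI[of n] cardI[of m] Suc by (simp add: algebra_simps)
  then have card: "card J > n * n" by simp
  have "finite J" using finI by (simp add: J_def)
  have "\<exists>c. (\<exists>j\<in>J. c j \<noteq> 0) \<and> (\<Sum>j\<in>J. sc (c j) * F j) = 0"
  proof (rule glr_dependent[OF \<open>finite J\<close> card])
    show "n \<le> n" ..
    fix x assume "x \<in> J"
    then consider p where "x = Inl p" "p \<in> I n" | p where "x = Inr (Inl p)" "p \<in> I m" | "x = Inr (Inr ())"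
      unfolding J_def by auto
    then show "F x \<in> glr n"
    proof cases
      case 1
      then show ?thesis using Pg In by (simp add: F_def)
    next
      case 2
      then have "fst p \<le> n" using In[of p m] Suc by simp
      then show ?thesis using 2 Kg ctr_glr by (simp add: F_def)
    qed (simp add: F_def A)
    then show "F x * idn n = F x" by (rule mult_idn)
  qed
  then obtain c where c: "\<exists>j\<in>J. c j \<noteq> 0" "(\<Sum>j\<in>J. sc (c j) * F j) = 0" by blast
  define c1 c2 c3 where "c1 p = c (Inl p)" and "c2 p = c (Inr (Inl p))" and "c3 = c (Inr (Inr ()))" for p
  define S where "S = (\<Sum>p\<in>I n. sc (c1 p) * P p) + sc c3 * A"
  define T where "T = (\<Sum>p\<in>I m. sc (cnj (c2 p)) * K p)"
  have ST: "S + ctr T = 0"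
    using c(2) unfolding sumJ by (simp add: F_def S_def T_def ctr_sum c1_def c2_def c3_def add_ac)
  have Tg: "T \<in> glr n" unfolding T_def by (intro glr_sum glr_sc Kg) (use Suc In[of _ m] in fastforce)
  have orthP: "tr (P q * K p) n = 0" if "q \<in> I n" "p \<in> I m" for p q
    using cent_isotropic[OF Pc Pc, of q n p] kk_form_alt[OF Pg Pg, of q p Y] In[OF that(1)] In[OF that(2)] Suc
    unfolding K_def by simp
  have orthA: "tr (A * K p) n = 0" if "p \<in> I m" for p
    using orth[OF _ Pc, of p] kk_form_alt[OF A Pg, of p Y] In[OF that] Suc unfolding K_def by simp
  have "tr (S * T) n = 0"
  proof -
    have "tr (S * K p) n = 0" if "p \<in> I m" for p
      unfolding S_def using orthP[OF _ that] orthA[OF that]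
      by (simp add: distrib_right tr_add sum_distrib_right tr_sum mult.assoc tr_sc)
    then show ?thesis unfolding T_def
      by (simp add: sum_distrib_left tr_sum sc_left_commute[of S] tr_sc)
  qed
  \<comment> \<open>\<open>T\<close> is trace-orthogonal to \<open>S\<close>, and the dependency
    identifies \<open>S\<close> with \<open>- ctr T\<close>; so the sum of the squared absolute
    values of the entries of \<open>T\<close> is zero.\<close>
  moreover have "S = - ctr T" using ST by (simp add: eq_neg_iff_add_eq_0)
  ultimately have "tr (ctr T * T) n = 0" by (simp add: tr_def sum_negf)
  then have T0: "T = 0" by (rule tr_ctr_eq_0[OF Tg])
  have sumI: "(\<Sum>p\<in>I k. sc (d p) * P p) = (\<Sum>i\<le>k. \<Sum>j<i. sc (d (i, j)) * cpow Y i j)" for d k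
    unfolding I_def P_def by (subst sum.Sigma) (auto simp: case_prod_beta)
  have indep: "d p = 0" if "(\<Sum>p\<in>I k. sc (d p) * P p) = 0" "p \<in> I k" for d k p
    using sreg_independent[OF sreg, where n = k and c = "\<lambda>i j. d (i, j)" and i = "fst p" and j = "snd p"] that unfolding sumI
    by (auto simp: I_def)
  \<comment> \<open>\<open>T = 0\<close> says that a combination of powers from \<open>gl(m)\<close>
    commutes with \<open>Y_n\<close>, where \<open>n = m + 1\<close>; such an element is zero, and
    its coefficients vanish by independence.\<close>
  have c2: "c2 p = 0" if "p \<in> I m" for p
  proof -
    let ?B = "\<Sum>p\<in>I m. sc (cnj (c2 p)) * P p"
    have "?B * pad n Y - pad n Y * ?B = T"
      unfolding T_def K_def
      by (simp add: sum_distrib_left sum_distrib_right sum_subtractf right_diff_distrib mult.assoc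
          sc_left_commute[of "pad _ _"])
    then have comm: "?B * pad n Y = pad n Y * ?B" using T0 by simp
    have Bg: "?B \<in> glr m" by (intro glr_sum glr_sc cent_glr[OF Pc] In)
    then have "?B \<in> cent Y (Suc m)" using comm glr_mono[of m "Suc m"] Suc by (auto simp: cent_def)
    then have "?B = 0" using sreg Bg unfolding sreg_def by blast
    then have "cnj (c2 p) = 0" using that by (rule indep[where k = m and d = "\<lambda>p. cnj (c2 p)"])
    then show ?thesis by simp
  qed
  have "ctr 0 = 0" by (rule rcmat_eqI) simp
  then have S0: "S = 0" using ST T0 by simp
  \<comment> \<open>Without \<open>A\<close> the remaining relation between the powers would be
    trivial. With \<open>A\<close> it expresses \<open>A\<close> through the powers.\<close>
  have c3: "c3 \<noteq> 0"
  proof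
    assume "c3 = 0"
    then have "(\<Sum>p\<in>I n. sc (c1 p) * P p) = 0" using S0 by (simp add: S_def)
    then have "c1 p = 0" if "p \<in> I n" for p using indep that by blast
    then show False using c(1) c2 \<open>c3 = 0\<close> by (auto simp: J_def c1_def c2_def c3_def)
  qed
  have "sc c3 * A = - (\<Sum>p\<in>I n. sc (c1 p) * P p)" using S0 by (simp add: S_def eq_neg_iff_add_eq_0 add.commute)
  then have "A = sc (inverse c3) * - (\<Sum>p\<in>I n. sc (c1 p) * P p)"
    using sc_inverse_cancel[OF c3, of A] by simp
  also have "\<dots> = (\<Sum>p\<in>I n. sc (- inverse c3 * c1 p) * P p)"
    by (simp add: sum_distrib_left sum_negf[symmetric] sc_mult_left sc_uminus)
  finally have "A = (\<Sum>i\<le>n. \<Sum>j<i. sc (- inverse c3 * c1 (i, j)) * cpow Y i j)" unfolding sumI .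
  moreover have "\<forall>i\<le>n. (\<Sum>j<i. sc (- inverse c3 * c1 (i, j)) * cpow Y i j) \<in> cent Y i"
    by (intro allI impI cent_sum cpow_cent)
  ultimately show ?thesis unfolding Vsp_def by blast
qed

section \<open>Rational functions and local closedness\<close>

lemma poly_funs_prod: "(\<And>x. x \<in> F \<Longrightarrow> f x \<in> poly_funs n) \<Longrightarrow> (\<lambda>g. \<Prod>x\<in>F. f x g) \<in> poly_funs n"
  by (induction F rule: infinite_finite_induct) (auto intro: poly_funs.intros)

lemma poly_funs_power: "p \<in> poly_funs n \<Longrightarrow> (\<lambda>g. p g ^ k) \<in> poly_funs n"
  by (induction k) (auto intro: poly_funs.intros)

text \<open>A rational function regular at \<open>H\<close>. The domain \<open>q \<noteq> 0\<close>
  may depend on \<open>H\<close>, and outside it \<open>F\<close> is unrestricted, so functions with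
  junk values away from \<open>H\<close>, such as \<open>zfac\<close>, qualify.\<close>

definition rat_rep where
  "rat_rep n H F p q \<longleftrightarrow> p \<in> poly_funs n \<and> q \<in> poly_funs n \<and> q (ent H) \<noteq> 0 \<and>
     (\<forall>G\<in>GU n. q (ent G) \<noteq> 0 \<longrightarrow> F G = p (ent G) / q (ent G))"

definition rat :: "nat \<Rightarrow> rcmat \<Rightarrow> (rcmat \<Rightarrow> complex) \<Rightarrow> bool" where
  "rat n H F \<longleftrightarrow> (\<exists>p q. rat_rep n H F p q)"

lemma ratI: "rat_rep n H F p q \<Longrightarrow> rat n H F"
  unfolding rat_def by blast

lemma rat_const: "rat n H (\<lambda>_. c)"
  by (rule ratI[of _ _ _ "\<lambda>_. c" "\<lambda>_. 1"]) (auto simp: rat_rep_def intro: poly_funs.const)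

lemma rat_ent: "rat n H (\<lambda>G. ent G i j)"
proof (cases "i < n \<and> j < n")
  case True
  then show ?thesis
    by (intro ratI[of _ _ _ "\<lambda>g. g i j" "\<lambda>_. 1"])
      (auto simp: rat_rep_def intro: poly_funs.const poly_funs.coord)
next
  case False
  then show ?thesis
    by (intro ratI[of _ _ _ "\<lambda>_. if i = j then 1 else 0" "\<lambda>_. 1"])
      (auto simp: rat_rep_def unip_ent[OF GU_minus_one] intro: poly_funs.const)
qed

lemma rat_add:
  assumes "rat n H F" "rat n H F'"
  shows "rat n H (\<lambda>G. F G + F' G)"
proof -
  obtain p q p' q' where "rat_rep n H F p q" "rat_rep n H F' p' q'"
    using assms by (auto simp: rat_def)
  then have "rat_rep n H (\<lambda>G. F G + F' G) (\<lambda>g. p g * q' g + p' g * q g) (\<lambda>g. q g * q' g)"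
    by (auto simp: rat_rep_def field_simps intro: poly_funs.intros)
  then show ?thesis by (rule ratI)
qed

lemma rat_mult:
  assumes "rat n H F" "rat n H F'"
  shows "rat n H (\<lambda>G. F G * F' G)"
proof -
  obtain p q p' q' where "rat_rep n H F p q" "rat_rep n H F' p' q'"
    using assms by (auto simp: rat_def)
  then have "rat_rep n H (\<lambda>G. F G * F' G) (\<lambda>g. p g * p' g) (\<lambda>g. q g * q' g)"
    by (auto simp: rat_rep_def intro: poly_funs.intros)
  then show ?thesis by (rule ratI)
qed

lemma rat_inverse:
  assumes "rat n H F" "H \<in> GU n" "F H \<noteq> 0"
  shows "rat n H (\<lambda>G. inverse (F G))"
proof -
  obtain p q where "rat_rep n H F p q" using assms(1) by (auto simp: rat_def)
  then have "rat_rep n H (\<lambda>G. inverse (F G)) (\<lambda>g. q g * q g) (\<lambda>g. p g * q g)"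
    using assms(2,3) by (auto simp: rat_rep_def intro: poly_funs.intros)
  then show ?thesis by (rule ratI)
qed

lemma rat_sum: "(\<And>x. x \<in> A \<Longrightarrow> rat n H (f x)) \<Longrightarrow> rat n H (\<lambda>G. \<Sum>x\<in>A. f x G)"
  by (induction A rule: infinite_finite_induct) (auto intro: rat_const rat_add)

lemma rat_prod: "(\<And>x. x \<in> A \<Longrightarrow> rat n H (f x)) \<Longrightarrow> rat n H (\<lambda>G. \<Prod>x\<in>A. f x G)"
  by (induction A rule: infinite_finite_induct) (auto intro: rat_const rat_mult)

lemma rat_det:
  assumes "\<And>i j. i < k \<Longrightarrow> j < k \<Longrightarrow> rat n H (\<lambda>G. f G i j)"
  shows "rat n H (\<lambda>G. det (mat k k (\<lambda>(i, j). f G i j)))"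
proof -
  have "det (mat k k (\<lambda>(i, j). f G i j))
      = (\<Sum>p\<in>{p. p permutes {0..<k}}. signof p * (\<Prod>i\<in>{0..<k}. f G i (p i)))" for G
    unfolding det_def'[OF mat_carrier]
    by (intro sum.cong refl arg_cong2[where f = "(*)"] prod.cong) (auto simp: permutes_in_image[of _ "{0..<k}", simplified])
  moreover have "rat n H (\<lambda>G. \<Sum>p\<in>{p. p permutes {0..<k}}. signof p * (\<Prod>i\<in>{0..<k}. f G i (p i)))"
    by (intro rat_sum rat_mult rat_const rat_prod assms)
      (auto dest: permutes_in_image[of _ "{0..<k}"])
  ultimately show ?thesis by simp
qed

lemma rat_adj:
  assumes "\<And>i j. i < k \<Longrightarrow> j < k \<Longrightarrow> rat n H (\<lambda>G. f G i j)" "i < k" "j < k"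
  shows "rat n H (\<lambda>G. adj_mat (mat k k (\<lambda>(i, j). f G i j)) $$ (i, j))"
proof -
  have "adj_mat (mat k k (\<lambda>(i, j). f G i j)) $$ (i, j) =
      (- 1) ^ (j + i) * det (mat (k - 1) (k - 1)
        (\<lambda>(a, b). (\<lambda>G a b. f G (if a < j then a else Suc a) (if b < i then b else Suc b)) G a b))" for G
    using assms(2,3) unfolding adj_mat_def cofactor_def mat_delete_def
    by (auto intro!: arg_cong[where f = det] eq_matI)
  moreover have "rat n H (\<lambda>G. (- 1) ^ (j + i) * det (mat (k - 1) (k - 1)
        (\<lambda>(a, b). (\<lambda>G a b. f G (if a < j then a else Suc a) (if b < i then b else Suc b)) G a b)))"
    by (intro rat_mult rat_const rat_det assms(1)) auto
  ultimately show ?thesis by simp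
qed

text \<open>The inverse of \<open>g \<in> GU n\<close> by Cramer's rule; a junk value unless the \<open>n \<times> n\<close> corner is invertible.\<close>

definition adj_inv :: "nat \<Rightarrow> rcmat \<Rightarrow> rcmat" where
  "adj_inv n g = emb n (inverse (det (corner n (ent g))) \<cdot>\<^sub>m adj_mat (corner n (ent g)))"

lemma adj_inv_unip: "adj_inv n g - 1 \<in> glr n"
  by (simp add: adj_inv_def emb_minus_one)

lemma adj_inv_inverse:
  assumes "g - 1 \<in> glr n" "det (corner n (ent g)) \<noteq> 0"
  shows "g \<in> GU n" "rinv g = adj_inv n g"
proof -
  let ?A = "corner n (ent g)" and ?d = "det (corner n (ent g))"
  let ?B = "inverse ?d \<cdot>\<^sub>m adj_mat ?A"
  note adj = adj_mat[OF corner_carrier[of n "ent g"]]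
  have B: "?B \<in> carrier_mat n n" using adj(1) by simp
  have "inverse ?d \<cdot>\<^sub>m (?d \<cdot>\<^sub>m 1\<^sub>m n) = 1\<^sub>m n"
    using assms(2) by (intro eq_matI) auto
  then have "?A * ?B = 1\<^sub>m n" "?B * ?A = 1\<^sub>m n"
    using adj(2,3) mult_smult_distrib[OF corner_carrier adj(1)]
      mult_smult_assoc_mat[OF adj(1) corner_carrier] by simp_all
  then have "emb n ?A * emb n ?B = 1" "emb n ?B * emb n ?A = 1"
    using emb_mult[OF corner_carrier B] emb_mult[OF B corner_carrier] emb_one by simp_all
  then have eq: "g * adj_inv n g = 1" "adj_inv n g * g = 1"
    by (simp_all add: emb_corner[OF assms(1)] adj_inv_def)
  then show "rinv g = adj_inv n g" by (rule rinv_eq)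
  show "g \<in> GU n" unfolding GU_def using eq assms(1) adj_inv_unip by blast
qed

lemma GU_det:
  assumes "g \<in> GU n"
  shows "det (corner n (ent g)) \<noteq> 0"
proof -
  let ?a = "corner n (ent g)" and ?b = "corner n (ent (rinv g))"
  have "emb n (?a * ?b) = emb n (1\<^sub>m n)"
    using GU_rinv[OF assms] assms by (simp add: emb_mult[symmetric] emb_corner GU_minus_one emb_one)
  then have "?a * ?b = 1\<^sub>m n"
    by (rule emb_inj[OF _ mult_carrier_mat[OF corner_carrier corner_carrier] one_carrier_mat])
  then have "det ?a * det ?b = 1"
    using Determinant.det_mult[of ?a n ?b] by simp
  then show ?thesis by auto
qed

lemma rat_cong:
  assumes "rat n H F" "w \<in> poly_funs n" "w (ent H) \<noteq> 0"
    "\<And>G. G \<in> GU n \<Longrightarrow> w (ent G) \<noteq> 0 \<Longrightarrow> F' G = F G"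
  shows "rat n H F'"
proof -
  obtain p q where "rat_rep n H F p q" using assms(1) by (auto simp: rat_def)
  then have "rat_rep n H F' (\<lambda>g. p g * w g) (\<lambda>g. q g * w g)"
    using assms(2-) by (auto simp: rat_rep_def intro: poly_funs.intros)
  then show ?thesis by (rule ratI)
qed

lemma rat_cong_GU: "rat n H F \<Longrightarrow> (\<And>G. G \<in> GU n \<Longrightarrow> F' G = F G) \<Longrightarrow> rat n H F'"
  by (erule rat_cong[of _ _ _ "\<lambda>_. 1"]) (auto intro: poly_funs.const)

definition rmat :: "nat \<Rightarrow> rcmat \<Rightarrow> (rcmat \<Rightarrow> rcmat) \<Rightarrow> bool" where
  "rmat n H M \<longleftrightarrow> (\<forall>i j. rat n H (\<lambda>G. ent (M G) i j))"

lemma rmat_mult: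
  assumes "rmat n H M" "rmat n H N" "\<And>G. G \<in> GU n \<Longrightarrow> banded k (M G)"
  shows "rmat n H (\<lambda>G. M G * N G)"
  unfolding rmat_def
proof (intro allI)
  fix i j
  have "rat n H (\<lambda>G. \<Sum>l<max k (Suc i). ent (M G) i l * ent (N G) l j)"
    using assms(1,2) unfolding rmat_def by (intro rat_sum rat_mult) auto
  then show "rat n H (\<lambda>G. ent (M G * N G) i j)"
    by (rule rat_cong_GU) (rule banded_mult_ent[OF assms(3)])
qed

lemma rmat_const: "rmat n H (\<lambda>_. A)" by (simp add: rmat_def rat_const)
lemma rmat_id: "rmat n H (\<lambda>G. G)" by (simp add: rmat_def rat_ent)

lemma corner_mat: "corner k (ent g) = mat k k (\<lambda>(i, j). ent g i j)" by (simp add: corner_def)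

lemma rmat_adj_inv:
  assumes "rmat n H M" "H \<in> GU n" "M H \<in> GU k"
  shows "rmat n H (\<lambda>G. adj_inv k (M G))"
  unfolding rmat_def
proof (intro allI)
  fix i j
  have r: "rat n H (\<lambda>G. ent (M G) i j)" for i j using assms(1) by (simp add: rmat_def)
  show "rat n H (\<lambda>G. ent (adj_inv k (M G)) i j)"
  proof (cases "i < k \<and> j < k")
    case True
    have "rat n H (\<lambda>G. inverse (det (mat k k (\<lambda>(i, j). ent (M G) i j))) *
        adj_mat (mat k k (\<lambda>(i, j). ent (M G) i j)) $$ (i, j))"
      using True GU_det[OF assms(3)] unfolding corner_mat
      by (intro rat_mult rat_inverse rat_det rat_adj r assms(2)) auto
    moreover have "ent (adj_inv k (M G)) i j = inverse (det (mat k k (\<lambda>(i, j). ent (M G) i j))) *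
        adj_mat (mat k k (\<lambda>(i, j). ent (M G) i j)) $$ (i, j)" for G
      using True adj_mat(1)[OF corner_carrier[of k "ent (M G)"]]
      by (simp add: adj_inv_def emb_def ent_one ent_idn ent_rm corner_mat)
    ultimately show ?thesis by simp
  next
    case False
    then have "ent (adj_inv k (M G)) i j = (if i = j then 1 else 0)" for G
      by (intro unip_ent[OF adj_inv_unip]) auto
    then show ?thesis by (simp add: rat_const)
  qed
qed

lemma rinv_eq_adj_inv: "G \<in> GU n \<Longrightarrow> rinv G = adj_inv n G"
  using adj_inv_inverse(2)[OF GU_minus_one GU_det] by blast

lemma rmat_rinv:
  assumes "H \<in> GU n"
  shows "rmat n H rinv"
  unfolding rmat_def
proof (intro allI)
  fix i j
  have "rat n H (\<lambda>G. ent (adj_inv n G) i j)"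
    using rmat_adj_inv[OF rmat_id assms assms] by (simp add: rmat_def)
  then show "rat n H (\<lambda>G. ent (rinv G) i j)"
    by (rule rat_cong_GU) (simp add: rinv_eq_adj_inv)
qed

lemma rat_nonzero:
  assumes "rat n H F" "H \<in> GU n" "F H \<noteq> 0"
  obtains w where "w \<in> poly_funs n" "w (ent H) \<noteq> 0" "\<And>G. G \<in> GU n \<Longrightarrow> w (ent G) \<noteq> 0 \<Longrightarrow> F G \<noteq> 0"
proof -
  obtain p q where "rat_rep n H F p q" using assms(1) by (auto simp: rat_def)
  then show thesis
    using assms(2,3) by (intro that[of "\<lambda>g. p g * q g"]) (auto simp: rat_rep_def intro: poly_funs.intros)
qed

definition lclosed_rep where
  "lclosed_rep n H P w S \<longleftrightarrow> w \<in> poly_funs n \<and> S \<subseteq> poly_funs n \<and> w (ent H) \<noteq> 0 \<and>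
     (\<forall>G\<in>GU n. w (ent G) \<noteq> 0 \<longrightarrow> (P G \<longleftrightarrow> (\<forall>q\<in>S. q (ent G) = 0)))"

text \<open>Closedness near \<open>H\<close>: on the neighbourhood \<open>w \<noteq> 0\<close> the
  condition amounts to polynomial equations. A subset of \<open>GL(n)\<close> is locally closed once
  this holds at each of its points, and the pointwise form suits an induction whose denominators
  depend on the point.\<close>

definition lclosed :: "nat \<Rightarrow> rcmat \<Rightarrow> (rcmat \<Rightarrow> bool) \<Rightarrow> bool" where
  "lclosed n H P \<longleftrightarrow> (\<exists>w S. lclosed_rep n H P w S)"

lemma lclosedI: "lclosed_rep n H P w S \<Longrightarrow> lclosed n H P"
  unfolding lclosed_def by blast

lemma lclosed_conj:
  assumes "lclosed n H P" "lclosed n H Q"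
  shows "lclosed n H (\<lambda>G. P G \<and> Q G)"
proof -
  obtain w S w' S' where "lclosed_rep n H P w S" "lclosed_rep n H Q w' S'"
    using assms by (auto simp: lclosed_def)
  then have "lclosed_rep n H (\<lambda>G. P G \<and> Q G) (\<lambda>g. w g * w' g) (S \<union> S')"
    by (auto simp: lclosed_rep_def intro: poly_funs.mult)
  then show ?thesis by (rule lclosedI)
qed

lemma lclosed_True: "lclosed n H (\<lambda>_. True)"
  by (rule lclosedI[of _ _ _ "\<lambda>_. 1" "{}"]) (auto simp: lclosed_rep_def intro: poly_funs.const)

lemma lclosed_rat:
  assumes "rat n H F"
  shows "lclosed n H (\<lambda>G. F G = 0)"
proof -
  obtain p q where "rat_rep n H F p q" using assms by (auto simp: rat_def)
  then have "lclosed_rep n H (\<lambda>G. F G = 0) q {p}" by (auto simp: rat_rep_def lclosed_rep_def)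
  then show ?thesis by (rule lclosedI)
qed

lemma lclosed_ball: "finite A \<Longrightarrow> (\<And>x. x \<in> A \<Longrightarrow> lclosed n H (P x)) \<Longrightarrow> lclosed n H (\<lambda>G. \<forall>x\<in>A. P x G)"
  by (induction A rule: finite_induct) (auto intro: lclosed_conj lclosed_True)

lemma lclosed_cong:
  assumes "lclosed n H P" "w \<in> poly_funs n" "w (ent H) \<noteq> 0"
    "\<And>G. G \<in> GU n \<Longrightarrow> w (ent G) \<noteq> 0 \<Longrightarrow> Q G \<longleftrightarrow> P G"
  shows "lclosed n H Q"
proof -
  obtain w' S where "lclosed_rep n H P w' S" using assms(1) by (auto simp: lclosed_def)
  then have "lclosed_rep n H Q (\<lambda>g. w g * w' g) S"
    using assms(2-) by (auto simp: lclosed_rep_def intro: poly_funs.mult)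
  then show ?thesis by (rule lclosedI)
qed

lemma rat_common_denominator:
  assumes "finite A" "\<And>x. x \<in> A \<Longrightarrow> rat n H (f x)"
  obtains d p where "d \<in> poly_funs n" "d (ent H) \<noteq> 0" "\<And>x. x \<in> A \<Longrightarrow> p x \<in> poly_funs n"
    "\<And>x G. x \<in> A \<Longrightarrow> G \<in> GU n \<Longrightarrow> d (ent G) \<noteq> 0 \<Longrightarrow> f x G = p x (ent G) / d (ent G)"
proof -
  obtain p q where rep: "\<And>x. x \<in> A \<Longrightarrow> rat_rep n H (f x) (p x) (q x)"
    using assms(2) unfolding rat_def by metis
  then have pq: "p x \<in> poly_funs n" "q x \<in> poly_funs n" "q x (ent H) \<noteq> 0"
    "G \<in> GU n \<Longrightarrow> q x (ent G) \<noteq> 0 \<Longrightarrow> f x G = p x (ent G) / q x (ent G)" if "x \<in> A" for x G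
    using that unfolding rat_rep_def by blast+
  define d where "d = (\<lambda>g. \<Prod>x\<in>A. q x g)"
  define r where "r x = (\<lambda>g. p x g * (\<Prod>y\<in>A - {x}. q y g))" for x
  show thesis
  proof (rule that[of d r])
    show "d \<in> poly_funs n" unfolding d_def by (intro poly_funs_prod pq(2))
    show "d (ent H) \<noteq> 0" unfolding d_def using pq(3) assms(1) by simp
    fix x assume x: "x \<in> A"
    show "r x \<in> poly_funs n" unfolding r_def by (intro poly_funs.mult poly_funs_prod pq(1)[OF x] pq(2)) auto
    fix G assume G: "G \<in> GU n" "d (ent G) \<noteq> 0"
    have "d (ent G) = q x (ent G) * (\<Prod>y\<in>A - {x}. q y (ent G))"
      unfolding d_def by (rule prod.remove[OF assms(1) x])
    then show "f x G = r x (ent G) / d (ent G)" using G pq(4)[OF x G(1)] by (simp add: r_def)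
  qed
qed

lemma poly_funs_compose:
  assumes "d \<in> poly_funs n" "\<And>i j. i < k \<Longrightarrow> j < k \<Longrightarrow> p i j \<in> poly_funs n"
    "\<And>i j G. i < k \<Longrightarrow> j < k \<Longrightarrow> G \<in> GU n \<Longrightarrow> d (ent G) \<noteq> 0 \<Longrightarrow> ent (M G) i j = p i j (ent G) / d (ent G)"
    and q: "q \<in> poly_funs k"
  shows "\<exists>r\<in>poly_funs n. \<exists>e. \<forall>G\<in>GU n. d (ent G) \<noteq> 0 \<longrightarrow> q (ent (M G)) = r (ent G) / d (ent G) ^ e"
  using q
proof induction
  case (const c)
  then show ?case by (intro bexI[of _ "\<lambda>_. c"] exI[of _ 0]) (auto intro: poly_funs.const)
next
  case (coord i j)
  then show ?case using assms by (intro bexI[of _ "p i j"] exI[of _ 1]) auto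
next
  case (add q q')
  then obtain r e r' e' where *: "r \<in> poly_funs n" "r' \<in> poly_funs n"
    "\<forall>G\<in>GU n. d (ent G) \<noteq> 0 \<longrightarrow> q (ent (M G)) = r (ent G) / d (ent G) ^ e"
    "\<forall>G\<in>GU n. d (ent G) \<noteq> 0 \<longrightarrow> q' (ent (M G)) = r' (ent G) / d (ent G) ^ e'" by blast
  show ?case
    by (rule bexI[of _ "\<lambda>g. r g * d g ^ e' + r' g * d g ^ e"], rule exI[of _ "e + e'"])
      (use * assms(1) in \<open>auto simp: power_add field_simps intro!: poly_funs.add poly_funs.mult poly_funs_power\<close>)
next
  case (mult q q')
  then obtain r e r' e' where *: "r \<in> poly_funs n" "r' \<in> poly_funs n"
    "\<forall>G\<in>GU n. d (ent G) \<noteq> 0 \<longrightarrow> q (ent (M G)) = r (ent G) / d (ent G) ^ e"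
    "\<forall>G\<in>GU n. d (ent G) \<noteq> 0 \<longrightarrow> q' (ent (M G)) = r' (ent G) / d (ent G) ^ e'" by blast
  show ?case
    by (rule bexI[of _ "\<lambda>g. r g * r' g"], rule exI[of _ "e + e'"])
      (use * in \<open>auto simp: power_add intro!: poly_funs.mult\<close>)
qed

text \<open>With a common denominator \<open>d\<close> of the entries of \<open>M\<close>, a
  polynomial equation for \<open>M G\<close> becomes one for \<open>G\<close> after multiplication
  by a power of \<open>d\<close>. That \<open>M G\<close> lies in \<open>GU k\<close> is a condition
  on \<open>G\<close> of its own and enters through \<open>dom\<close>.\<close>

lemma lclosed_compose:
  assumes M: "rmat n H M" and H: "H \<in> GU n" and P: "lclosed k (M H) P"
    and dom: "lclosed n H (\<lambda>G. M G \<in> GU k)"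
  shows "lclosed n H (\<lambda>G. M G \<in> GU k \<and> P (M G))"
proof -
  have "finite ({..<k} \<times> {..<k})" by simp
  moreover have "rat n H (case x of (i, j) \<Rightarrow> \<lambda>G. ent (M G) i j)" for x
    using M by (auto simp: rmat_def split: prod.split)
  ultimately obtain d p where d: "d \<in> poly_funs n" "d (ent H) \<noteq> 0"
    "\<And>x. x \<in> {..<k} \<times> {..<k} \<Longrightarrow> p x \<in> poly_funs n"
    "\<And>x G. x \<in> {..<k} \<times> {..<k} \<Longrightarrow> G \<in> GU n \<Longrightarrow> d (ent G) \<noteq> 0 \<Longrightarrow>
      (case x of (i, j) \<Rightarrow> \<lambda>G. ent (M G) i j) G = p x (ent G) / d (ent G)"
    using rat_common_denominator[of "{..<k} \<times> {..<k}" n H "\<lambda>x. case x of (i, j) \<Rightarrow> \<lambda>G. ent (M G) i j"]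
    by blast
  have "\<exists>r e. r \<in> poly_funs n \<and> (\<forall>G\<in>GU n. d (ent G) \<noteq> 0 \<longrightarrow> q (ent (M G)) = r (ent G) / d (ent G) ^ e)"
    if "q \<in> poly_funs k" for q
    using poly_funs_compose[OF d(1) _ _ that, of "\<lambda>i j. p (i, j)" M] d(3) d(4)[of "(_, _)"] by auto
  then obtain r e where r: "\<And>q. q \<in> poly_funs k \<Longrightarrow> r q \<in> poly_funs n"
    "\<And>q G. q \<in> poly_funs k \<Longrightarrow> G \<in> GU n \<Longrightarrow> d (ent G) \<noteq> 0 \<Longrightarrow> q (ent (M G)) = r q (ent G) / d (ent G) ^ e q"
    by metis
  from P obtain w S where w: "w \<in> poly_funs k" "S \<subseteq> poly_funs k" "w (ent (M H)) \<noteq> 0"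
    "\<forall>G\<in>GU k. w (ent G) \<noteq> 0 \<longrightarrow> (P G \<longleftrightarrow> (\<forall>q\<in>S. q (ent G) = 0))"
    unfolding lclosed_def lclosed_rep_def by blast
  from dom obtain u T where u: "u \<in> poly_funs n" "T \<subseteq> poly_funs n" "u (ent H) \<noteq> 0"
    "\<forall>G\<in>GU n. u (ent G) \<noteq> 0 \<longrightarrow> (M G \<in> GU k \<longleftrightarrow> (\<forall>q\<in>T. q (ent G) = 0))"
    unfolding lclosed_def lclosed_rep_def by blast
  show ?thesis
  proof (rule lclosedI[of _ _ _ "\<lambda>g. u g * d g * r w g" "T \<union> r ` S"], unfold lclosed_rep_def, intro conjI ballI impI)
    show "T \<union> r ` S \<subseteq> poly_funs n" using u w r by auto
    show "u (ent H) * d (ent H) * r w (ent H) \<noteq> 0"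
      using u d w r(2)[OF w(1) H d(2)] by auto
    show "(\<lambda>g. u g * d g * r w g) \<in> poly_funs n" by (intro poly_funs.mult u d r w)
    fix G assume G: "G \<in> GU n" "u (ent G) * d (ent G) * r w (ent G) \<noteq> 0"
    have "w (ent (M G)) \<noteq> 0" using r(2)[OF w(1) G(1)] G(2) by auto
    moreover have "q (ent (M G)) = 0 \<longleftrightarrow> r q (ent G) = 0" if "q \<in> S" for q
      using r(2)[of q G] that w(2) G by auto
    ultimately show "M G \<in> GU k \<and> P (M G) \<longleftrightarrow> (\<forall>q\<in>T \<union> r ` S. q (ent G) = 0)"
      using u(4) w(4) G by auto
  qed
qed

lemma unip_inverse:
  assumes "g \<in> GU n" "g - 1 \<in> glr m"
  shows "g \<in> GU m"
proof -
  have "rinv g - 1 = (1 - g) * rinv g" "rinv g - 1 = rinv g * (1 - g)"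
    using GU_rinv[OF assms(1)] by (simp_all add: left_diff_distrib right_diff_distrib)
  moreover have g1: "1 - g \<in> glr m" using glr_uminus[OF assms(2)] by simp
  ultimately have "rinv g - 1 \<in> glr m" unfolding glr_iff
    by (metis mult.assoc idn_mult mult_idn)
  then show ?thesis unfolding GU_def using assms(2) GU_rinv[OF assms(1)] by blast
qed

section \<open>Recovering the last factor of an element of \<open>L_(m+1)\<close>\<close>

definition last_idn :: "nat \<Rightarrow> rcmat" where "last_idn m = idn (Suc m) - idn m"

lemma ent_last_idn: "ent (last_idn m) i j = (if i = m \<and> j = m then 1 else 0)"
  by (auto simp: last_idn_def ent_idn)

lemma ent_last_idn_mult: "ent (last_idn m * A) i j = (if i = m then ent A i j else 0)"
  by (auto simp: last_idn_def left_diff_distrib ent_idn_mult)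
lemma ent_mult_last_idn: "ent (A * last_idn m) i j = (if j = m then ent A i j else 0)"
  by (auto simp: last_idn_def right_diff_distrib ent_mult_idn)

lemma last_idn_glr_mult: "A \<in> glr m \<Longrightarrow> last_idn m * A = 0" "A \<in> glr m \<Longrightarrow> A * last_idn m = 0"
  using glr_mono[of m "Suc m"] by (auto simp: last_idn_def left_diff_distrib right_diff_distrib)

lemma last_idn_unip:
  assumes "g - 1 \<in> glr m"
  shows "last_idn m * g = last_idn m" "g * last_idn m = last_idn m"
  using last_idn_glr_mult[OF assms] by (simp_all add: left_diff_distrib right_diff_distrib)

lemma glr_Suc_restrict:
  assumes "A \<in> glr (Suc m)" "last_idn m * A = 0" "A * last_idn m = 0"
  shows "A \<in> glr m"
  using assms unfolding glr_iff by (simp add: last_idn_def left_diff_distrib right_diff_distrib)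

definition lin_comb :: "infmat \<Rightarrow> nat \<Rightarrow> (nat \<Rightarrow> complex) \<Rightarrow> rcmat" where
  "lin_comb X n c = (\<Sum>k<n. sc (c k) * cpow X n k)"

lemma lin_comb_cent: "lin_comb X n c \<in> cent X n"
  unfolding lin_comb_def by (intro cent_sum cpow_cent)

lemma lin_comb_glr: "lin_comb X n c \<in> glr n"
  using lin_comb_cent cent_glr by blast

text \<open>If \<open>g = g' z\<close> with \<open>g' \<in> GU m\<close> and \<open>z \<in> ZZ X (m + 1)\<close>, then \<open>z\<close> has the same last row as \<open>g\<close> and
  maps the last column of \<open>g\<^sup>-\<^sup>1\<close> to the last unit vector. These are linear equations for the
  coordinates of \<open>z\<close> in the basis \<open>cpow X (m + 1) k\<close>; \<open>sys_mat\<close> and \<open>sys_rhs\<close> are the normal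
  equations with the adjoint taken at \<open>h\<close>, which makes them holomorphic in \<open>g\<close> and
  uniquely solvable near \<open>h\<close>.\<close>

definition sys_mat :: "infmat \<Rightarrow> nat \<Rightarrow> rcmat \<Rightarrow> rcmat \<Rightarrow> nat \<Rightarrow> nat \<Rightarrow> complex" where
  "sys_mat X m h g k l =
     (\<Sum>a<Suc m. cnj (ent (cpow X (Suc m) k) m a) * ent (cpow X (Suc m) l) m a) +
     (\<Sum>a<Suc m. cnj (ent (cpow X (Suc m) k * rinv h) a m) * ent (cpow X (Suc m) l * rinv g) a m)"

definition sys_rhs :: "infmat \<Rightarrow> nat \<Rightarrow> rcmat \<Rightarrow> rcmat \<Rightarrow> nat \<Rightarrow> complex" where
  "sys_rhs X m h g k =
     (\<Sum>a<Suc m. cnj (ent (cpow X (Suc m) k) m a) * ent g m a) +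
     (\<Sum>a<Suc m. cnj (ent (cpow X (Suc m) k * rinv h) a m) * ent (last_idn m) a m)"

definition sys_M :: "infmat \<Rightarrow> nat \<Rightarrow> rcmat \<Rightarrow> rcmat \<Rightarrow> complex mat" where
  "sys_M X m h g = mat (Suc m) (Suc m) (\<lambda>(k, l). sys_mat X m h g k l)"

definition sys_sol :: "infmat \<Rightarrow> nat \<Rightarrow> rcmat \<Rightarrow> rcmat \<Rightarrow> nat \<Rightarrow> complex" where
  "sys_sol X m h g k = (\<Sum>l<Suc m. inverse (det (sys_M X m h g)) *
     adj_mat (sys_M X m h g) $$ (k, l) * sys_rhs X m h g l)"

definition zfac :: "infmat \<Rightarrow> nat \<Rightarrow> rcmat \<Rightarrow> rcmat \<Rightarrow> rcmat" where
  "zfac X m h g = 1 - idn (Suc m) + lin_comb X (Suc m) (sys_sol X m h g)"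

lemma ent_lin_comb_mult: "ent (lin_comb X n c * A) i j = (\<Sum>k<n. c k * ent (cpow X n k * A) i j)"
  by (simp add: lin_comb_def sum_distrib_right mult.assoc)

lemma ent_lin_comb: "ent (lin_comb X n c) i j = (\<Sum>k<n. c k * ent (cpow X n k) i j)"
  by (simp add: lin_comb_def)

lemma sys_mat_apply:
  "(\<Sum>l<Suc m. sys_mat X m h g k l * c l) =
     (\<Sum>a<Suc m. cnj (ent (cpow X (Suc m) k) m a) * ent (lin_comb X (Suc m) c) m a) +
     (\<Sum>a<Suc m. cnj (ent (cpow X (Suc m) k * rinv h) a m) * ent (lin_comb X (Suc m) c * rinv g) a m)"
proof -
  let ?n = "Suc m" and ?P = "cpow X (Suc m)"
  have "(\<Sum>l<?n. (\<Sum>a<?n. u k a * v l a) * c l) = (\<Sum>a<?n. u k a * (\<Sum>l<?n. c l * v l a))"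
    for u v :: "nat \<Rightarrow> nat \<Rightarrow> complex"
    unfolding sum_distrib_left sum_distrib_right by (subst sum.swap) (intro sum.cong refl, simp)
  from this[of "\<lambda>k a. cnj (ent (?P k) m a)" "\<lambda>l a. ent (?P l) m a"]
    this[of "\<lambda>k a. cnj (ent (?P k * rinv h) a m)" "\<lambda>l a. ent (?P l * rinv g) a m"]
  show ?thesis
    unfolding sys_mat_def distrib_right sum.distrib ent_lin_comb ent_lin_comb_mult by (simp only:)
qed

text \<open>A kernel vector is an element \<open>y\<close> of \<open>\<complex>[X_(m+1)]\<close>
  whose last row vanishes and for which the last column of \<open>y h^-1\<close> vanishes. As
  \<open>y\<close> commutes with \<open>z\<close> and \<open>h'^-1\<close> fixes the last unit
  vector, the last column of \<open>y\<close> vanishes as well. So \<open>y\<close> lies in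
  \<open>gl(m)\<close> and commutes with \<open>X_(m+1)\<close>, hence is zero.\<close>

lemma sys_M_det_nonzero:
  assumes X: "sreg X" and H: "h = h' * z" "h' \<in> GU m" "z \<in> ZZ X (Suc m)"
  shows "det (sys_M X m h h) \<noteq> 0"
proof
  let ?n = "Suc m" and ?P = "cpow X (Suc m)"
  assume "det (sys_M X m h h) = 0"
  then obtain v where v: "v \<in> carrier_vec ?n" "v \<noteq> 0\<^sub>v ?n" "sys_M X m h h *\<^sub>v v = 0\<^sub>v ?n"
    using det_0_iff_vec_prod_zero_field[of "sys_M X m h h" ?n] by (auto simp: sys_M_def)
  define c where "c k = v $ k" for k
  let ?z = "lin_comb X ?n c"
  have eq: "(\<Sum>l<?n. sys_mat X m h h k l * c l) = 0" if "k < ?n" for k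
    using arg_cong[OF v(3), of "\<lambda>w :: complex Matrix.vec. w $ k"] that v(1)
    by (simp add: sys_M_def scalar_prod_def c_def lessThan_atLeast0 del: sum.lessThan_Suc sum.atLeast0_lessThan_Suc)
  let ?r = "\<lambda>a. ent ?z m a" and ?s = "\<lambda>a. ent (?z * rinv h) a m"
  \<comment> \<open>At \<open>g = h\<close> the system matrix is a Gram matrix; pairing with the
    conjugate coefficients gives a sum of squares.\<close>
  have "(\<Sum>k<?n. cnj (c k) * (\<Sum>l<?n. sys_mat X m h h k l * c l)) = 0"
    using eq by (intro sum.neutral) simp
  also have "(\<Sum>k<?n. cnj (c k) * (\<Sum>l<?n. sys_mat X m h h k l * c l))
      = (\<Sum>a<?n. cnj (?r a) * ?r a) + (\<Sum>a<?n. cnj (?s a) * ?s a)"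
  proof -
    have "(\<Sum>k<?n. cnj (c k) * (\<Sum>a<?n. cnj (u k a) * w a)) = (\<Sum>a<?n. cnj (\<Sum>k<?n. c k * u k a) * w a)"
      for u :: "nat \<Rightarrow> nat \<Rightarrow> complex" and w
      unfolding sum_distrib_left sum_distrib_right cnj_sum by (subst sum.swap) (intro sum.cong refl, simp)
    from this[of "\<lambda>k a. ent (?P k) m a" ?r] this[of "\<lambda>k a. ent (?P k * rinv h) a m" ?s]
    show ?thesis
      unfolding sys_mat_apply distrib_left sum.distrib
      by (simp only: ent_lin_comb[symmetric] ent_lin_comb_mult[symmetric])
  qed
  also have "\<dots> = of_real ((\<Sum>a<?n. (cmod (?r a))\<^sup>2) + (\<Sum>a<?n. (cmod (?s a))\<^sup>2))"
    unfolding of_real_add of_real_sum complex_norm_square by (simp only: mult.commute)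
  finally have z: "(\<Sum>a<?n. (cmod (?r a))\<^sup>2) + (\<Sum>a<?n. (cmod (?s a))\<^sup>2) = 0"
    by (simp only: of_real_eq_0_iff)
  have nn: "0 \<le> (\<Sum>a<?n. (cmod (?r a))\<^sup>2)" "0 \<le> (\<Sum>a<?n. (cmod (?s a))\<^sup>2)" by (simp_all only: sum_nonneg zero_le_power2)
  then have "(\<Sum>a<?n. (cmod (?r a))\<^sup>2) = 0" "(\<Sum>a<?n. (cmod (?s a))\<^sup>2) = 0"
    using z by linarith+
  then have r0: "?r a = 0" and s0: "?s a = 0" if "a < ?n" for a
    using that by (subst (asm) (1 2) sum_nonneg_eq_0_iff; force)+
  have zg: "?z \<in> glr ?n" by (rule lin_comb_glr)
  have zc: "?z * pad ?n X = pad ?n X * ?z" using lin_comb_cent by (auto simp: cent_def)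
  have hG: "h \<in> GU ?n" using H GU_mult[OF GU_le[OF H(2)] ZZ_GU[OF H(3)]] by simp
  have "last_idn m * ?z = 0"
  proof (rule rcmat_eqI)
    fix i j
    have "?r j = 0" using r0[of j] glr_ent[OF zg, of m j] by (cases "j < ?n") auto
    then show "ent (last_idn m * ?z) i j = ent 0 i j" by (simp add: ent_last_idn_mult)
  qed
  moreover have "?z * last_idn m = 0"
  proof -
    have "?z * rinv h \<in> glr ?n" by (intro unip_glr zg GU_minus_one GU_rinv(3) hG)
    then have "?s i = 0" for i
      using s0[of i] glr_ent[of "?z * rinv h" ?n i m] by (cases "i < ?n") auto
    then have "?z * rinv h * last_idn m = 0"
      by (intro rcmat_eqI) (simp add: ent_mult_last_idn)
    then have "z * (?z * rinv h * last_idn m) = 0" by simp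
    moreover have "z * ?z = ?z * z"
    proof -
      obtain p where p: "?z = pev ?n (pad ?n X) p" using centralizer_pev[OF sreg_nd[OF X] zg zc] by blast
      have zG: "z \<in> GU ?n" by (rule ZZ_GU[OF H(3)])
      have c: "idn ?n * z * ?z = ?z * (idn ?n * z)"
        unfolding p by (rule pev_commute[OF pad_glr idn_GU_glr[OF zG] ZZ_idn_commute[OF H(3)]])
      have "z * ?z = z * idn ?n * ?z" using zg by (simp add: mult.assoc)
      also have "\<dots> = ?z * (idn ?n * z)" by (simp only: c[symmetric] unip_idn[OF GU_minus_one[OF zG], symmetric])
      also have "\<dots> = ?z * z" using zg by (simp add: mult.assoc[symmetric])
      finally show ?thesis .
    qed
    moreover have "z * rinv h = rinv h'"
      using H rinv_mult[OF GU_le[OF H(2), of ?n] ZZ_GU[OF H(3)]] by (simp add: GU_cancel[OF ZZ_GU[OF H(3)]])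
    ultimately have "?z * (rinv h' * last_idn m) = 0"
      by (metis mult.assoc)
    then show ?thesis using last_idn_unip(2)[OF GU_minus_one[OF GU_rinv(3)[OF H(2)]]] by simp
  qed
  ultimately have "?z \<in> glr m" by (rule glr_Suc_restrict[OF zg])
  then have "?z = 0" using X lin_comb_cent[of X ?n c] unfolding sreg_def by blast
  then have "\<forall>k<?n. c k = 0"
    using sreg_nd[OF X, of ?n] unfolding nonderogatory_def lin_comb_def cpow_def by blast
  then have "v = 0\<^sub>v ?n" using v(1) by (intro eq_vecI) (auto simp: c_def)
  with v(2) show False ..
qed

lemma sys_sol_unique:
  assumes "det (sys_M X m h g) \<noteq> 0" "k < Suc m"
    "\<And>k. k < Suc m \<Longrightarrow> (\<Sum>l<Suc m. sys_mat X m h g k l * c l) = sys_rhs X m h g k"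
  shows "sys_sol X m h g k = c k"
proof -
  let ?n = "Suc m" and ?M = "sys_M X m h g"
  have M: "?M \<in> carrier_mat ?n ?n" by (simp add: sys_M_def)
  note adj = adj_mat[OF M]
  have e: "(\<Sum>l<?n. adj_mat ?M $$ (k, l) * ?M $$ (l, j)) = (if k = j then det ?M else 0)"
    if "j < ?n" for j
  proof -
    have "(adj_mat ?M * ?M) $$ (k, j) = (\<Sum>l<?n. adj_mat ?M $$ (k, l) * ?M $$ (l, j))"
      using adj(1) M assms(2) that by (auto simp: scalar_prod_def lessThan_atLeast0 intro!: sum.cong)
    moreover have "(adj_mat ?M * ?M) $$ (k, j) = (det ?M \<cdot>\<^sub>m 1\<^sub>m ?n) $$ (k, j)"
      by (simp only: adj(3))
    ultimately show ?thesis using assms(2) that by (cases "k = j") (simp_all del: sum.lessThan_Suc)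
  qed
  have "sys_sol X m h g k = (\<Sum>l<?n. inverse (det ?M) * adj_mat ?M $$ (k, l) *
      (\<Sum>j<?n. ?M $$ (l, j) * c j))"
    unfolding sys_sol_def using assms(3)
    by (intro sum.cong refl arg_cong2[where f = "(*)"]) (simp add: sys_M_def del: sum.lessThan_Suc)
  also have "\<dots> = (\<Sum>j<?n. inverse (det ?M) * (\<Sum>l<?n. adj_mat ?M $$ (k, l) * ?M $$ (l, j)) * c j)"
    unfolding sum_distrib_left sum_distrib_right by (subst sum.swap) (intro sum.cong refl, simp only: mult_ac)
  also have "\<dots> = (\<Sum>j<?n. if k = j then c j else 0)"
    using assms(1) by (intro sum.cong refl) (simp add: e del: sum.lessThan_Suc)
  also have "\<dots> = c k" using assms(2) by simp
  finally show ?thesis .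
qed

lemma zfac_unip: "zfac X m h g - 1 \<in> glr (Suc m)"
  unfolding zfac_def by (auto intro: glr_diff lin_comb_glr)

text \<open>The coordinates of any admissible last factor solve the system, so wherever the system
  is nonsingular the factorization is unique and found by Cramer's rule.\<close>

lemma zfac_eq:
  assumes X: "sreg X" and g: "g = g' * z" "g' \<in> GU m" "z \<in> ZZ X (Suc m)"
    and det: "det (sys_M X m h g) \<noteq> 0"
  shows "zfac X m h g = z"
proof -
  let ?n = "Suc m"
  have zG: "z \<in> GU ?n" by (rule ZZ_GU[OF g(3)])
  have g'G: "g' \<in> GU ?n" using GU_le[OF g(2)] by simp
  obtain c where c: "idn ?n * z = lin_comb X ?n c"
    using nonderogatory_centralizer[OF sreg_nd[OF X] idn_GU_glr[OF zG] ZZ_idn_commute[OF g(3)]]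
    unfolding lin_comb_def cpow_def by blast
  have "(\<Sum>l<?n. sys_mat X m h g k l * c l) = sys_rhs X m h g k" for k
  proof -
    have "last_idn m * g = last_idn m * z"
      unfolding g(1) using last_idn_unip(1)[OF GU_minus_one[OF g(2)]] by (simp add: mult.assoc[symmetric])
    then have "ent (last_idn m * g) m a = ent (last_idn m * z) m a" for a by (simp only:)
    then have 1: "ent (lin_comb X ?n c) m a = ent g m a" for a
      unfolding c[symmetric] by (simp add: ent_last_idn_mult ent_idn_mult)
    have "z * rinv g = rinv g'"
      unfolding g(1) using rinv_mult[OF g'G zG] by (simp add: GU_cancel[OF zG])
    then have "idn ?n * z * rinv g * last_idn m = idn ?n * last_idn m"
      using last_idn_unip(2)[OF GU_minus_one[OF GU_rinv(3)[OF g(2)]]] by (simp add: mult.assoc)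
    then have "ent (lin_comb X ?n c * rinv g * last_idn m) a m = ent (idn ?n * last_idn m) a m" for a
      by (simp only: c)
    then have 2: "ent (lin_comb X ?n c * rinv g) a m = ent (last_idn m) a m" if "a < ?n" for a
      using that by (simp add: ent_mult_last_idn ent_idn ent_last_idn)
    show ?thesis
      unfolding sys_mat_apply sys_rhs_def using 1 2
      by (intro arg_cong2[where f = "(+)"] sum.cong refl) auto
  qed
  then have "sys_sol X m h g k = c k" if "k < ?n" for k
    using sys_sol_unique[OF det that] by blast
  then have "lin_comb X ?n (sys_sol X m h g) = idn ?n * z"
    unfolding c lin_comb_def by (intro sum.cong) auto
  then show ?thesis
    using GU_split[OF GU_minus_one[OF zG]] by (simp add: zfac_def)
qed

lemma rat_cpow_rinv:
  assumes "h \<in> GU n"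
  shows "rat n h (\<lambda>g. ent (cpow X n l * rinv g) a b)"
  using rmat_mult[OF rmat_const rmat_rinv[OF assms] glr_banded[OF cpow_glr]]
  by (simp add: rmat_def)

lemma rmat_zfac:
  assumes H: "h \<in> GU (Suc m)" and det: "det (sys_M X m h h) \<noteq> 0"
  shows "rmat (Suc m) h (zfac X m h)"
proof -
  let ?n = "Suc m"
  have M: "rat ?n h (\<lambda>g. sys_mat X m h g k l)" for k l
    unfolding sys_mat_def by (intro rat_add rat_sum rat_mult rat_const rat_cpow_rinv H)
  have b: "rat ?n h (\<lambda>g. sys_rhs X m h g k)" for k
    unfolding sys_rhs_def by (intro rat_add rat_sum rat_mult rat_const rat_ent)
  have "rat ?n h (\<lambda>g. sys_sol X m h g k)" if "k < ?n" for k
    unfolding sys_sol_def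
  proof (intro rat_sum rat_mult b)
    show "rat ?n h (\<lambda>g. inverse (det (sys_M X m h g)))"
      by (rule rat_inverse[where F = "\<lambda>g. det (sys_M X m h g)", OF _ H det]) (unfold sys_M_def, intro rat_det M)
    fix l assume "l \<in> {..<?n}"
    then show "rat ?n h (\<lambda>g. adj_mat (sys_M X m h g) $$ (k, l))"
      unfolding sys_M_def by (intro rat_adj M that) auto
  qed
  then show ?thesis
    unfolding rmat_def zfac_def ent_add ent_lin_comb
    by (intro allI rat_add rat_const rat_sum rat_mult) auto
qed

text \<open>The values of \<open>zfac\<close> commute with \<open>X_(m+1)\<close> for every
  \<open>g\<close>, so near \<open>h\<close> membership of \<open>g\<close> is equivalent to
  membership of \<open>M g = g zfac(g)^-1\<close> in \<open>L_m\<close>. The latter is the induction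
  hypothesis composed with a rational map, restricted by the equations for \<open>M g\<close> to lie
  in \<open>GL(m)\<close>.\<close>

theorem LS_lclosed:
  assumes X: "sreg X" and h: "h \<in> LS X n"
  shows "lclosed n h (\<lambda>g. g \<in> LS X n)"
  using h
proof (induction n arbitrary: h)
  case 0
  have "g = 1" if "g \<in> GU 0" for g
  proof -
    have "g - 1 = 0" using GU_minus_one[OF that] by (intro glr_ent_eqI[of _ 0]) (auto simp: glr_zero)
    then show ?thesis by simp
  qed
  then show ?case
    using lclosed_cong[OF lclosed_True, of "\<lambda>_. 1" 0 h "\<lambda>g. g \<in> LS X 0"] by (auto intro: poly_funs.const)
next
  case (Suc m)
  let ?n = "Suc m"
  obtain h' z where hz: "h = h' * z" "h' \<in> LS X m" "z \<in> ZZ X ?n" using Suc.prems by auto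
  have h': "h' \<in> GU m" by (rule LS_GU[OF hz(2)])
  have H: "h \<in> GU ?n" by (rule LS_GU[OF Suc.prems])
  have zG: "z \<in> GU ?n" using hz(3) by (rule ZZ_GU)
  have det: "det (sys_M X m h h) \<noteq> 0" by (rule sys_M_det_nonzero[OF X hz(1) h' hz(3)])
  let ?Z = "zfac X m h"
  have Zh: "?Z h = z" by (rule zfac_eq[OF X hz(1) h' hz(3) det])
  have rZ: "rmat ?n h ?Z" by (rule rmat_zfac[OF H det])
  define M where "M g = g * adj_inv ?n (?Z g)" for g
  have rM: "rmat ?n h M"
    unfolding M_def
    by (rule rmat_mult[OF rmat_id rmat_adj_inv[OF rZ H], where k = ?n]) (simp_all add: Zh zG unip_banded GU_minus_one)
  have Mh: "M h = h'"
  proof -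
    have "M h = h * adj_inv ?n z" by (simp only: M_def Zh)
    also have "\<dots> = h' * (z * rinv z)"
      by (simp only: hz(1) mult.assoc rinv_eq_adj_inv[OF zG])
    finally show ?thesis by (simp add: GU_rinv(1)[OF zG])
  qed
  have rZe: "rat ?n h (\<lambda>g. det (corner ?n (ent (?Z g))))"
    unfolding corner_mat using rZ by (intro rat_det) (simp add: rmat_def)
  \<comment> \<open>Two shrinkings of the neighbourhood: where \<open>w1\<close> is nonzero the
    matrix \<open>zfac\<close> is invertible, and where \<open>w2\<close> is nonzero the linear
    system has a unique solution.\<close>
  obtain w1 where w1: "w1 \<in> poly_funs ?n" "w1 (ent h) \<noteq> 0"
    "\<And>g. g \<in> GU ?n \<Longrightarrow> w1 (ent g) \<noteq> 0 \<Longrightarrow> det (corner ?n (ent (?Z g))) \<noteq> 0"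
    using rat_nonzero[OF rZe H] GU_det[OF zG] Zh by auto
  have rD: "rat ?n h (\<lambda>g. det (sys_M X m h g))"
    unfolding sys_M_def sys_mat_def by (intro rat_det rat_add rat_sum rat_mult rat_const rat_cpow_rinv H)
  obtain w2 where w2: "w2 \<in> poly_funs ?n" "w2 (ent h) \<noteq> 0"
    "\<And>g. g \<in> GU ?n \<Longrightarrow> w2 (ent g) \<noteq> 0 \<Longrightarrow> det (sys_M X m h g) \<noteq> 0"
    using rat_nonzero[OF rD H det] by auto
  have ZG: "?Z g \<in> GU ?n" "adj_inv ?n (?Z g) = rinv (?Z g)" if "g \<in> GU ?n" "w1 (ent g) \<noteq> 0" for g
    using adj_inv_inverse[OF zfac_unip w1(3)[OF that]] by simp_all
  have MG: "M g \<in> GU ?n" if "g \<in> GU ?n" "w1 (ent g) \<noteq> 0" for g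
    unfolding M_def ZG(2)[OF that] by (intro GU_mult that(1) GU_rinv(3) ZG[OF that])
  have dom: "lclosed ?n h (\<lambda>g. M g \<in> GU m)"
  proof (rule lclosed_cong[OF _ w1(1,2)])
    have "rat ?n h (\<lambda>g. ent (M g) i j - c)" for i j c
      using rat_add[OF _ rat_const, of ?n h "\<lambda>g. ent (M g) i j" "- c"] rM by (simp add: rmat_def)
    then show "lclosed ?n h (\<lambda>g. \<forall>a\<in>{..<?n}. ent (M g) m a - (if m = a then 1 else 0) = 0 \<and>
        ent (M g) a m - (if a = m then 1 else 0) = 0)"
      by (intro lclosed_ball lclosed_conj lclosed_rat) auto
    fix g assume g: "g \<in> GU ?n" "w1 (ent g) \<noteq> 0"
    show "M g \<in> GU m \<longleftrightarrow> (\<forall>a\<in>{..<?n}. ent (M g) m a - (if m = a then 1 else 0) = 0 \<and>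
        ent (M g) a m - (if a = m then 1 else 0) = 0)" (is "_ \<longleftrightarrow> ?R")
    proof
      assume "M g \<in> GU m"
      then show ?R using unip_ent[OF GU_minus_one, of "M g" m] by auto
    next
      assume R: ?R
      have "M g - 1 \<in> glr m" unfolding glr_def
      proof (intro CollectI allI impI)
        fix i j assume ij: "m \<le> i \<or> m \<le> j"
        show "ent (M g - 1) i j = 0"
        proof (cases "?n \<le> i \<or> ?n \<le> j")
          case True
          then show ?thesis using unip_ent[OF GU_minus_one[OF MG[OF g]]] by (simp add: ent_one)
        next
          case False
          then show ?thesis using R ij by (auto simp: ent_one le_less_Suc_eq not_le)
        qed
      qed
      then show "M g \<in> GU m" by (rule unip_inverse[OF MG[OF g]])
    qed
  qed
  have IH: "lclosed m (M h) (\<lambda>g. g \<in> LS X m)" unfolding Mh by (rule Suc.IH[OF hz(2)])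
  show ?case
  proof (rule lclosed_cong[OF lclosed_compose[OF rM H IH dom], of "\<lambda>g. w1 g * w2 g"])
    show "(\<lambda>g. w1 g * w2 g) \<in> poly_funs ?n" by (intro poly_funs.mult w1 w2)
    show "w1 (ent h) * w2 (ent h) \<noteq> 0" using w1 w2 by simp
    fix g assume g: "g \<in> GU ?n" and w: "w1 (ent g) * w2 (ent g) \<noteq> 0"
    then have w1g: "w1 (ent g) \<noteq> 0" and w2g: "w2 (ent g) \<noteq> 0" by auto
    show "g \<in> LS X ?n \<longleftrightarrow> M g \<in> GU m \<and> M g \<in> LS X m"
    proof
      assume "g \<in> LS X ?n"
      then obtain g' y where y: "g = g' * y" "g' \<in> LS X m" "y \<in> ZZ X ?n" by auto
      have "?Z g = y" by (rule zfac_eq[OF X y(1) LS_GU[OF y(2)] y(3) w2(3)[OF g w2g]])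
      then have "M g = g'"
        unfolding M_def ZG(2)[OF g w1g] using y(1) GU_rinv(1)[OF ZZ_GU[OF y(3)]] by (simp add: mult.assoc)
      then show "M g \<in> GU m \<and> M g \<in> LS X m" using y(2) LS_GU by auto
    next
      assume "M g \<in> GU m \<and> M g \<in> LS X m"
      moreover have "g = M g * ?Z g"
        unfolding M_def ZG(2)[OF g w1g] using GU_rinv(2)[OF ZG(1)[OF g w1g]] by (simp add: mult.assoc)
      moreover have "?Z g \<in> ZZ X ?n"
      proof -
        have "lin_comb X ?n (sys_sol X m h g) * pad ?n X = pad ?n X * lin_comb X ?n (sys_sol X m h g)"
          using lin_comb_cent by (auto simp: cent_def)
        then have "?Z g * pad ?n X = pad ?n X * ?Z g"
          by (simp add: zfac_def left_diff_distrib right_diff_distrib distrib_left distrib_right)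
        then show ?thesis using ZG(1)[OF g w1g] by (simp add: ZZ_def)
      qed
      ultimately show "g \<in> LS X ?n" by auto
    qed
  qed
qed

section \<open>The orbit as an ind-variety\<close>

lemma openin_zariski_GL:
  "openin (zariski_GL n) U \<longleftrightarrow> (\<exists>S\<subseteq>poly_funs n. U = {g \<in> GL n. \<exists>p\<in>S. p g \<noteq> 0})"
  unfolding zariski_GL_def by (subst topology_inverse'[OF istopology_zariski_GL]) simp

lemma openin_GL: "openin (zariski_GL n) (GL n)"
  unfolding openin_zariski_GL
  by (intro exI[of _ "{\<lambda>_. 1}"]) (auto intro: poly_funs.const)

lemma topspace_zariski_GL: "topspace (zariski_GL n) = GL n"
  using openin_subset[OF openin_GL, of n] openin_topspace[of "zariski_GL n"]
  unfolding openin_zariski_GL by blast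

lemma openin_final_topology:
  "openin (final_topology S I T f) U \<longleftrightarrow> U \<subseteq> S \<and> (\<forall>i\<in>I. openin (T i) {x \<in> topspace (T i). f i x \<in> U})"
  unfolding final_topology_def by (subst topology_inverse'[OF istopology_final_topology]) simp

lemma G_orbit_eq: "G_orbit n X = (\<lambda>g. AD g X) ` GU n"
  unfolding G_orbit_def GL_eq_GU image_image by (intro image_cong refl) (simp add: Ad_ent)

lemma openin_zariski_orbit:
  "openin (zariski_orbit n X) U \<longleftrightarrow> U \<subseteq> G_orbit n X \<and>
     (\<exists>S\<subseteq>poly_funs n. \<forall>g\<in>GU n. AD g X \<in> U \<longleftrightarrow> (\<exists>p\<in>S. p (ent g) \<noteq> 0))"
proof -
  have eq: "{g \<in> GL n. Ad g X \<in> U} = {g \<in> GL n. \<exists>p\<in>S. p g \<noteq> 0} \<longleftrightarrow>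
      (\<forall>g\<in>GU n. AD g X \<in> U \<longleftrightarrow> (\<exists>p\<in>S. p (ent g) \<noteq> 0))" for S
  proof -
    have "{g \<in> GL n. Ad g X \<in> U} = {g \<in> GL n. \<exists>p\<in>S. p g \<noteq> 0} \<longleftrightarrow>
        (\<forall>g\<in>GL n. Ad g X \<in> U \<longleftrightarrow> (\<exists>p\<in>S. p g \<noteq> 0))" by blast
    also have "\<dots> \<longleftrightarrow> (\<forall>g\<in>GU n. AD g X \<in> U \<longleftrightarrow> (\<exists>p\<in>S. p (ent g) \<noteq> 0))"
      unfolding GL_eq_GU by (simp add: Ad_ent)
    finally show ?thesis .
  qed
  show ?thesis
    unfolding zariski_orbit_def openin_final_topology topspace_zariski_GL openin_zariski_GL eq
    by simp
qed

lemma topspace_zariski_orbit: "topspace (zariski_orbit n X) = G_orbit n X"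
proof
  have "openin (zariski_orbit n X) (G_orbit n X)"
    unfolding openin_zariski_orbit G_orbit_eq
    by (intro conjI subset_refl exI[of _ "{\<lambda>_. 1}"]) (auto intro: poly_funs.const)
  then show "G_orbit n X \<subseteq> topspace (zariski_orbit n X)" by (rule openin_subset)
  show "topspace (zariski_orbit n X) \<subseteq> G_orbit n X"
    using openin_topspace[of "zariski_orbit n X"] unfolding openin_zariski_orbit by blast
qed

lemma A_orbit_LS: "sreg X \<Longrightarrow> A_orbit X = (\<Union>n. (\<lambda>g. AD g X) ` LS X n)"
  by (rule A_orbit_eq) (rule sreg_nd)

lemma A_orbit_Int_G_orbit:
  assumes "sreg X"
  shows "A_orbit X \<inter> G_orbit n X = (\<lambda>g. AD g X) ` LS X n"
proof
  show "A_orbit X \<inter> G_orbit n X \<subseteq> (\<lambda>g. AD g X) ` LS X n"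
  proof
    fix Y assume "Y \<in> A_orbit X \<inter> G_orbit n X"
    then obtain m g h where gh: "g \<in> LS X m" "Y = AD g X" "h \<in> GU n" "Y = AD h X"
      unfolding A_orbit_LS[OF assms] G_orbit_eq by auto
    have "g \<in> GU (max m n)" "h \<in> GU (max m n)"
      using GU_le[OF LS_GU[OF gh(1)], of "max m n"] GU_le[OF gh(3), of "max m n"] by simp_all
    then have "g = h" using gh by (intro AD_inj[OF assms]) auto
    then have "g \<in> LS X n" using LS_restrict[OF assms gh(1)] gh(3) by simp
    then show "Y \<in> (\<lambda>g. AD g X) ` LS X n" using gh(2) by auto
  qed
  show "(\<lambda>g. AD g X) ` LS X n \<subseteq> A_orbit X \<inter> G_orbit n X"
    unfolding A_orbit_LS[OF assms] G_orbit_eq using LS_GU by auto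
qed

lemma AD_image_iff:
  assumes "sreg X" "A \<subseteq> GU n" "g \<in> GU n"
  shows "AD g X \<in> (\<lambda>g. AD g X) ` A \<longleftrightarrow> g \<in> A"
  using AD_inj[OF assms(1,3)] assms(2) by auto

text \<open>\<open>U\<close> is the union of all basic open sets in which \<open>L_n\<close> is
  closed, and \<open>C\<close> is the Zariski closure of \<open>L_n\<close> in \<open>GL(n)\<close>.
  Injectivity of \<open>g \<mapsto> AD g X\<close> carries both over to the orbit.\<close>

theorem ind_subvariety_A_orbit:
  assumes X: "sreg X"
  shows "ind_subvariety X (A_orbit X)"
  unfolding ind_subvariety_def
proof (intro conjI allI)
  show "A_orbit X \<subseteq> GL_inf_orbit X"
    unfolding A_orbit_LS[OF X] GL_inf_orbit_def G_orbit_eq using LS_GU by blast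
  fix n
  let ?AD = "\<lambda>g. AD g X"
  define S where "S = {w \<in> poly_funs n. \<exists>T\<subseteq>poly_funs n. \<forall>g\<in>GU n. w (ent g) \<noteq> 0 \<longrightarrow>
      (g \<in> LS X n \<longleftrightarrow> (\<forall>q\<in>T. q (ent g) = 0))}"
  define I where "I = {q \<in> poly_funs n. \<forall>k\<in>LS X n. q (ent k) = 0}"
  define U where "U = {g \<in> GU n. \<exists>w\<in>S. w (ent g) \<noteq> 0}"
  define C where "C = {g \<in> GU n. \<forall>q\<in>I. q (ent g) = 0}"
  have UC: "U \<subseteq> GU n" "C \<subseteq> GU n" by (auto simp: U_def C_def)
  have "openin (zariski_orbit n X) (?AD ` U)"
    unfolding openin_zariski_orbit
  proof (intro conjI exI[of _ S])
    show "?AD ` U \<subseteq> G_orbit n X" unfolding G_orbit_eq using UC by blast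
    show "S \<subseteq> poly_funs n" by (auto simp: S_def)
    show "\<forall>g\<in>GU n. AD g X \<in> ?AD ` U \<longleftrightarrow> (\<exists>p\<in>S. p (ent g) \<noteq> 0)"
      using AD_image_iff[OF X UC(1)] by (auto simp: U_def)
  qed
  moreover have "closedin (zariski_orbit n X) (?AD ` C)"
    unfolding closedin_def topspace_zariski_orbit openin_zariski_orbit
  proof (intro conjI exI[of _ I])
    show "?AD ` C \<subseteq> G_orbit n X" unfolding G_orbit_eq using UC by blast
    show "I \<subseteq> poly_funs n" by (auto simp: I_def)
    have "AD g X \<in> G_orbit n X - ?AD ` C \<longleftrightarrow> (\<exists>p\<in>I. p (ent g) \<noteq> 0)" if "g \<in> GU n" for g
      using AD_image_iff[OF X UC(2) that] that unfolding G_orbit_eq by (auto simp: C_def)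
    then show "\<forall>g\<in>GU n. AD g X \<in> G_orbit n X - ?AD ` C \<longleftrightarrow> (\<exists>p\<in>I. p (ent g) \<noteq> 0)" by blast
  qed blast
  moreover have "LS X n = U \<inter> C"
  proof (intro equalityI subsetI)
    fix g assume g: "g \<in> LS X n"
    then obtain w T where "w \<in> poly_funs n" "T \<subseteq> poly_funs n" "w (ent g) \<noteq> 0"
      "\<forall>G\<in>GU n. w (ent G) \<noteq> 0 \<longrightarrow> (G \<in> LS X n \<longleftrightarrow> (\<forall>q\<in>T. q (ent G) = 0))"
      using LS_lclosed[OF X g] unfolding lclosed_def lclosed_rep_def by blast
    then have "w \<in> S" "w (ent g) \<noteq> 0" unfolding S_def by blast+
    then show "g \<in> U \<inter> C" using g LS_GU[OF g] by (auto simp: U_def C_def I_def)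
  next
    fix g assume "g \<in> U \<inter> C"
    then obtain w where w: "w \<in> S" "w (ent g) \<noteq> 0" and gG: "g \<in> GU n" and gC: "g \<in> C"
      by (auto simp: U_def)
    obtain T where T: "T \<subseteq> poly_funs n"
      "\<And>g. g \<in> GU n \<Longrightarrow> w (ent g) \<noteq> 0 \<Longrightarrow> g \<in> LS X n \<longleftrightarrow> (\<forall>q\<in>T. q (ent g) = 0)"
      using w(1) unfolding S_def by blast
    have "q (ent g) = 0" if q: "q \<in> T" for q
    proof -
      \<comment> \<open>The equation \<open>q\<close> holds on \<open>L_n\<close> only where
        \<open>w\<close> is nonzero; the product with \<open>w\<close> vanishes on all of
        \<open>L_n\<close> and so on its closure.\<close>
      have "q (ent k) * w (ent k) = 0" if "k \<in> LS X n" for k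
        using T(2)[OF LS_GU[OF that]] that q by auto
      moreover have "(\<lambda>g. q g * w g) \<in> poly_funs n"
        using q T(1) w(1) by (intro poly_funs.mult) (auto simp: S_def)
      ultimately have "(\<lambda>g. q g * w g) \<in> I" by (simp add: I_def)
      then show ?thesis using gC w(2) unfolding C_def by auto
    qed
    then show "g \<in> LS X n" using T(2)[OF gG w(2)] by blast
  qed
  then have "A_orbit X \<inter> G_orbit n X = ?AD ` U \<inter> ?AD ` C"
    unfolding A_orbit_Int_G_orbit[OF X] using AD_inj[OF X] UC by blast
  ultimately show "locally_closed_in (zariski_orbit n X) (A_orbit X \<inter> G_orbit n X)"
    unfolding locally_closed_in_def by blast
qed

section \<open>Irreducibility\<close>

definition ispoly :: "(complex \<Rightarrow> complex) \<Rightarrow> bool" where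
  "ispoly f \<longleftrightarrow> (\<exists>P. \<forall>s. f s = poly P s)"

lemma ispoly_const: "ispoly (\<lambda>_. c)" unfolding ispoly_def by (intro exI[of _ "[:c:]"]) simp
lemma ispoly_id: "ispoly (\<lambda>s. s)" unfolding ispoly_def by (intro exI[of _ "[:0, 1:]"]) simp
lemma ispoly_add: "ispoly f \<Longrightarrow> ispoly g \<Longrightarrow> ispoly (\<lambda>s. f s + g s)"
  unfolding ispoly_def by (metis poly_add)
lemma ispoly_mult: "ispoly f \<Longrightarrow> ispoly g \<Longrightarrow> ispoly (\<lambda>s. f s * g s)"
  unfolding ispoly_def by (metis poly_mult)
lemma ispoly_sum: "(\<And>x. x \<in> A \<Longrightarrow> ispoly (f x)) \<Longrightarrow> ispoly (\<lambda>s. \<Sum>x\<in>A. f x s)"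
  by (induction A rule: infinite_finite_induct) (auto intro: ispoly_const ispoly_add)
lemma ispoly_prod: "(\<And>x. x \<in> A \<Longrightarrow> ispoly (f x)) \<Longrightarrow> ispoly (\<lambda>s. \<Prod>x\<in>A. f x s)"
  by (induction A rule: infinite_finite_induct) (auto intro: ispoly_const ispoly_mult)

lemma ispoly_poly_fun:
  assumes "p \<in> poly_funs n" "\<And>i j. ispoly (\<lambda>s. ent (K s) i j)"
  shows "ispoly (\<lambda>s. p (ent (K s)))"
  using assms(1) by induction (auto intro: ispoly_const ispoly_add ispoly_mult assms(2))

lemma ispoly_finite_zeros:
  assumes "ispoly f" "f a \<noteq> 0"
  shows "finite {s. f s = 0}"
proof -
  obtain P where P: "\<And>s. f s = poly P s" using assms(1) unfolding ispoly_def by blast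
  then have "P \<noteq> 0" using assms(2) by auto
  then show ?thesis using poly_roots_finite P by simp
qed

text \<open>In each factor the segment \<open>(1 - s) y + s z\<close> stays in the algebra commuting
  with the corner, and it is invertible for all but finitely many \<open>s\<close> because its
  determinant is a polynomial in \<open>s\<close> that is nonzero at 0. \<open>K\<close> is the
  product of these segments.\<close>

lemma LS_curve:
  assumes "g \<in> LS X n" "h \<in> LS X n"
  obtains K where "K 0 = g" "K 1 = h" "\<And>i j. ispoly (\<lambda>s. ent (K s) i j)" "finite {s. K s \<notin> LS X n}"
    "\<And>s. K s - 1 \<in> glr n"
proof -
  have "\<exists>K. K 0 = g \<and> K 1 = h \<and> (\<forall>i j. ispoly (\<lambda>s. ent (K s) i j)) \<and> finite {s. K s \<notin> LS X n} \<and>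
      (\<forall>s. K s - 1 \<in> glr n)"
    using assms
  proof (induction n arbitrary: g h)
    case 0
    then show ?case by (intro exI[of _ "\<lambda>_. 1"]) (auto simp: ispoly_const glr_zero)
  next
    case (Suc n)
    let ?n = "Suc n"
    obtain g' y where y: "g = g' * y" "g' \<in> LS X n" "y \<in> ZZ X ?n" using Suc.prems(1) by auto
    obtain h' z where z: "h = h' * z" "h' \<in> LS X n" "z \<in> ZZ X ?n" using Suc.prems(2) by auto
    obtain K where K: "K 0 = g'" "K 1 = h'" "\<And>i j. ispoly (\<lambda>s. ent (K s) i j)"
      "finite {s. K s \<notin> LS X n}" "\<And>s. K s - 1 \<in> glr n"
      using Suc.IH[OF y(2) z(2)] by blast
    define Z where "Z s = sc (1 - s) * y + sc s * z" for s
    have Zu: "Z s - 1 \<in> glr ?n" for s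
    proof -
      have "Z s - 1 = sc (1 - s) * (y - 1) + sc s * (z - 1)"
        by (simp add: Z_def sc_diff algebra_simps)
      also have "\<dots> \<in> glr ?n" by (intro glr_add glr_sc GU_minus_one ZZ_GU[OF y(3)] ZZ_GU[OF z(3)])
      finally show ?thesis .
    qed
    have Zp: "ispoly (\<lambda>s. ent (Z s) i j)" for i j
    proof -
      have "ispoly (\<lambda>s. (1 + (- 1) * s) * ent y i j + s * ent z i j)"
        by (intro ispoly_add ispoly_mult ispoly_const ispoly_id)
      then show ?thesis by (simp add: Z_def)
    qed
    have Zc: "Z s * pad ?n X = pad ?n X * Z s" for s
      using y(3) z(3) by (simp add: Z_def ZZ_def distrib_left distrib_right mult.assoc sc_left_commute[of "pad _ _"])
    define d where "d s = det (corner ?n (ent (Z s)))" for s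
    have "ispoly d"
    proof -
      have "d = (\<lambda>s. \<Sum>p\<in>{p. p permutes {0..<?n}}. signof p * (\<Prod>i\<in>{0..<?n}. ent (Z s) i (p i)))"
        unfolding d_def det_def'[OF corner_carrier]
        by (intro ext sum.cong refl arg_cong2[where f = "(*)"] prod.cong) (auto dest: permutes_in_image)
      moreover have "ispoly (\<lambda>s. \<Sum>p\<in>{p. p permutes {0..<?n}}. signof p * (\<Prod>i\<in>{0..<?n}. ent (Z s) i (p i)))"
        by (intro ispoly_sum ispoly_mult ispoly_const ispoly_prod Zp)
      ultimately show ?thesis by (simp only:)
    qed
    moreover have "d 0 \<noteq> 0" unfolding d_def using GU_det[OF ZZ_GU[OF y(3)]] by (simp add: Z_def)
    ultimately have fin: "finite {s. d s = 0}" by (rule ispoly_finite_zeros)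
    have ZZ: "Z s \<in> ZZ X ?n" if "d s \<noteq> 0" for s
      using adj_inv_inverse(1)[OF Zu] that Zc unfolding ZZ_def d_def by blast
    have "{s. K s * Z s \<notin> LS X ?n} \<subseteq> {s. K s \<notin> LS X n} \<union> {s. d s = 0}"
      using ZZ by auto
    then have "finite {s. K s * Z s \<notin> LS X ?n}" using fin K(4) by (meson finite_UnI finite_subset)
    moreover have Kn: "K s - 1 \<in> glr ?n" for s using K(5)[of s] glr_mono[of n ?n] by auto
    moreover have "ispoly (\<lambda>s. ent (K s * Z s) i j)" for i j
      unfolding banded_mult_ent[OF unip_banded[OF Kn]]
      by (intro ispoly_sum ispoly_mult K Zp)
    ultimately show ?case
      using K(1,2) y(1) z(1) unip_mult[OF Kn Zu]
      by (intro exI[of _ "\<lambda>s. K s * Z s"]) (auto simp: Z_def)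
  qed
  with that show thesis by blast
qed

text \<open>On the curve from \<open>g\<close> to \<open>h\<close> both \<open>p\<close> and
  \<open>q\<close> are nonzero polynomials in the parameter, so all but finitely many parameters
  give a suitable point.\<close>

lemma LS_irreducible:
  assumes "g \<in> LS X n" "h \<in> LS X n" "p \<in> poly_funs n" "q \<in> poly_funs n" "p (ent g) \<noteq> 0" "q (ent h) \<noteq> 0"
  obtains k where "k \<in> LS X n" "p (ent k) \<noteq> 0" "q (ent k) \<noteq> 0"
proof -
  obtain K where K: "K 0 = g" "K 1 = h" "\<And>i j. ispoly (\<lambda>s. ent (K s) i j)" "finite {s. K s \<notin> LS X n}"
    using LS_curve[OF assms(1,2)] by metis
  have "finite {s. p (ent (K s)) = 0}"
    by (rule ispoly_finite_zeros[where a = 0]) (use K assms ispoly_poly_fun[OF assms(3) K(3)] in auto)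
  moreover have "finite {s. q (ent (K s)) = 0}"
    by (rule ispoly_finite_zeros[where a = 1]) (use K assms ispoly_poly_fun[OF assms(4) K(3)] in auto)
  ultimately have "finite ({s. p (ent (K s)) = 0} \<union> {s. q (ent (K s)) = 0} \<union> {s. K s \<notin> LS X n})"
    using K(4) by simp
  from ex_new_if_finite[OF infinite_UNIV_char_0 this] show thesis using that by auto
qed

lemma openin_ind_topology:
  assumes X: "sreg X" and V: "openin (ind_topology X (A_orbit X)) V"
  obtains S where "S \<subseteq> poly_funs n" "\<And>g. g \<in> LS X n \<Longrightarrow> AD g X \<in> V \<longleftrightarrow> (\<exists>p\<in>S. p (ent g) \<noteq> 0)"
proof -
  let ?L = "A_orbit X \<inter> G_orbit n X"
  have top: "topspace (subtopology (zariski_orbit n X) ?L) = ?L"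
    by (auto simp: topspace_zariski_orbit)
  have "openin (subtopology (zariski_orbit n X) ?L) {x \<in> topspace (subtopology (zariski_orbit n X) ?L). x \<in> V}"
    using V unfolding ind_topology_def openin_final_topology by blast
  then have "openin (subtopology (zariski_orbit n X) ?L) {x \<in> ?L. x \<in> V}"
    by (simp only: top)
  then obtain T where T: "openin (zariski_orbit n X) T" "{x \<in> ?L. x \<in> V} = T \<inter> ?L"
    unfolding openin_subtopology by blast
  obtain S where S: "S \<subseteq> poly_funs n" "\<forall>g\<in>GU n. AD g X \<in> T \<longleftrightarrow> (\<exists>p\<in>S. p (ent g) \<noteq> 0)"
    using T(1) unfolding openin_zariski_orbit by blast
  show thesis
  proof (rule that[OF S(1)])
    fix g assume g: "g \<in> LS X n"
    then have "AD g X \<in> ?L" unfolding A_orbit_Int_G_orbit[OF X] by blast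
    then have "AD g X \<in> V \<longleftrightarrow> AD g X \<in> T" using T(2) by blast
    then show "AD g X \<in> V \<longleftrightarrow> (\<exists>p\<in>S. p (ent g) \<noteq> 0)" using S(2) LS_GU[OF g] by blast
  qed
qed

text \<open>The sets \<open>L_n\<close> increase, so points of two nonempty open sets lie in a
  common \<open>L_N\<close>, where the two open sets meet.\<close>

theorem irreducible_A_orbit:
  assumes X: "sreg X"
  shows "irreducible_top (ind_topology X (A_orbit X))"
proof -
  let ?T = "ind_topology X (A_orbit X)" and ?L = "A_orbit X"
  have "openin ?T ?L" unfolding ind_topology_def openin_final_topology
  proof (intro conjI ballI subset_refl)
    fix n
    have "{x \<in> topspace (subtopology (zariski_orbit n X) (?L \<inter> G_orbit n X)). x \<in> ?L}
        = topspace (subtopology (zariski_orbit n X) (?L \<inter> G_orbit n X))" by auto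
    then show "openin (subtopology (zariski_orbit n X) (?L \<inter> G_orbit n X))
        {x \<in> topspace (subtopology (zariski_orbit n X) (?L \<inter> G_orbit n X)). x \<in> ?L}"
      by (simp only: openin_topspace)
  qed
  moreover have "topspace ?T \<subseteq> ?L"
    using openin_topspace[of ?T] unfolding ind_topology_def openin_final_topology by blast
  ultimately have top: "topspace ?T = ?L" using openin_subset by blast
  have "AD 1 X \<in> ?L" unfolding A_orbit_LS[OF X] by (auto intro!: exI[of _ 0])
  moreover have False
    if C: "closedin ?T C" and D: "closedin ?T D" and CD: "C \<union> D = ?L" and ne: "C \<noteq> ?L" "D \<noteq> ?L" for C D
  proof -
    obtain x y where xy: "x \<in> ?L" "x \<notin> C" "y \<in> ?L" "y \<notin> D" using CD ne by blast
    then obtain n g m h where gh: "x = AD g X" "g \<in> LS X n" "y = AD h X" "h \<in> LS X m"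
      unfolding A_orbit_LS[OF X] by blast
    define N where "N = max n m"
    have g: "g \<in> LS X N" and h: "h \<in> LS X N"
      using gh LS_mono[of n N X] LS_mono[of m N X] by (auto simp: N_def)
    have oC: "openin ?T (?L - C)" and oD: "openin ?T (?L - D)" using C D top unfolding closedin_def by auto
    obtain S where S: "S \<subseteq> poly_funs N" "\<And>g. g \<in> LS X N \<Longrightarrow> AD g X \<in> ?L - C \<longleftrightarrow> (\<exists>p\<in>S. p (ent g) \<noteq> 0)"
      using openin_ind_topology[OF X oC, where n = N] by metis
    obtain S' where S': "S' \<subseteq> poly_funs N" "\<And>g. g \<in> LS X N \<Longrightarrow> AD g X \<in> ?L - D \<longleftrightarrow> (\<exists>p\<in>S'. p (ent g) \<noteq> 0)"
      using openin_ind_topology[OF X oD, where n = N] by metis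
    obtain p where p: "p \<in> S" "p (ent g) \<noteq> 0" using S(2)[OF g] xy gh by blast
    obtain q where q: "q \<in> S'" "q (ent h) \<noteq> 0" using S'(2)[OF h] xy gh by blast
    have "p \<in> poly_funs N" "q \<in> poly_funs N" using p q S S' by auto
    from LS_irreducible[OF g h this p(2) q(2)] obtain k
      where k: "k \<in> LS X N" "p (ent k) \<noteq> 0" "q (ent k) \<noteq> 0" by blast
    then have "AD k X \<in> ?L - C" "AD k X \<in> ?L - D" using S(2) S'(2) p(1) q(1) by blast+
    then show False using CD by blast
  qed
  ultimately show ?thesis unfolding irreducible_top_def top by blast
qed

section \<open>The Lagrangian property\<close>

lemma pad_ent: "A \<in> glr n \<Longrightarrow> pad n (ent A) = A"
  by (rule rcmat_eqI) (auto simp: ent_pad glr_ent not_less)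

lemma gl_eq_glr: "gl n = ent ` glr n"
proof
  show "ent ` glr n \<subseteq> gl n" by (auto simp: gl_def glr_def)
  show "gl n \<subseteq> ent ` glr n"
  proof
    fix A assume "A \<in> gl n"
    then have "A = ent (pad n A)" by (intro ext) (auto simp: gl_def ent_pad not_less)
    then show "A \<in> ent ` glr n" using pad_glr by blast
  qed
qed

lemma gl_inf_eq: "gl_inf = ent ` (\<Union>n. glr n)"
  by (auto simp: gl_inf_def gl_eq_glr)

lemma gl_exp_eq: "gl_exp n (\<lambda>i j. s * ent A i j) = ent (fexp (sc s * A))" if "A \<in> glr n"
proof -
  have "rm n (corner n (\<lambda>i j. s * ent A i j)) = sc s * A"
    unfolding rm_corner using that by (intro rcmat_eqI) (auto simp: ent_pad glr_ent not_less)
  then show ?thesis unfolding gl_exp_def by (simp add: GL_embed_mat_exp)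
qed

text \<open>A one-parameter group in a trivial stabilizer is constant, so its derivative vanishes.
  Tangent classes are therefore singletons, and \<open>gl(\<infinity>)\<close> itself serves as the
  tangent space.\<close>

lemma gl_inf_stab_trivial:
  assumes Y: "sreg Y"
  shows "gl_inf_stab Y = {\<lambda>i j. 0}"
proof
  show "gl_inf_stab Y \<subseteq> {\<lambda>i j. 0}"
  proof
    fix A assume "A \<in> gl_inf_stab Y"
    then obtain n where n: "A \<in> gl n" "\<And>s. gl_exp n (\<lambda>i j. s * A i j) \<in> stab n Y"
      by (auto simp: gl_inf_stab_def lie_algebra_def)
    then obtain B where B: "A = ent B" "B \<in> glr n" unfolding gl_eq_glr by blast
    have "fexp (sc s * B) = 1" for s
    proof -
      have g: "fexp (sc s * B) \<in> GU n" by (intro fexp_GU glr_sc B)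
      have "ent (fexp (sc s * B)) \<in> stab n Y" using n(2)[of s] gl_exp_eq[OF B(2)] B(1) by simp
      then have "AD (fexp (sc s * B)) Y = AD 1 Y" by (simp add: stab_def Ad_ent[OF g] AD_one)
      then show ?thesis by (rule AD_inj[OF Y g GU_one])
    qed
    then have "ent B i j = 0" for i j
      using fexp_has_derivative_0[OF B(2), of i j] DERIV_unique[OF _ DERIV_const] by simp
    then show "A \<in> {\<lambda>i j. 0}" using B(1) by auto
  qed
  have "(\<lambda>i j. 0) = ent 0" by (intro ext) simp
  moreover have "ent 0 \<in> gl_inf_stab Y"
    unfolding gl_inf_stab_def lie_algebra_def
    using gl_exp_eq[OF glr_zero[of 0]] GU_one[of 0] Ad_ent[OF GU_one[of 0], of Y]
    by (auto simp: gl_eq_glr glr_zero stab_def AD_one GL_eq_GU intro!: exI[of _ 0])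
  ultimately show "{\<lambda>i j. 0} \<subseteq> gl_inf_stab Y" by simp
qed

lemma tangent_class_eq:
  assumes "sreg Y" "A \<in> glr n"
  shows "tangent_class Y (ent A) = {ent A}"
proof -
  have "ent A \<in> gl_inf" using assms(2) by (auto simp: gl_inf_eq)
  moreover have "B = ent A" if "(\<lambda>i j. B i j - ent A i j) = (\<lambda>i j. 0)" for B
    using fun_cong[OF fun_cong[OF that]] by (intro ext) simp
  ultimately show ?thesis
    unfolding tangent_class_def gl_inf_stab_trivial[OF assms(1)] by auto
qed

lemma tangent_orbit_eq:
  assumes "sreg Y"
  shows "tangent_orbit Y = {{ent A} | A n. A \<in> glr n}"
proof -
  have "tangent_orbit Y = (\<Union>n. (\<lambda>A. tangent_class Y (ent A)) ` glr n)"
    by (auto simp: tangent_orbit_def gl_inf_eq)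
  also have "\<dots> = (\<Union>n. (\<lambda>A. {ent A}) ` glr n)"
    using tangent_class_eq[OF assms] by (intro SUP_cong image_cong refl) blast
  finally show ?thesis by blast
qed

lemma omega_eq:
  assumes "A \<in> glr n" "B \<in> glr n"
  shows "omega Y {ent A} {ent B} = kk_form n Y A B"
proof -
  have val: "mtrace (corner m Y * (corner m (ent A) * corner m (ent B) - corner m (ent B) * corner m (ent A)))
      = kk_form m Y A B" if "A \<in> glr m" "B \<in> glr m" for m
  proof -
    let ?a = "corner m (ent A)" and ?b = "corner m (ent B)"
    have ab: "?a * ?b \<in> carrier_mat m m" "?b * ?a \<in> carrier_mat m m"
      by (rule mult_carrier_mat[OF corner_carrier corner_carrier])+
    have d: "?a * ?b - ?b * ?a \<in> carrier_mat m m" by (rule minus_carrier_mat[OF ab(2)])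
    show ?thesis
      unfolding kk_form_def mtrace_rm[OF mult_carrier_mat[OF corner_carrier d]] rm_mult[OF corner_carrier d]
        rm_diff[OF ab] rm_mult[OF corner_carrier corner_carrier] rm_corner that[THEN pad_ent] ..
  qed
  have in_gl: "ent C \<in> gl m \<longleftrightarrow> C \<in> glr m" for C m by (simp add: gl_def glr_def)
  have eq: "kk_form m Y A B = kk_form n Y A B" if "A \<in> glr m" "B \<in> glr m" for m
    using kk_form_stable[OF assms, of "max m n"] kk_form_stable[OF that, of "max m n"] by simp
  show ?thesis
    unfolding omega_def
  proof (rule the_equality)
    show "\<exists>n'. \<exists>a\<in>{ent A} \<inter> gl n'. \<exists>b\<in>{ent B} \<inter> gl n'. kk_form n Y A B =
        mtrace (corner n' Y * (corner n' a * corner n' b - corner n' b * corner n' a))"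
      using assms val[OF assms] in_gl by (intro exI[of _ n] bexI[of _ "ent A"] bexI[of _ "ent B"]) auto
    fix c assume "\<exists>n'. \<exists>a\<in>{ent A} \<inter> gl n'. \<exists>b\<in>{ent B} \<inter> gl n'. c =
        mtrace (corner n' Y * (corner n' a * corner n' b - corner n' b * corner n' a))"
    then obtain m where "A \<in> glr m" "B \<in> glr m"
      "c = mtrace (corner m Y * (corner m (ent A) * corner m (ent B) - corner m (ent B) * corner m (ent A)))"
      using in_gl by auto
    then show "c = kk_form n Y A B" using val eq by simp
  qed
qed

text \<open>A chain rule at \<open>G\<close> with coefficients that do not depend on the curve. It
  records that the derivative of \<open>p\<close> is linear in the velocity, without calculus on a
  space of infinite matrices.\<close>

definition entry_gradient :: "nat \<Rightarrow> rcmat \<Rightarrow> (infmat \<Rightarrow> complex) \<Rightarrow> infmat \<Rightarrow> bool" where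
  "entry_gradient n G p a \<longleftrightarrow>
    (\<forall>c D. c 0 = G \<and> (\<forall>i j. ((\<lambda>s. ent (c s) i j) has_field_derivative ent D i j) (at 0)) \<longrightarrow>
      ((\<lambda>s. p (ent (c s))) has_field_derivative (\<Sum>i<n. \<Sum>j<n. a i j * ent D i j)) (at 0))"

lemma entry_gradientD:
  assumes "entry_gradient n G p a" "c 0 = G"
    "\<And>i j. ((\<lambda>s. ent (c s) i j) has_field_derivative ent D i j) (at 0)"
  shows "((\<lambda>s. p (ent (c s))) has_field_derivative (\<Sum>i<n. \<Sum>j<n. a i j * ent D i j)) (at 0)"
  using assms unfolding entry_gradient_def by blast

lemma poly_fun_gradient:
  assumes "p \<in> poly_funs n"
  shows "\<exists>a. entry_gradient n G p a"
  using assms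
proof induction
  case (const c)
  then show ?case unfolding entry_gradient_def by (intro exI[of _ "\<lambda>_ _. 0"]) simp
next
  case (coord i j)
  have "(\<Sum>k<n. \<Sum>l<n. (if k = i \<and> l = j then 1 else 0) * v k l) = v i j" for v :: "nat \<Rightarrow> nat \<Rightarrow> complex"
  proof -
    have "(\<Sum>k<n. \<Sum>l<n. (if k = i \<and> l = j then 1 else 0) * v k l)
        = (\<Sum>k<n. \<Sum>l<n. if l = j then (if k = i then v k l else 0) else 0)"
      by (intro sum.cong refl) auto
    then show ?thesis using coord by simp
  qed
  then show ?case unfolding entry_gradient_def
    by (intro exI[of _ "\<lambda>k l. if k = i \<and> l = j then 1 else 0"]) simp
next
  case (add p q)
  then obtain a b where ab: "entry_gradient n G p a" "entry_gradient n G q b" by blast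
  have eq: "(\<Sum>i<n. \<Sum>j<n. (a i j + b i j) * ent D i j)
      = (\<Sum>i<n. \<Sum>j<n. a i j * ent D i j) + (\<Sum>i<n. \<Sum>j<n. b i j * ent D i j)" for D
    by (simp add: distrib_right sum.distrib)
  have "entry_gradient n G (\<lambda>g. p g + q g) (\<lambda>i j. a i j + b i j)"
    unfolding entry_gradient_def eq
    by (intro allI impI DERIV_add entry_gradientD[OF ab(1)] entry_gradientD[OF ab(2)]) auto
  then show ?case by blast
next
  case (mult p q)
  then obtain a b where ab: "entry_gradient n G p a" "entry_gradient n G q b" by blast
  have eq: "(\<Sum>i<n. \<Sum>j<n. (a i j * q (ent G) + b i j * p (ent G)) * ent D i j)
      = (\<Sum>i<n. \<Sum>j<n. a i j * ent D i j) * q (ent G) + (\<Sum>i<n. \<Sum>j<n. b i j * ent D i j) * p (ent G)" for D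
    unfolding sum_distrib_right sum.distrib[symmetric] by (intro sum.cong refl) (simp add: algebra_simps)
  have "entry_gradient n G (\<lambda>g. p g * q g) (\<lambda>i j. a i j * q (ent G) + b i j * p (ent G))"
    unfolding entry_gradient_def eq
  proof (intro allI impI)
    fix c D
    assume "c 0 = G \<and> (\<forall>i j. ((\<lambda>s. ent (c s) i j) has_field_derivative ent D i j) (at 0))"
    then show "((\<lambda>s. p (ent (c s)) * q (ent (c s))) has_field_derivative
      (\<Sum>i<n. \<Sum>j<n. a i j * ent D i j) * q (ent G) + (\<Sum>i<n. \<Sum>j<n. b i j * ent D i j) * p (ent G)) (at 0)"
      using DERIV_mult[OF entry_gradientD[OF ab(1)] entry_gradientD[OF ab(2)], of c D c D] by auto
  qed
  then show ?case by blast
qed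

lemma flow_deriv:
  assumes "A \<in> glr n" "g \<in> GU n"
  shows "mat_deriv n (\<lambda>s. fexp (sc s * A) * g) (A * g)"
  using mat_deriv_mult[OF mat_deriv_fexp[OF assms(1)] mat_deriv_const[OF unip_banded[OF GU_minus_one[OF assms(2)]]]]
  by simp

lemma cent_sc: "A \<in> cent Y i \<Longrightarrow> sc s * A \<in> cent Y i"
  by (auto simp: cent_def glr_sc mult.assoc sc_left_commute[of "pad _ _"])

text \<open>For \<open>B\<close> in a single centralizer, the flow
  \<open>fexp (sc s * B) * g\<close> stays in \<open>L_n\<close> by \<open>LS_flow\<close>, so the
  local numerator \<open>p\<close> of \<open>f\<close> vanishes along it. For a sum \<open>A\<close>
  of such elements the flow need not stay in \<open>L_n\<close>; the derivative of \<open>p\<close>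
  vanishes because it is linear in the velocity.\<close>

lemma Vsp_tangent:
  assumes X: "sreg X" and g: "g \<in> LS X n" and A: "A \<in> Vsp (AD g X) n"
    and U: "AD g X \<in> U" and f: "regular_fun_orbit n X U f"
    and f0: "\<And>Z. Z \<in> A_orbit X \<inter> G_orbit n X \<Longrightarrow> Z \<in> U \<Longrightarrow> f Z = 0"
  shows "((\<lambda>s. f (AD (fexp (sc s * A)) (AD g X))) has_field_derivative 0) (at 0)"
proof -
  let ?Y = "AD g X"
  have gG: "g \<in> GU n" by (rule LS_GU[OF g])
  have "ent g \<in> {g \<in> GL n. Ad g X \<in> U}" using U gG by (auto simp: GL_eq_GU Ad_ent)
  then obtain W p q where W: "openin (zariski_GL n) W" "ent g \<in> W" "W \<subseteq> {g \<in> GL n. Ad g X \<in> U}"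
    and pq: "p \<in> poly_funs n" "q \<in> poly_funs n" "\<And>h. h \<in> W \<Longrightarrow> q h \<noteq> 0 \<and> f (Ad h X) = p h / q h"
    using f unfolding regular_fun_orbit_def regular_fun_GL_def by blast
  obtain S where S: "S \<subseteq> poly_funs n" "W = {g \<in> GL n. \<exists>r\<in>S. r g \<noteq> 0}"
    using W(1) unfolding openin_zariski_GL by blast
  obtain r where r: "r \<in> S" "r (ent g) \<noteq> 0" using W(2) S(2) by blast
  have rp: "r \<in> poly_funs n" using r S by blast
  obtain ap aq ar where grad: "entry_gradient n g p ap" "entry_gradient n g q aq" "entry_gradient n g r ar"
    using poly_fun_gradient pq(1,2) rp by metis
  note ap = entry_gradientD[OF grad(1)] and aq = entry_gradientD[OF grad(2)] and ar = entry_gradientD[OF grad(3)]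
  define c where "c B s = fexp (sc s * B) * g" for B s
  have c0: "c B 0 = g" for B by (simp add: c_def)
  have cd: "((\<lambda>s. ent (c B s) i j) has_field_derivative ent (B * g) i j) (at 0)" if "B \<in> glr n" for B i j
    using flow_deriv[OF that gG] by (simp add: mat_deriv_def c_def)
  have cG: "c B s \<in> GU n" if "B \<in> glr n" for B s
    unfolding c_def by (intro GU_mult fexp_GU glr_sc that gG)
  \<comment> \<open>\<open>r\<close> is nonzero at \<open>g\<close>, so by continuity every flow
    stays in \<open>W\<close> for small \<open>s\<close>.\<close>
  have cW: "\<forall>\<^sub>F s in at 0. ent (c B s) \<in> W" if B: "B \<in> glr n" for B
  proof -
    have "isCont (\<lambda>s. r (ent (c B s))) 0" using ar[of "c B", OF c0 cd[OF B]] by (rule DERIV_isCont)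
    then have "((\<lambda>s. r (ent (c B s))) \<longlongrightarrow> r (ent g)) (at 0)" by (simp add: isCont_def c0)
    then have "\<forall>\<^sub>F s in at 0. r (ent (c B s)) \<noteq> 0" using r(2) by (rule tendsto_imp_eventually_ne)
    then show ?thesis by eventually_elim (use r(1) cG[OF B] in \<open>auto simp: S(2) GL_eq_GU\<close>)
  qed
  have fc: "f (AD (c B s) X) = p (ent (c B s)) / q (ent (c B s))" "q (ent (c B s)) \<noteq> 0" "AD (c B s) X \<in> U"
    if "B \<in> glr n" "ent (c B s) \<in> W" for B s
    using pq(3)[OF that(2)] W(3) that Ad_ent[OF cG[OF that(1)]] by auto
  have gW: "ent (c 0 0) \<in> W" using W(2) by (simp add: c0)
  have p0: "p (ent g) = 0" "q (ent g) \<noteq> 0"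
  proof -
    have "f ?Y = 0" using f0[OF _ U] g unfolding A_orbit_Int_G_orbit[OF X] by blast
    then show "p (ent g) = 0" "q (ent g) \<noteq> 0"
      using fc[OF glr_zero gW] by (auto simp: c0)
  qed
  have zero: "(\<Sum>i<n. \<Sum>j<n. ap i j * ent (B * g) i j) = 0" if B: "B \<in> cent ?Y k" "k \<le> n" for B k
  proof -
    have Bg: "B \<in> glr n" by (rule cent_glr[OF B])
    have "\<forall>\<^sub>F s in at 0. p (ent (c B s)) = 0"
      using cW[OF Bg]
    proof eventually_elim
      case (elim s)
      have "c B s \<in> LS X n" unfolding c_def by (rule LS_flow[OF g B(2) cent_sc[OF B(1)]])
      then have "f (AD (c B s) X) = 0"
        using f0[OF _ fc(3)[OF Bg elim]] unfolding A_orbit_Int_G_orbit[OF X] by blast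
      then show ?case using fc[OF Bg elim] by simp
    qed
    then have "\<forall>\<^sub>F s in nhds 0. p (ent (c B s)) = 0"
      using p0 by (simp add: eventually_nhds_conv_at c0)
    then have "((\<lambda>s. p (ent (c B s))) has_field_derivative 0) (at 0)"
      by (subst DERIV_cong_ev[OF refl _ refl]) auto
    then show ?thesis using ap[of "c B", OF c0 cd[OF Bg]] DERIV_unique by blast
  qed
  have Ag: "A \<in> glr n" by (rule Vsp_glr[OF A])
  obtain B where B: "A = (\<Sum>k\<le>n. B k)" "\<And>k. k \<le> n \<Longrightarrow> B k \<in> cent ?Y k" using A by (auto simp: Vsp_def)
  have "(\<Sum>i<n. \<Sum>j<n. ap i j * ent (A * g) i j) = (\<Sum>k\<le>n. \<Sum>i<n. \<Sum>j<n. ap i j * ent (B k * g) i j)"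
    by (simp add: B(1) sum_distrib_right sum_distrib_left) (simp add: sum.swap[of _ "{..n}"])
  also have "\<dots> = 0" using zero[OF B(2)] by (intro sum.neutral) simp
  finally have "((\<lambda>s. p (ent (c A s))) has_field_derivative 0) (at 0)"
    using ap[of "c A", OF c0 cd[OF Ag]] by simp
  \<comment> \<open>\<open>p\<close> and its derivative along the flow both vanish at
    \<open>s = 0\<close>, which leaves nothing in the quotient rule.\<close>
  then have "((\<lambda>s. p (ent (c A s)) / q (ent (c A s))) has_field_derivative 0) (at 0)"
    using DERIV_divide[of "\<lambda>s. p (ent (c A s))" 0 0 UNIV "\<lambda>s. q (ent (c A s))", OF _ aq[of "c A", OF c0 cd[OF Ag]]] p0
    by (simp add: c0)
  moreover have "\<forall>\<^sub>F s in nhds 0. f (AD (c A s) X) = p (ent (c A s)) / q (ent (c A s))"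
  proof -
    have "\<forall>\<^sub>F s in at 0. f (AD (c A s) X) = p (ent (c A s)) / q (ent (c A s))"
      using cW[OF Ag] by eventually_elim (rule fc(1)[OF Ag])
    moreover have "f (AD (c A 0) X) = p (ent (c A 0)) / q (ent (c A 0))"
      using fc(1)[OF Ag, of 0] W(2) by (simp add: c0)
    ultimately show ?thesis by (simp add: eventually_nhds_conv_at)
  qed
  ultimately have "((\<lambda>s. f (AD (c A s) X)) has_field_derivative 0) (at 0)"
    by (subst DERIV_cong_ev[OF refl _ refl])
  moreover have "AD (c A s) X = AD (fexp (sc s * A)) ?Y" for s
    unfolding c_def by (rule AD_mult[OF fexp_GU[OF glr_sc[OF Ag]] gG, symmetric])
  ultimately show ?thesis by simp
qed

text \<open>By \<open>pad_AD_LS\<close> the corner of size \<open>i\<close> is conjugated by an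
  element of \<open>GL(i)\<close>, even when \<open>n\<close> exceeds \<open>i\<close>.\<close>

lemma f_tr_constant:
  assumes "g \<in> LS X n"
  shows "f_tr i j (AD g X) = f_tr i j X"
proof (cases "i = 0 \<or> j = 0")
  case True
  then show ?thesis by (auto simp: f_tr_eq tr_def)
next
  case False
  then obtain m k' where ij: "i = Suc m" "j = Suc k'" by (metis not0_implies_Suc)
  obtain k where k: "k \<in> LS X m" "pad i (AD g X) = k * pad i X * rinv k"
    using pad_AD_LS[OF assms, of m] ij by blast
  have kG: "k \<in> GU i" using LS_GU[OF k(1)] ij GU_le[of k m i] by simp
  let ?M = "pad i X"
  have pw: "(k * ?M * rinv k) ^ l = k * ?M ^ l * rinv k" for l
    by (induction l) (simp_all add: GU_rinv[OF kG] mult.assoc GU_cancel[OF kG])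
  have "?M ^ j \<in> glr i" using glr_power[OF pad_glr] ij by simp
  then have "?M ^ j * rinv k \<in> glr i" by (intro unip_glr GU_minus_one GU_rinv(3) kG)
  then have "tr (?M ^ j * rinv k * k) i = tr (k * (?M ^ j * rinv k)) i" by (rule tr_commute)
  then show ?thesis
    unfolding f_tr_eq k(2) pw using GU_rinv(2)[OF kG] by (simp add: mult.assoc)
qed

lemma pad_AD_le:
  assumes "G \<in> GU n" "i \<le> n"
  shows "pad i (AD G X) = idn i * (G * pad n X * rinv G) * idn i"
  using pad_pad[OF assms(2), of "AD G X"] pad_AD[OF assms(1)] by simp

lemma rat_f_tr:
  assumes "i \<le> n" "H \<in> GU n"
  shows "rat n H (\<lambda>G. f_tr i j (AD G X))"
proof -
  let ?M = "\<lambda>G. idn i * (G * pad n X * rinv G) * idn i"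
  have "rmat n H ?M"
  proof (intro rmat_mult[where k = n] rmat_const rmat_id rmat_rinv assms)
    fix G assume G: "G \<in> GU n"
    show "banded n G" by (rule unip_banded[OF GU_minus_one[OF G]])
    show "banded n (idn i)" using glr_mono[OF assms(1)] by (intro glr_banded) auto
    show "banded n (G * pad n X)" by (intro glr_banded unip_glr GU_minus_one[OF G] pad_glr)
    have "idn i * (G * pad n X * rinv G) \<in> glr n"
      by (intro glr_mult unip_glr GU_minus_one[OF G] GU_minus_one[OF GU_rinv(3)[OF G]] pad_glr)
        (use glr_mono[OF assms(1)] in auto)
    then show "banded n (idn i * (G * pad n X * rinv G))" by (rule glr_banded)
  qed
  moreover have "banded i (?M G)" if "G \<in> GU n" for G
    using pad_AD_le[OF that assms(1), of X] pad_glr[of i "AD G X"] by (intro glr_banded) simp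
  ultimately have "rmat n H (\<lambda>G. ?M G ^ j)"
  proof (induction j)
    case (Suc j)
    then show ?case using rmat_mult[OF Suc(2,1) Suc(3)] by simp
  qed (simp add: rmat_const)
  then have "rat n H (\<lambda>G. tr (?M G ^ j) i)"
    unfolding tr_def rmat_def by (intro rat_sum) auto
  then show ?thesis
    by (rule rat_cong_GU) (simp add: f_tr_eq pad_AD_le[OF _ assms(1)])
qed

lemma regular_f_tr:
  assumes "i \<le> n"
  shows "regular_fun_orbit n X (G_orbit n X) (\<lambda>Z. f_tr i j Z - c)"
  unfolding regular_fun_orbit_def regular_fun_GL_def
proof (intro conjI ballI)
  show "openin (zariski_orbit n X) (G_orbit n X)"
    using openin_topspace[of "zariski_orbit n X"] by (simp add: topspace_zariski_orbit)
  fix h assume "h \<in> {g \<in> GL n. Ad g X \<in> G_orbit n X}"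
  then obtain H where H: "h = ent H" "H \<in> GU n" by (auto simp: GL_eq_GU)
  have "rat n H (\<lambda>G. f_tr i j (AD G X) + - c)" by (intro rat_add rat_const rat_f_tr assms H)
  then obtain p q where pq: "p \<in> poly_funs n" "q \<in> poly_funs n" "q (ent H) \<noteq> 0"
    "\<And>G. G \<in> GU n \<Longrightarrow> q (ent G) \<noteq> 0 \<Longrightarrow> f_tr i j (AD G X) + - c = p (ent G) / q (ent G)"
    unfolding rat_def rat_rep_def by blast
  let ?W = "{g \<in> GL n. \<exists>r\<in>{q}. r g \<noteq> 0}"
  show "\<exists>W p q. openin (zariski_GL n) W \<and> h \<in> W \<and> W \<subseteq> {g \<in> GL n. Ad g X \<in> G_orbit n X} \<and>
      p \<in> poly_funs n \<and> q \<in> poly_funs n \<and> (\<forall>h\<in>W. q h \<noteq> 0 \<and> f_tr i j (Ad h X) - c = p h / q h)"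
  proof (rule exI[of _ ?W], rule exI[of _ p], rule exI[of _ q], intro conjI pq(1,2))
    show "openin (zariski_GL n) ?W" unfolding openin_zariski_GL using pq(2) by blast
    show "h \<in> ?W" using H pq(3) by (auto simp: GL_eq_GU)
    show "?W \<subseteq> {g \<in> GL n. Ad g X \<in> G_orbit n X}" by (auto simp: G_orbit_def)
    show "\<forall>k\<in>?W. q k \<noteq> 0 \<and> f_tr i j (Ad k X) - c = p k / q k"
    proof
    fix k assume "k \<in> ?W"
    then obtain K where "k = ent K" "K \<in> GU n" "q k \<noteq> 0" by (auto simp: GL_eq_GU)
    then show "q k \<noteq> 0 \<and> f_tr i j (Ad k X) - c = p k / q k" using pq(4)[of K] by (simp add: Ad_ent)
    qed
  qed
qed

text \<open>\<open>A\<close> moves \<open>Y_n\<close> with velocity \<open>[A, Y_n]\<close>, which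
  gives \<open>(j + 1) tr(Y_i^j [A, Y_n])\<close>: up to sign and scale, \<open>Y_i^j\<close> is the
  Hamiltonian direction of \<open>f_(i,j+1)\<close>.\<close>

lemma f_tr_flow_deriv:
  assumes A: "A \<in> glr n" and i: "i \<le> n"
  shows "((\<lambda>s. f_tr i (Suc j) (AD (fexp (sc s * A)) Y)) has_field_derivative
    of_nat (Suc j) * kk_form n Y (cpow Y i j) A) (at 0)"
proof -
  let ?Yn = "pad n Y"
  let ?D = "idn i * (A * ?Yn - ?Yn * A) * idn i"
  have g: "fexp (sc s * A) \<in> GU n" for s by (intro fexp_GU glr_sc A)
  have inv: "rinv (fexp (sc s * A)) = fexp (sc s * - A)" for s
    using fexp_minus[OF glr_sc[OF A, of s]] by (intro rinv_eq) simp_all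
  define M where "M s = idn i * (fexp (sc s * A) * ?Yn * fexp (sc s * - A)) * idn i" for s
  have M: "pad i (AD (fexp (sc s * A)) Y) = M s" for s
    unfolding pad_AD_le[OF g i] inv M_def ..
  have idn_b: "mat_deriv n (\<lambda>_. idn i) 0"
    using glr_mono[OF i] by (intro mat_deriv_const glr_banded) auto
  have d1: "mat_deriv n (\<lambda>s. fexp (sc s * A) * ?Yn) (A * ?Yn)"
    using mat_deriv_mult[OF mat_deriv_fexp[OF A] mat_deriv_const[OF glr_banded[OF pad_glr]]] by simp
  have d2: "mat_deriv n (\<lambda>s. fexp (sc s * A) * ?Yn * fexp (sc s * - A)) (A * ?Yn - ?Yn * A)"
    using mat_deriv_mult[OF d1 mat_deriv_fexp[OF glr_uminus[OF A]]] by simp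
  have d3: "mat_deriv n (\<lambda>s. idn i * (fexp (sc s * A) * ?Yn * fexp (sc s * - A))) (idn i * (A * ?Yn - ?Yn * A))"
    using mat_deriv_mult[OF idn_b d2] by simp
  have "mat_deriv n M ?D"
    unfolding M_def using mat_deriv_mult[OF d3 idn_b] by simp
  moreover have Mg: "M s \<in> glr i" for s unfolding M[symmetric] by simp
  ultimately have "mat_deriv i M ?D" by (simp add: mat_deriv_def glr_banded)
  moreover have Dg: "?D \<in> glr i" unfolding glr_iff by (simp add: mult.assoc)
  ultimately have "((\<lambda>s. tr (M s ^ Suc j) i) has_field_derivative of_nat (Suc j) * tr (M 0 ^ j * ?D) i) (at 0)"
    using tr_power_deriv[of i M ?D "Suc j"] Mg by simp
  moreover have "M 0 = pad i Y" unfolding M_def using pad_pad[OF i, of Y] by simp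
  moreover have "tr (pad i Y ^ j * ?D) i = kk_form n Y (cpow Y i j) A"
  proof -
    have "tr (pad i Y ^ j * ?D) i = tr (cpow Y i j * ?D) i"
      unfolding cpow_def mult.assoc by (simp add: tr_def ent_idn_mult)
    also have "\<dots> = tr (cpow Y i j * (A * ?Yn - ?Yn * A)) n" by (rule tr_corner[OF cpow_glr i, symmetric])
    also have "\<dots> = kk_form n Y (cpow Y i j) A"
      using cent_glr[OF cpow_cent i] by (rule kk_form_alt[OF _ A, symmetric])
    finally show ?thesis .
  qed
  ultimately show ?thesis unfolding f_tr_eq M by simp
qed

theorem tangent_sub_eq:
  assumes X: "sreg X" and g: "g \<in> LS X n"
  shows "tangent_sub n X (A_orbit X \<inter> G_orbit n X) (AD g X) = {{ent A} | A. A \<in> Vsp (AD g X) n}"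
proof -
  let ?Y = "AD g X" and ?L = "A_orbit X \<inter> G_orbit n X"
  have Y: "sreg ?Y" by (rule sreg_AD[OF X g])
  have gG: "g \<in> GU n" by (rule LS_GU[OF g])
  define Q where "Q A \<longleftrightarrow> (\<forall>U f. ?Y \<in> U \<and> regular_fun_orbit n X U f \<and> (\<forall>Z\<in>?L \<inter> U. f Z = 0) \<longrightarrow>
      ((\<lambda>s. f (AD (fexp (sc s * A)) ?Y)) has_field_derivative 0) (at 0))" for A
  have flow: "Ad (gl_exp n (\<lambda>i j. s * ent A i j)) ?Y = AD (fexp (sc s * A)) ?Y" if "A \<in> glr n" for A s
    unfolding gl_exp_eq[OF that] by (rule Ad_ent[of _ n]) (intro fexp_GU glr_sc that)
  define R where "R A \<longleftrightarrow> (\<forall>U f. ?Y \<in> U \<and> regular_fun_orbit n X U f \<and> (\<forall>Z\<in>?L \<inter> U. f Z = 0) \<longrightarrow>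
      ((\<lambda>s. f (Ad (gl_exp n (\<lambda>i j. s * A i j)) ?Y)) has_field_derivative 0) (at 0))" for A
  have RQ: "R (ent A) \<longleftrightarrow> Q A" if "A \<in> glr n" for A
    unfolding R_def Q_def flow[OF that] ..
  have "tangent_sub n X ?L ?Y = tangent_class ?Y ` {A \<in> ent ` glr n. R A}"
    unfolding tangent_sub_def gl_eq_glr R_def ..
  also have "{A \<in> ent ` glr n. R A} = ent ` {A \<in> glr n. Q A}"
    using RQ by auto
  also have "{A \<in> glr n. Q A} = Vsp ?Y n"
  proof (intro equalityI subsetI)
    fix A assume A: "A \<in> Vsp ?Y n"
    have "Q A" unfolding Q_def
    proof (intro allI impI)
      fix U f assume Uf: "?Y \<in> U \<and> regular_fun_orbit n X U f \<and> (\<forall>Z\<in>?L \<inter> U. f Z = 0)"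
      show "((\<lambda>s. f (AD (fexp (sc s * A)) ?Y)) has_field_derivative 0) (at 0)"
        by (rule Vsp_tangent[OF X g A]) (use Uf in auto)
    qed
    then show "A \<in> {A \<in> glr n. Q A}" using Vsp_glr[OF A] by simp
  next
    fix A assume "A \<in> {A \<in> glr n. Q A}"
    then have A: "A \<in> glr n" "Q A" by auto
    show "A \<in> Vsp ?Y n"
    proof (rule Vsp_maximal[OF Y A(1)])
      fix i B assume i: "i \<le> n" and B: "B \<in> cent ?Y i"
      have cp: "kk_form n ?Y (cpow ?Y i j) A = 0" for j
      proof -
        \<comment> \<open>On \<open>L_n\<close> the function keeps its value at \<open>X\<close>;
          subtracting that value gives a test function that vanishes there.\<close>
        let ?f = "\<lambda>Z. f_tr i (Suc j) Z - f_tr i (Suc j) X"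
        have "?Y \<in> G_orbit n X" unfolding G_orbit_eq using gG by blast
        moreover have "\<forall>Z\<in>?L \<inter> G_orbit n X. ?f Z = 0"
          unfolding A_orbit_Int_G_orbit[OF X] by (auto simp: f_tr_constant)
        ultimately have "((\<lambda>s. ?f (AD (fexp (sc s * A)) ?Y)) has_field_derivative 0) (at 0)"
          using A(2)[unfolded Q_def, rule_format, of "G_orbit n X" ?f] regular_f_tr[OF i] by simp
        moreover have "((\<lambda>s. ?f (AD (fexp (sc s * A)) ?Y)) has_field_derivative
            of_nat (Suc j) * kk_form n ?Y (cpow ?Y i j) A - 0) (at 0)"
          by (intro DERIV_diff f_tr_flow_deriv A i DERIV_const)
        ultimately have "of_nat (Suc j) * kk_form n ?Y (cpow ?Y i j) A - 0 = 0" by (rule DERIV_unique[symmetric])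
        then show ?thesis by (simp del: of_nat_Suc)
      qed
      obtain c where c: "B = (\<Sum>j<i. sc (c j) * cpow ?Y i j)" using cent_span[OF sreg_nd[OF Y] B] by blast
      have sc_left: "kk_form n ?Y (sc a * C) A = a * kk_form n ?Y C A" for a C
        by (simp add: kk_form_def mult.assoc sc_left_commute[of A] sc_left_commute[of "pad _ _"]
            right_diff_distrib tr_diff tr_sc)
      have "kk_form n ?Y B A = 0"
        unfolding c kk_form_sum_left sc_left by (simp add: cp)
      then show "kk_form n ?Y A B = 0" using kk_form_antisym[of n ?Y A B] by simp
    qed
  qed
  also have "tangent_class ?Y ` ent ` Vsp ?Y n = (\<lambda>A. {ent A}) ` Vsp ?Y n"
    unfolding image_image using tangent_class_eq[OF Y Vsp_glr] by (intro image_cong refl)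
  finally show ?thesis by blast
qed

lemma Vsp_mono: "n \<le> m \<Longrightarrow> Vsp Y n \<subseteq> Vsp Y m"
proof
  fix A assume nm: "n \<le> m" and "A \<in> Vsp Y n"
  then obtain B where B: "A = (\<Sum>i\<le>n. B i)" "\<forall>i\<le>n. B i \<in> cent Y i" by (auto simp: Vsp_def)
  define C where "C i = (if i \<le> n then B i else 0)" for i
  have "(\<Sum>i\<le>m. C i) = (\<Sum>i\<le>n. C i)"
    using nm by (intro sum.mono_neutral_right) (auto simp: C_def)
  also have "\<dots> = A" unfolding B(1) by (intro sum.cong) (auto simp: C_def)
  finally have "A = (\<Sum>i\<le>m. C i)" ..
  moreover have "\<forall>i\<le>m. C i \<in> cent Y i" using B(2) by (auto simp: C_def cent_def glr_zero)
  ultimately show "A \<in> Vsp Y m" unfolding Vsp_def by blast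
qed

lemma cent_Vsp: "B \<in> cent Y i \<Longrightarrow> i \<le> n \<Longrightarrow> B \<in> Vsp Y n"
proof -
  assume B: "B \<in> cent Y i" "i \<le> n"
  have "B = (\<Sum>k\<le>n. if k = i then B else 0)" using B(2) by simp
  moreover have "\<forall>k\<le>n. (if k = i then B else 0) \<in> cent Y k" using B(1) by (auto simp: cent_def glr_zero)
  ultimately show ?thesis unfolding Vsp_def by (intro CollectI exI[of _ "\<lambda>k. if k = i then B else 0"]) simp
qed

lemma Vsp_isotropic_Vsp:
  assumes "A \<in> Vsp Y n" "B \<in> Vsp Y n"
  shows "kk_form n Y A B = 0"
proof -
  obtain C where C: "B = (\<Sum>i\<le>n. C i)" "\<And>i. i \<le> n \<Longrightarrow> C i \<in> cent Y i" using assms(2) by (auto simp: Vsp_def)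
  have "kk_form n Y (C i) A = 0" if "i \<le> n" for i
    using Vsp_isotropic[OF assms(1) that C(2)[OF that]] kk_form_antisym[of n Y "C i" A] by simp
  then have "kk_form n Y B A = 0" unfolding C(1) kk_form_sum_left by (intro sum.neutral) simp
  then show ?thesis using kk_form_antisym[of n Y A B] by simp
qed

theorem lagrangian_A_orbit:
  assumes X: "sreg X"
  shows "lagrangian X (A_orbit X)"
  unfolding lagrangian_def
proof
  fix Y assume YL: "Y \<in> A_orbit X"
  then obtain N g where g: "g \<in> LS X N" "Y = AD g X" unfolding A_orbit_LS[OF X] by blast
  have Y: "sreg Y" unfolding g(2) by (rule sreg_AD[OF X g(1)])
  let ?I = "{n. Y \<in> A_orbit X \<inter> G_orbit n X}"
  let ?T = "tangent_ind X (A_orbit X) Y"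
  have sub: "tangent_sub n X (A_orbit X \<inter> G_orbit n X) Y = {{ent A} | A. A \<in> Vsp Y n}" if n: "n \<in> ?I" for n
  proof -
    obtain h where "h \<in> LS X n" "Y = AD h X" using n unfolding A_orbit_Int_G_orbit[OF X] by blast
    then show ?thesis using tangent_sub_eq[OF X] by simp
  qed
  have T: "?T = {{ent A} | A n. n \<in> ?I \<and> A \<in> Vsp Y n}"
    unfolding tangent_ind_def using sub by (auto simp del: Int_iff)
  have N: "n \<in> ?I" if "N \<le> n" for n
    using LS_mono[OF that, of X] g unfolding A_orbit_Int_G_orbit[OF X] by blast
  show "?T = annihilator Y ?T"
  proof (intro equalityI subsetI)
    fix v assume "v \<in> ?T"
    then obtain A n where A: "v = {ent A}" "A \<in> Vsp Y n" unfolding T by blast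
    have "omega Y v w = 0" if w: "w \<in> ?T" for w
    proof -
      obtain B m where B: "w = {ent B}" "B \<in> Vsp Y m" using w unfolding T by blast
      have AB: "A \<in> Vsp Y (max n m)" "B \<in> Vsp Y (max n m)"
        using A B Vsp_mono[of n "max n m" Y] Vsp_mono[of m "max n m" Y] by auto
      then show ?thesis
        using omega_eq[OF Vsp_glr[OF AB(1)] Vsp_glr[OF AB(2)]] Vsp_isotropic_Vsp[OF AB] A(1) B(1) by simp
    qed
    moreover have "v \<in> tangent_orbit Y" unfolding tangent_orbit_eq[OF Y] using A Vsp_glr by blast
    ultimately show "v \<in> annihilator Y ?T" by (simp add: annihilator_def)
  next
    fix v assume v: "v \<in> annihilator Y ?T"
    then obtain A k where A: "v = {ent A}" "A \<in> glr k"
      unfolding annihilator_def tangent_orbit_eq[OF Y] by blast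
    \<comment> \<open>Large enough for \<open>A\<close> to lie in \<open>gl(n)\<close> and for
      \<open>Y\<close> to lie in the orbit of \<open>GL(n)\<close>, so that \<open>V\<close> at
      level \<open>n\<close> is part of the tangent space.\<close>
    define n where "n = max k N"
    have An: "A \<in> glr n" using A(2) glr_mono[of k n] by (auto simp: n_def)
    have nI: "n \<in> ?I" by (rule N) (simp add: n_def)
    have "A \<in> Vsp Y n"
    proof (rule Vsp_maximal[OF Y An])
      fix i B assume B: "i \<le> n" "B \<in> cent Y i"
      have BV: "B \<in> Vsp Y n" by (rule cent_Vsp[OF B(2,1)])
      then have "{ent B} \<in> ?T" unfolding T using nI by blast
      then have "omega Y {ent A} {ent B} = 0" using v A(1) unfolding annihilator_def by blast
      then show "kk_form n Y A B = 0" using omega_eq[OF An Vsp_glr[OF BV]] by simp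
    qed
    then show "v \<in> ?T" unfolding T A(1) using nI by blast
  qed
qed

theorem theorem1p2:
  fixes X :: infmat
  assumes "strongly_regular X"
  shows "ind_subvariety X (A_orbit X) \<and>
         irreducible_top (ind_topology X (A_orbit X)) \<and>
         lagrangian X (A_orbit X)"
  using strongly_regular_imp_sreg[OF assms] ind_subvariety_A_orbit irreducible_A_orbit lagrangian_A_orbit
  by blast

end
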